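(* Let $M$ be a smooth connected manifold of dimension $n>1$, let $F$ be a Finsler metric on $M$, and let $S$ be its geodesic spray, with associated horizontal projector $h$. Then $F$ has constant flag curvature if and only if the following three conditions hold: (1) $S$ is isotropic; and the curvature $1$-form $\xi$ of $S$ satisfies (2) $d_J\xi=0$; (3) $d_h\xi=0$. Moreover, condition (1) is always satisfied when $n=2$, and condition (3) is always satisfied (for isotropic $S$) when $n>2$.
   Context: $M$ is a smooth connected $n$-manifold, $n>1$; $TM$ is its tangent bundle with induced coordinates $(x^i,y^i)$, and $T_0M=TM\setminus\{0\}$ is the slit tangent bundle. $\mathcal{C}=y^i\frac{\partial}{\partial y^i}$ is the Liouville vector field and $J=\frac{\partial}{\partial y^i}\otimes dx^i$ is the vertical endomorphism. All objects are smooth on $T_0M$. A differential form on $T_0M$ is semi-basic if it vanishes whenever one of its arguments is vertical. For a $(1,1)$-tensor $K$ on $T_0M$, $i_K$ acts on functions by $i_Kf=0$ and on $p$-forms by $(i_K\omega)(X_1,\dots,X_p)=\sum_i\omega(X_1,\dots,KX_i,\dots,X_p)$, and $d_K:=i_K\circ d-d\circ i_K$ (so $d_Kf=df\circ K$ for functions). A spray is a smooth vector field $S$ on $T_0M$ with $JS=\mathcal{C}$ and $[\mathcal{C},S]=S$. With $[S,K]:=\mathcal{L}_SK$ for a $(1,1)$-tensor $K$, its horizontal and vertical projectors are $h=\frac12(\mathrm{Id}-[S,J])$ and $v=\frac12(\mathrm{Id}+[S,J])$. Its Jacobi endomorphism is $\Phi=v\circ[S,h]$, and its curvature is $R=\frac12[h,h]$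 (Frölicher–Nijenhuis bracket), i.e. $R(X,Y)=v[hX,hY]$. The Ricci scalar is $\rho=\frac1{n-1}\mathrm{Tr}(\Phi)$, where $\mathrm{Tr}(\Phi)=\Phi^i_i$ for $\Phi=\Phi^i_j\,\frac{\partial}{\partial y^i}\otimes dx^j$ (semi-basic trace). The spray $S$ is isotropic if there is a semi-basic $1$-form $\alpha$ on $T_0M$ with $\Phi=\rho J-\alpha\otimes\mathcal{C}$. For an isotropic spray, the curvature $1$-form is the semi-basic $1$-form $\xi=\frac13(\alpha+d_J\rho)$; it satisfies $R=\xi\wedge J-d_J\xi\otimes\mathcal{C}$, where $(\xi\wedge J)(X,Y)=\xi(X)JY-\xi(Y)JX$. A Finsler metric on $M$ is a continuous function $F:TM\to[0,\infty)$, smooth and positive on $T_0M$, positively $1$-homogeneous on the fibres, with $\left(\frac12\frac{\partial^2F^2}{\partial y^i\partial y^j}\right)$ positive definite on $T_0M$. Its geodesic spray $S$ is the unique spray with $i_S\,dd_JF^2=-dF^2$. $F$ has scalar flag curvature if there is a $0$-homogeneous function $\kappa\in C^\infty(T_0M)$ such that the Jacobi endomorphism of its geodesic spray is $\Phi=\kappa(F^2J-F\,d_JF\otimes\mathcal{C})$; it has constant (flag) curvature if moreover $\kappa$ is constant. *)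

theory Defs
  imports "HOL-Analysis.Analysis"
begin

section \<open>Smooth maps between open subsets of normed spaces\<close>

text \<open>Only used for open sets \<open>U\<close> of finite-dimensional spaces.\<close>

primrec Ck_on :: "nat \<Rightarrow> 'a::real_normed_vector set \<Rightarrow> ('a \<Rightarrow> 'b::real_normed_vector) \<Rightarrow> bool" where
  "Ck_on 0 U f \<longleftrightarrow> continuous_on U f"
| "Ck_on (Suc k) U f \<longleftrightarrow> (\<forall>x\<in>U. f differentiable (at x)) \<and>
     (\<forall>v. Ck_on k U (\<lambda>x. frechet_derivative f (at x) v))"

definition smooth_on :: "'a::real_normed_vector set \<Rightarrow> ('a \<Rightarrow> 'b::real_normed_vector) \<Rightarrow> bool" where
  "smooth_on U f \<longleftrightarrow> (\<forall>k. Ck_on k U f)"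


section \<open>Charts, atlases, tangent vectors\<close>

text \<open>A chart is a domain together with a coordinate map; the values of the map outside the
  domain are irrelevant.\<close>

type_synonym ('x, 'e) chart = "'x set \<times> ('x \<Rightarrow> 'e)"

abbreviation cdom :: "('x, 'e) chart \<Rightarrow> 'x set" where "cdom \<equiv> fst"

abbreviation cmap :: "('x, 'e) chart \<Rightarrow> 'x \<Rightarrow> 'e" where "cmap \<equiv> snd"

definition cimg :: "('x, 'e) chart \<Rightarrow> 'e set" where
  "cimg c = cmap c ` cdom c"

definition cinv :: "('x, 'e) chart \<Rightarrow> 'e \<Rightarrow> 'x" where
  "cinv c = inv_into (cdom c) (cmap c)"

definition transition :: "('x, 'e) chart \<Rightarrow> ('x, 'e) chart \<Rightarrow> 'e \<Rightarrow> 'e" where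
  "transition c c' = cmap c' \<circ> cinv c"

definition smooth_atlas :: "('m::topological_space, 'e::euclidean_space) chart set \<Rightarrow> bool" where
  "smooth_atlas A \<longleftrightarrow>
     (\<Union>c\<in>A. cdom c) = UNIV \<and>
     (\<forall>c\<in>A. open (cdom c) \<and> open (cimg c) \<and> homeomorphism (cdom c) (cimg c) (cmap c) (cinv c)) \<and>
     (\<forall>c\<in>A. \<forall>c'\<in>A. smooth_on (cmap c ` (cdom c \<inter> cdom c')) (transition c c'))"

definition carrier_of :: "('x, 'e) chart set \<Rightarrow> 'x set" where
  "carrier_of B = (\<Union>c\<in>B. cdom c)"

definition chart_at :: "('x, 'e) chart set \<Rightarrow> 'x \<Rightarrow> ('x, 'e) chart" where
  "chart_at B u = (SOME c. c \<in> B \<and> u \<in> cdom c)"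

text \<open>A tangent vector at \<open>u\<close> is the family of its components in all charts of the atlas
  around \<open>u\<close>, related by the Jacobians of the coordinate changes. Components with respect to
  charts not containing \<open>u\<close> are set to \<open>0\<close>, so that equality of tangent vectors is equality of
  functions.\<close>

type_synonym ('x, 'e) tvec = "('x, 'e) chart \<Rightarrow> 'e"

definition tangent_space ::
    "('x, 'e::euclidean_space) chart set \<Rightarrow> 'x \<Rightarrow> ('x, 'e) tvec set" where
  "tangent_space B u = {X.
     (\<forall>c. \<not> (c \<in> B \<and> u \<in> cdom c) \<longrightarrow> X c = 0) \<and>
     (\<forall>c\<in>B. \<forall>c'\<in>B. u \<in> cdom c \<and> u \<in> cdom c' \<longrightarrow>
        X c' = frechet_derivative (transition c c') (at (cmap c u)) (X c))}"

text \<open>The tangent vector at \<open>u\<close> with components \<open>w\<close> in the chart \<open>c\<close>. For fixed \<open>w\<close> and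
  varying \<open>u\<close> this is the coordinate vector field on the domain of \<open>c\<close> in the direction \<open>w\<close>.\<close>

definition coord_vec ::
    "('x, 'e::euclidean_space) chart set \<Rightarrow> ('x, 'e) chart \<Rightarrow> 'e \<Rightarrow> 'x \<Rightarrow> ('x, 'e) tvec" where
  "coord_vec B c w u = (\<lambda>c'. if c' \<in> B \<and> u \<in> cdom c'
     then frechet_derivative (transition c c') (at (cmap c u)) w else 0)"


section \<open>Calculus on a manifold given by an atlas\<close>

text \<open>Throughout, \<open>B\<close> is the atlas of the manifold. Fields are functions of the points, and
  only their values on \<open>carrier_of B\<close> and on tangent vectors matter. One-forms and two-forms are
  functions on tangent vectors, (1,1)-tensors are maps between tangent vectors.\<close>

type_synonym ('x, 'e) vfield = "'x \<Rightarrow> ('x, 'e) tvec"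
type_synonym ('x, 'e) form1 = "'x \<Rightarrow> ('x, 'e) tvec \<Rightarrow> real"
type_synonym ('x, 'e) form2 = "'x \<Rightarrow> ('x, 'e) tvec \<Rightarrow> ('x, 'e) tvec \<Rightarrow> real"
type_synonym ('x, 'e) tensor11 = "'x \<Rightarrow> ('x, 'e) tvec \<Rightarrow> ('x, 'e) tvec"

definition smooth_fun :: "('x, 'e::euclidean_space) chart set \<Rightarrow> ('x \<Rightarrow> real) \<Rightarrow> bool" where
  "smooth_fun B f \<longleftrightarrow> (\<forall>c\<in>B. smooth_on (cimg c) (f \<circ> cinv c))"

definition smooth_vfield :: "('x, 'e::euclidean_space) chart set \<Rightarrow> ('x, 'e) vfield \<Rightarrow> bool" where
  "smooth_vfield B X \<longleftrightarrow>
     (\<forall>u\<in>carrier_of B. X u \<in> tangent_space B u) \<and>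
     (\<forall>c\<in>B. smooth_on (cimg c) (\<lambda>z. X (cinv c z) c))"

definition smooth_form1 :: "('x, 'e::euclidean_space) chart set \<Rightarrow> ('x, 'e) form1 \<Rightarrow> bool" where
  "smooth_form1 B \<omega> \<longleftrightarrow>
     (\<forall>u\<in>carrier_of B. \<forall>X\<in>tangent_space B u. \<forall>Y\<in>tangent_space B u. \<forall>a b.
        \<omega> u (\<lambda>c. a *\<^sub>R X c + b *\<^sub>R Y c) = a * \<omega> u X + b * \<omega> u Y) \<and>
     (\<forall>c\<in>B. \<forall>w. smooth_on (cimg c) (\<lambda>z. \<omega> (cinv c z) (coord_vec B c w (cinv c z))))"

definition form2_zero :: "('x, 'e::euclidean_space) chart set \<Rightarrow> ('x, 'e) form2 \<Rightarrow> bool" where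
  "form2_zero B \<omega> \<longleftrightarrow>
     (\<forall>u\<in>carrier_of B. \<forall>X\<in>tangent_space B u. \<forall>Y\<in>tangent_space B u. \<omega> u X Y = 0)"

text \<open>Lie bracket of vector fields, in components: \<open>[X,Y] = DY(X) - DX(Y)\<close>.\<close>

definition lie_bracket ::
    "('x, 'e::euclidean_space) chart set \<Rightarrow> ('x, 'e) vfield \<Rightarrow> ('x, 'e) vfield \<Rightarrow> ('x, 'e) vfield" where
  "lie_bracket B X Y u = (\<lambda>c. if c \<in> B \<and> u \<in> cdom c then
       frechet_derivative (\<lambda>z. Y (cinv c z) c) (at (cmap c u)) (X u c)
     - frechet_derivative (\<lambda>z. X (cinv c z) c) (at (cmap c u)) (Y u c)
     else 0)"

text \<open>\<open>(L\<^sub>S K) W = [S, K W] - K [S, W]\<close>. By tensoriality \<open>W\<close> may be extended to a vector field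
  near \<open>u\<close> arbitrarily; for the component in the chart \<open>c\<close> the extension with constant
  coordinates in \<open>c\<close> is used.\<close>

definition lie_tensor ::
    "('x, 'e::euclidean_space) chart set \<Rightarrow> ('x, 'e) vfield \<Rightarrow> ('x, 'e) tensor11 \<Rightarrow> ('x, 'e) tensor11" where
  "lie_tensor B S K u W = (\<lambda>c.
     lie_bracket B S (\<lambda>p. K p (coord_vec B c (W c) p)) u c
   - K u (lie_bracket B S (coord_vec B c (W c)) u) c)"

definition d0 :: "('x, 'e::euclidean_space) chart set \<Rightarrow> ('x \<Rightarrow> real) \<Rightarrow> ('x, 'e) form1" where
  "d0 B f u X = (let c = chart_at B u in
     frechet_derivative (f \<circ> cinv c) (at (cmap c u)) (X c))"

text \<open>\<open>d\<omega>(X,Y) = X \<omega>(Y) - Y \<omega>(X) - \<omega>([X,Y])\<close> for the extensions of \<open>X\<close> and \<open>Y\<close> with constant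
  coordinates in a chart around \<open>u\<close>, for which \<open>[X,Y] = 0\<close>.\<close>

definition d1 :: "('x, 'e::euclidean_space) chart set \<Rightarrow> ('x, 'e) form1 \<Rightarrow> ('x, 'e) form2" where
  "d1 B \<omega> u X Y = (let c = chart_at B u in
     frechet_derivative (\<lambda>z. \<omega> (cinv c z) (coord_vec B c (Y c) (cinv c z))) (at (cmap c u)) (X c)
   - frechet_derivative (\<lambda>z. \<omega> (cinv c z) (coord_vec B c (X c) (cinv c z))) (at (cmap c u)) (Y c))"

definition i1 :: "('x, 'e) tensor11 \<Rightarrow> ('x, 'e) form1 \<Rightarrow> ('x, 'e) form1" where
  "i1 K \<omega> u X = \<omega> u (K u X)"

definition i2 :: "('x, 'e) tensor11 \<Rightarrow> ('x, 'e) form2 \<Rightarrow> ('x, 'e) form2" where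
  "i2 K \<omega> u X Y = \<omega> u (K u X) Y + \<omega> u X (K u Y)"

text \<open>\<open>d\<^sub>K = i\<^sub>K d - d i\<^sub>K\<close> on functions (where \<open>i\<^sub>K f = 0\<close>) and on one-forms.\<close>

definition dK0 ::
    "('x, 'e::euclidean_space) chart set \<Rightarrow> ('x, 'e) tensor11 \<Rightarrow> ('x \<Rightarrow> real) \<Rightarrow> ('x, 'e) form1" where
  "dK0 B K f = i1 K (d0 B f)"

definition dK1 ::
    "('x, 'e::euclidean_space) chart set \<Rightarrow> ('x, 'e) tensor11 \<Rightarrow> ('x, 'e) form1 \<Rightarrow> ('x, 'e) form2" where
  "dK1 B K \<omega> u X Y = i2 K (d1 B \<omega>) u X Y - d1 B (i1 K \<omega>) u X Y"


section \<open>The tangent bundle and the slit tangent bundle\<close>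

type_synonym ('m, 'e) tpoint = "'m \<times> ('m, 'e) tvec"

definition tangent_bundle :: "('m, 'e::euclidean_space) chart set \<Rightarrow> ('m, 'e) tpoint set" where
  "tangent_bundle A = (SIGMA p:carrier_of A. tangent_space A p)"

definition slit_bundle :: "('m, 'e::euclidean_space) chart set \<Rightarrow> ('m, 'e) tpoint set" where
  "slit_bundle A = {(p, v) \<in> tangent_bundle A. v \<noteq> (\<lambda>_. 0)}"

text \<open>Induced coordinates \<open>(x, y)\<close>.\<close>

definition induced_coords :: "('m, 'e) chart \<Rightarrow> ('m, 'e) tpoint \<Rightarrow> 'e \<times> 'e" where
  "induced_coords c = (\<lambda>(p, v). (cmap c p, v c))"

definition bundle_chart ::
    "('m, 'e::euclidean_space) chart set \<Rightarrow> ('m, 'e) chart \<Rightarrow> (('m, 'e) tpoint, 'e \<times> 'e) chart" where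
  "bundle_chart A c = ({u \<in> tangent_bundle A. fst u \<in> cdom c}, induced_coords c)"

definition slit_chart ::
    "('m, 'e::euclidean_space) chart set \<Rightarrow> ('m, 'e) chart \<Rightarrow> (('m, 'e) tpoint, 'e \<times> 'e) chart" where
  "slit_chart A c = ({u \<in> slit_bundle A. fst u \<in> cdom c}, induced_coords c)"

definition slit_atlas ::
    "('m, 'e::euclidean_space) chart set \<Rightarrow> (('m, 'e) tpoint, 'e \<times> 'e) chart set" where
  "slit_atlas A = slit_chart A ` A"

text \<open>Fibrewise multiplication by a scalar.\<close>

definition fibre_scale :: "real \<Rightarrow> ('m, 'e::euclidean_space) tpoint \<Rightarrow> ('m, 'e) tpoint" where
  "fibre_scale t = (\<lambda>(p, v). (p, \<lambda>c. t *\<^sub>R v c))"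

text \<open>In induced coordinates \<open>\<C> = y\<^sup>i \<partial>/\<partial>y\<^sup>i\<close> and \<open>J = \<partial>/\<partial>y\<^sup>i \<otimes> dx\<^sup>i\<close>, that is
  \<open>J (a, b) = (0, a)\<close>.\<close>

definition liouville ::
    "('m, 'e::euclidean_space) chart set \<Rightarrow> (('m, 'e) tpoint, 'e \<times> 'e) vfield" where
  "liouville A u = (\<lambda>c. if c \<in> slit_atlas A \<and> u \<in> cdom c then (0, snd (cmap c u)) else 0)"

definition vert_endo :: "(('m, 'e::euclidean_space) tpoint, 'e \<times> 'e) tensor11" where
  "vert_endo u W = (\<lambda>c. (0, fst (W c)))"

definition vertical ::
    "('m, 'e::euclidean_space) chart set \<Rightarrow> ('m, 'e) tpoint \<Rightarrow> (('m, 'e) tpoint, 'e \<times> 'e) tvec \<Rightarrow> bool" where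
  "vertical A u X \<longleftrightarrow> X \<in> tangent_space (slit_atlas A) u \<and>
     (\<forall>c\<in>slit_atlas A. u \<in> cdom c \<longrightarrow> fst (X c) = 0)"

definition semibasic1 ::
    "('m, 'e::euclidean_space) chart set \<Rightarrow> (('m, 'e) tpoint, 'e \<times> 'e) form1 \<Rightarrow> bool" where
  "semibasic1 A \<alpha> \<longleftrightarrow> smooth_form1 (slit_atlas A) \<alpha> \<and>
     (\<forall>u\<in>slit_bundle A. \<forall>X. vertical A u X \<longrightarrow> \<alpha> u X = 0)"


section \<open>Sprays and their curvature\<close>

definition is_spray ::
    "('m, 'e::euclidean_space) chart set \<Rightarrow> (('m, 'e) tpoint, 'e \<times> 'e) vfield \<Rightarrow> bool" where
  "is_spray A S \<longleftrightarrow> smooth_vfield (slit_atlas A) S \<and>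
     (\<forall>u\<in>slit_bundle A. vert_endo u (S u) = liouville A u) \<and>
     (\<forall>u\<in>slit_bundle A. lie_bracket (slit_atlas A) (liouville A) S u = S u)"

definition hor_proj ::
    "('m, 'e::euclidean_space) chart set \<Rightarrow> (('m, 'e) tpoint, 'e \<times> 'e) vfield
      \<Rightarrow> (('m, 'e) tpoint, 'e \<times> 'e) tensor11" where
  "hor_proj A S u W = (\<lambda>c. (1/2) *\<^sub>R (W c - lie_tensor (slit_atlas A) S vert_endo u W c))"

definition vert_proj ::
    "('m, 'e::euclidean_space) chart set \<Rightarrow> (('m, 'e) tpoint, 'e \<times> 'e) vfield
      \<Rightarrow> (('m, 'e) tpoint, 'e \<times> 'e) tensor11" where
  "vert_proj A S u W = (\<lambda>c. (1/2) *\<^sub>R (W c + lie_tensor (slit_atlas A) S vert_endo u W c))"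

definition jacobi_endo ::
    "('m, 'e::euclidean_space) chart set \<Rightarrow> (('m, 'e) tpoint, 'e \<times> 'e) vfield
      \<Rightarrow> (('m, 'e) tpoint, 'e \<times> 'e) tensor11" where
  "jacobi_endo A S u W = vert_proj A S u (lie_tensor (slit_atlas A) S (hor_proj A S) u W)"

text \<open>For \<open>K = K\<^sup>i\<^sub>j \<partial>/\<partial>y\<^sup>i \<otimes> dx\<^sup>j\<close> this is \<open>K\<^sup>i\<^sub>i\<close>: the \<open>y\<^sup>i\<close>-component of
  \<open>K (\<partial>/\<partial>x\<^sup>i)\<close>, summed over \<open>i\<close>.\<close>

definition semibasic_trace ::
    "('m, real^'n) chart set \<Rightarrow> (('m, real^'n) tpoint, (real^'n) \<times> (real^'n)) tensor11
      \<Rightarrow> ('m, real^'n) tpoint \<Rightarrow> real" where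
  "semibasic_trace A K u = (let c = chart_at (slit_atlas A) u in
     \<Sum>i\<in>UNIV. snd (K u (coord_vec (slit_atlas A) c (axis i 1, 0) u) c) $ i)"

definition ricci_scalar ::
    "('m, real^'n) chart set \<Rightarrow> (('m, real^'n) tpoint, (real^'n) \<times> (real^'n)) vfield
      \<Rightarrow> ('m, real^'n) tpoint \<Rightarrow> real" where
  "ricci_scalar A S u = semibasic_trace A (jacobi_endo A S) u / (real CARD('n) - 1)"

definition isotropy_form ::
    "('m, real^'n) chart set \<Rightarrow> (('m, real^'n) tpoint, (real^'n) \<times> (real^'n)) vfield
      \<Rightarrow> (('m, real^'n) tpoint, (real^'n) \<times> (real^'n)) form1 \<Rightarrow> bool" where
  "isotropy_form A S \<alpha> \<longleftrightarrow> semibasic1 A \<alpha> \<and>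
     (\<forall>u\<in>slit_bundle A. \<forall>X\<in>tangent_space (slit_atlas A) u.
        jacobi_endo A S u X =
          (\<lambda>c. ricci_scalar A S u *\<^sub>R vert_endo u X c - \<alpha> u X *\<^sub>R liouville A u c))"

definition isotropic ::
    "('m, real^'n) chart set \<Rightarrow> (('m, real^'n) tpoint, (real^'n) \<times> (real^'n)) vfield \<Rightarrow> bool" where
  "isotropic A S \<longleftrightarrow> (\<exists>\<alpha>. isotropy_form A S \<alpha>)"

text \<open>Since \<open>\<C>\<close> has no zeros on the slit tangent bundle, the form \<open>\<alpha>\<close> of an isotropic spray is
  unique there, so the choice below is immaterial.\<close>

definition curvature_form ::
    "('m, real^'n) chart set \<Rightarrow> (('m, real^'n) tpoint, (real^'n) \<times> (real^'n)) vfield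
      \<Rightarrow> (('m, real^'n) tpoint, (real^'n) \<times> (real^'n)) form1" where
  "curvature_form A S u X =
     (1/3) * ((SOME \<alpha>. isotropy_form A S \<alpha>) u X
              + dK0 (slit_atlas A) vert_endo (ricci_scalar A S) u X)"


section \<open>Finsler metrics\<close>

definition partial_y :: "'n \<Rightarrow> ((real^'n) \<times> (real^'n) \<Rightarrow> real) \<Rightarrow> (real^'n) \<times> (real^'n) \<Rightarrow> real" where
  "partial_y i f z = frechet_derivative f (at z) (0, axis i 1)"

definition metric_matrix ::
    "(('m, real^'n) tpoint, (real^'n) \<times> (real^'n)) chart \<Rightarrow> (('m, real^'n) tpoint \<Rightarrow> real)
      \<Rightarrow> (real^'n) \<times> (real^'n) \<Rightarrow> real^'n^'n" where
  "metric_matrix c F z =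
     (\<chi> i j. (1/2) * partial_y i (partial_y j ((\<lambda>u. (F u)\<^sup>2) \<circ> cinv c)) z)"

definition finsler_metric ::
    "('m, real^'n) chart set \<Rightarrow> (('m, real^'n) tpoint \<Rightarrow> real) \<Rightarrow> bool" where
  "finsler_metric A F \<longleftrightarrow>
     (\<forall>c\<in>A. continuous_on (cimg (bundle_chart A c)) (F \<circ> cinv (bundle_chart A c))) \<and>
     (\<forall>u\<in>tangent_bundle A. F u \<ge> 0) \<and>
     smooth_fun (slit_atlas A) F \<and>
     (\<forall>u\<in>slit_bundle A. F u > 0) \<and>
     (\<forall>u\<in>tangent_bundle A. \<forall>t>0. F (fibre_scale t u) = t * F u) \<and>
     (\<forall>c\<in>slit_atlas A. \<forall>z\<in>cimg c. \<forall>w. w \<noteq> 0 \<longrightarrow> w \<bullet> (metric_matrix c F z *v w) > 0)"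

text \<open>\<open>i\<^sub>S d d\<^sub>J F\<^sup>2 = - d F\<^sup>2\<close>\<close>

definition geodesic_spray ::
    "('m, 'e::euclidean_space) chart set \<Rightarrow> (('m, 'e) tpoint \<Rightarrow> real)
      \<Rightarrow> (('m, 'e) tpoint, 'e \<times> 'e) vfield \<Rightarrow> bool" where
  "geodesic_spray A F S \<longleftrightarrow> is_spray A S \<and>
     (\<forall>u\<in>slit_bundle A. \<forall>X\<in>tangent_space (slit_atlas A) u.
        d1 (slit_atlas A) (dK0 (slit_atlas A) vert_endo (\<lambda>u. (F u)\<^sup>2)) u (S u) X
          = - d0 (slit_atlas A) (\<lambda>u. (F u)\<^sup>2) u X)"

definition scalar_flag_curvature ::
    "('m, 'e::euclidean_space) chart set \<Rightarrow> (('m, 'e) tpoint \<Rightarrow> real)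
      \<Rightarrow> (('m, 'e) tpoint, 'e \<times> 'e) vfield \<Rightarrow> (('m, 'e) tpoint \<Rightarrow> real) \<Rightarrow> bool" where
  "scalar_flag_curvature A F S \<kappa> \<longleftrightarrow>
     geodesic_spray A F S \<and>
     smooth_fun (slit_atlas A) \<kappa> \<and>
     (\<forall>u\<in>slit_bundle A. \<forall>t>0. \<kappa> (fibre_scale t u) = \<kappa> u) \<and>
     (\<forall>u\<in>slit_bundle A. \<forall>X\<in>tangent_space (slit_atlas A) u.
        jacobi_endo A S u X =
          (\<lambda>c. \<kappa> u *\<^sub>R ((F u)\<^sup>2 *\<^sub>R vert_endo u X c
             - (F u * dK0 (slit_atlas A) vert_endo F u X) *\<^sub>R liouville A u c)))"

definition constant_flag_curvature ::
    "('m, 'e::euclidean_space) chart set \<Rightarrow> (('m, 'e) tpoint \<Rightarrow> real)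
      \<Rightarrow> (('m, 'e) tpoint, 'e \<times> 'e) vfield \<Rightarrow> bool" where
  "constant_flag_curvature A F S \<longleftrightarrow>
     (\<exists>\<kappa>. scalar_flag_curvature A F S \<kappa> \<and> (\<exists>k. \<forall>u\<in>slit_bundle A. \<kappa> u = k))"

end

theory Submission
  imports Defs
begin

text \<open>In induced coordinates a spray is \<open>y\<^sup>i \<partial>/\<partial>x\<^sup>i - 2 G\<^sup>i \<partial>/\<partial>y\<^sup>i\<close>, and all identities below are
  commutator computations with the fields \<open>S\<close>, \<open>\<C>\<close>, \<open>\<partial>/\<partial>y\<^sup>i\<close> and the horizontal lifts \<open>\<delta>\<^sub>i\<close>.
  For \<open>L = F\<^sup>2\<close> the Euler-Lagrange equations give first \<open>S L = 0\<close>, then \<open>\<delta>\<^sub>i L = 0\<close>, and hence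
  \<open>d L \<circ> \<Phi> = [S, \<delta>] L = 0\<close>. For isotropic \<open>S\<close> this forces \<open>\<rho> = \<kappa> L\<close>, \<open>\<alpha> = \<kappa> F d\<^sub>J F\<close>, so that
  \<open>\<xi> = \<kappa> F d\<^sub>J F + (L/3) d\<^sub>J \<kappa>\<close>; then \<open>d\<^sub>J \<xi> = 0\<close> says that \<open>\<kappa>\<close> is a function on \<open>M\<close>, and
  \<open>d\<^sub>h \<xi> = 0\<close> that \<open>d\<kappa> \<and> d\<^sub>J F = 0\<close>, which for varying \<open>y\<close> is only possible if \<open>d\<kappa> = 0\<close>.
  For \<open>n > 2\<close> the Bianchi identity reads
  \<open>d\<^sub>h\<xi>(X,Y) Z + d\<^sub>h\<xi>(Y,Z) X + d\<^sub>h\<xi>(Z,X) Y = - d\<^sub>J d\<^sub>h\<xi>(X,Y,Z) y\<close>. Taking \<open>Y = y\<close> and \<open>Z\<close> outside the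
  span of \<open>X\<close> and \<open>y\<close> gives \<open>d\<^sub>h\<xi>(X, y) = 0\<close>; by homogeneity, \<open>Z = y\<close> then gives
  \<open>d\<^sub>h\<xi> = - 3 d\<^sub>h\<xi>\<close>. For \<open>n = 2\<close>, \<open>\<Phi>\<close> kills \<open>y\<close> and has its image in the kernel of
  \<open>\<partial>L/\<partial>y\<close>, hence it is a multiple of the projection along \<open>y\<close>.\<close>

text \<open>The exterior derivative and the Ricci scalar are evaluated in the chart that
  \<open>chart_at\<close> selects at each point, and this selection may jump from point to point.
  What they yield is thus known at one point in one chart, whereas the commutator computations
  differentiate identities and need them on a whole chart domain. The bridge is to phrase each
  intermediate result through the differential of a scalar (\<open>L\<close> along \<open>S\<close>,
  \<open>L\<close> along horizontal vectors, \<open>\<kappa>\<close> along vertical vectors and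
  along \<open>S\<close>), which does not depend on the chart by \<open>d0_eq\<close>, and to read
  it off again in any chart. This is why the local lemmas separate hypotheses at the point from
  hypotheses on the domain, and why the Lie derivative of a tensor has to be shown to send tangent
  vectors to tangent vectors. The local calculus works with constant coordinate vectors
  \<open>X\<close> and functions of \<open>z\<close> instead of tensors; where the fibre coordinate
  itself is inserted, as in \<open>N (snd z)\<close>, the product rule for families of linear maps
  accounts for its motion. The 1/3 in the curvature form reflects the identity
  \<open>[J, Phi] = 3 R\<close>.\<close>

section \<open>Rules for Frechet derivatives\<close>

abbreviation D :: "('a::real_normed_vector \<Rightarrow> 'b::real_normed_vector) \<Rightarrow> 'a \<Rightarrow> 'a \<Rightarrow> 'b" where
  "D f z \<equiv> frechet_derivative f (at z)"

lemma has_derivative_D: "f differentiable (at z) \<Longrightarrow> (f has_derivative D f z) (at z)"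
  by (simp add: frechet_derivative_works)

lemma D_eq: "(f has_derivative f') (at z) \<Longrightarrow> D f z = f'"
  using frechet_derivative_at by metis

lemma D_cong_open:
  assumes "open U" "z \<in> U" "\<And>x. x \<in> U \<Longrightarrow> f x = g x"
  shows "D f z = D g z"
proof -
  have "(f has_derivative h) (at z) \<longleftrightarrow> (g has_derivative h) (at z)" for h
    using has_derivative_transform_within_open[OF _ assms(1,2)] assms(3) by metis
  then show ?thesis by (simp add: frechet_derivative_def)
qed

lemma differentiable_cong_open:
  assumes "open U" "z \<in> U" "\<And>x. x \<in> U \<Longrightarrow> f x = g x" "f differentiable (at z)"
  shows "g differentiable (at z)"
  using has_derivative_transform_within_open[OF _ assms(1,2)] assms(3,4)
  unfolding differentiable_def by metis

lemma D_linear: "f differentiable (at z) \<Longrightarrow> linear (D f z)"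
  by (rule linear_frechet_derivative)

lemma D_add:
  assumes "f differentiable (at z)" "g differentiable (at z)"
  shows "D (\<lambda>x. f x + g x) z v = D f z v + D g z v"
  by (simp add: D_eq[OF has_derivative_add[OF assms[THEN has_derivative_D]]])

lemma D_diff:
  assumes "f differentiable (at z)" "g differentiable (at z)"
  shows "D (\<lambda>x. f x - g x) z v = D f z v - D g z v"
  by (simp add: D_eq[OF has_derivative_diff[OF assms[THEN has_derivative_D]]])

lemma D_minus:
  assumes "f differentiable (at z)"
  shows "D (\<lambda>x. - f x) z v = - D f z v"
  by (simp add: D_eq[OF has_derivative_minus[OF assms[THEN has_derivative_D]]])

lemma D_Pair:
  assumes "f differentiable (at z)" "g differentiable (at z)"
  shows "D (\<lambda>x. (f x, g x)) z v = (D f z v, D g z v)"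
  by (simp add: D_eq[OF has_derivative_Pair[OF assms[THEN has_derivative_D]]])

lemma
  assumes "bounded_linear T" "f differentiable (at z)"
  shows D_bounded_linear: "D (\<lambda>x. T (f x)) z v = T (D f z v)"
    and differentiable_bounded_linear: "(\<lambda>x. T (f x)) differentiable (at z)"
proof -
  note d = bounded_linear.has_derivative[OF assms(1) has_derivative_D[OF assms(2)]]
  show "D (\<lambda>x. T (f x)) z v = T (D f z v)" by (simp add: D_eq[OF d])
  show "(\<lambda>x. T (f x)) differentiable (at z)" by (rule differentiableI[OF d])
qed

lemma
  assumes "bounded_bilinear b" "f differentiable (at z)" "g differentiable (at z)"
  shows D_bilinear: "D (\<lambda>x. b (f x) (g x)) z v = b (f z) (D g z v) + b (D f z v) (g z)"
    and differentiable_bilinear: "(\<lambda>x. b (f x) (g x)) differentiable (at z)"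
proof -
  note d = bounded_bilinear.FDERIV[OF assms(1) assms(2,3)[THEN has_derivative_D]]
  show "D (\<lambda>x. b (f x) (g x)) z v = b (f z) (D g z v) + b (D f z v) (g z)" by (simp add: D_eq[OF d])
  show "(\<lambda>x. b (f x) (g x)) differentiable (at z)" by (rule differentiableI[OF d])
qed

lemmas D_scaleR = D_bilinear[OF bounded_bilinear_scaleR]
lemmas D_mult = D_bilinear[OF bounded_bilinear_mult]

lemma
  assumes "f differentiable (at z)" "g differentiable (at (f z))"
  shows D_compose: "D (\<lambda>x. g (f x)) z v = D g (f z) (D f z v)"
    and differentiable_comp: "(\<lambda>x. g (f x)) differentiable (at z)"
proof -
  note d = has_derivative_compose[OF assms[THEN has_derivative_D]]
  show "D (\<lambda>x. g (f x)) z v = D g (f z) (D f z v)" by (simp add: D_eq[OF d])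
  show "(\<lambda>x. g (f x)) differentiable (at z)" by (rule differentiableI[OF d])
qed

lemma linear_basis_sum:
  fixes v :: "'a::euclidean_space"
  assumes "linear T" shows "T v = (\<Sum>b\<in>Basis. (v \<bullet> b) *\<^sub>R T b)"
proof -
  have "T v = T (\<Sum>b\<in>Basis. (v \<bullet> b) *\<^sub>R b)" by (simp add: euclidean_representation)
  then show ?thesis using assms by (simp add: linear_sum linear_scale)
qed

text \<open>Differentiability of \<open>k\<close> is known only for each fixed second argument, so
  no operator-valued derivative is at hand. Expanding \<open>m x\<close> in the finite basis reduces
  the product rule to scalar multiples of the functions \<open>k x b\<close>.\<close>

lemma has_derivative_linear_family:
  fixes m :: "'a::real_normed_vector \<Rightarrow> 'b::euclidean_space"
    and k :: "'c::real_normed_vector \<Rightarrow> 'b \<Rightarrow> 'd::real_normed_vector"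
  assumes m: "m differentiable (at z)" and g: "g differentiable (at z)"
    and V: "open V" "g z \<in> V" "\<And>x. x \<in> V \<Longrightarrow> linear (k x)"
    and k: "\<And>b. (\<lambda>x. k x b) differentiable (at (g z))"
  shows "((\<lambda>x. k (g x) (m x)) has_derivative
     (\<lambda>v. D (\<lambda>x. k x (m z)) (g z) (D g z v) + k (g z) (D m z v))) (at z)"
proof -
  note dg = has_derivative_D[OF g] and dm = has_derivative_D[OF m]
  have dk: "((\<lambda>x. k (g x) b) has_derivative (\<lambda>v. D (\<lambda>x. k x b) (g z) (D g z v))) (at z)" for b
    using has_derivative_compose[OF dg has_derivative_D[OF k]] .
  have 1: "((\<lambda>x. \<Sum>b\<in>Basis. (m x \<bullet> b) *\<^sub>R k (g x) b) has_derivative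
     (\<lambda>v. \<Sum>b\<in>Basis. (m z \<bullet> b) *\<^sub>R D (\<lambda>x. k x b) (g z) (D g z v) + (D m z v \<bullet> b) *\<^sub>R k (g z) b)) (at z)"
    by (intro has_derivative_sum has_derivative_scaleR dk has_derivative_inner_left dm)
  have dk0: "((\<lambda>x. \<Sum>b\<in>Basis. (m z \<bullet> b) *\<^sub>R k x b) has_derivative
     (\<lambda>w. \<Sum>b\<in>Basis. (m z \<bullet> b) *\<^sub>R D (\<lambda>x. k x b) (g z) w)) (at (g z))"
    by (intro has_derivative_sum has_derivative_scaleR_right has_derivative_D[OF k])
  have dk1: "((\<lambda>x. k x (m z)) has_derivative
     (\<lambda>w. \<Sum>b\<in>Basis. (m z \<bullet> b) *\<^sub>R D (\<lambda>x. k x b) (g z) w)) (at (g z))"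
    by (rule has_derivative_transform_within_open[OF dk0 V(1,2)])
      (use V(3) linear_basis_sum in metis)
  have 2: "(\<Sum>b\<in>Basis. (m z \<bullet> b) *\<^sub>R D (\<lambda>x. k x b) (g z) (D g z v) + (D m z v \<bullet> b) *\<^sub>R k (g z) b)
     = D (\<lambda>x. k x (m z)) (g z) (D g z v) + k (g z) (D m z v)" for v
    unfolding D_eq[OF dk1] sum.distrib using linear_basis_sum[OF V(3)[OF V(2)], of "D m z v"] by simp
  have "isCont g z" using g differentiable_imp_continuous_within by blast
  then obtain U where U: "open U" "z \<in> U" "\<And>x. x \<in> U \<Longrightarrow> g x \<in> V"
    using V(1,2) unfolding continuous_at_open by metis
  show ?thesis
    by (rule has_derivative_transform_within_open[OF 1[unfolded 2] U(1,2)])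
      (use U(3) V(3) linear_basis_sum in metis)
qed

lemmas D_linear_family = D_eq[OF has_derivative_linear_family, THEN fun_cong]

section \<open>Smooth maps\<close>

lemma Ck_on_cong:
  "open U \<Longrightarrow> (\<And>x. x \<in> U \<Longrightarrow> f x = g x) \<Longrightarrow> Ck_on k U f \<Longrightarrow> Ck_on k U g"
proof (induction k arbitrary: f g)
  case 0 then show ?case by (metis Ck_on.simps(1) continuous_on_cong)
next
  case (Suc k)
  have "Ck_on k U (\<lambda>x. D g x v)" for v
  proof (rule Suc.IH[of "\<lambda>x. D f x v"])
    show "D f x v = D g x v" if "x \<in> U" for x
      using D_cong_open[OF Suc.prems(1) that Suc.prems(2)] by simp
  qed (use Suc.prems in auto)
  moreover have "g differentiable (at x)" if "x \<in> U" for x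
    using differentiable_cong_open[OF Suc.prems(1) that Suc.prems(2)] Suc.prems(3) that by simp
  ultimately show ?case by simp
qed

lemma Ck_on_Suc_imp: "Ck_on (Suc k) U f \<Longrightarrow> Ck_on k U f"
proof (induction k arbitrary: f)
  case 0
  then show ?case
    by (simp add: continuous_at_imp_continuous_on differentiable_imp_continuous_within)
qed simp

lemma Ck_on_subset: "Ck_on k U f \<Longrightarrow> V \<subseteq> U \<Longrightarrow> Ck_on k V f"
proof (induction k arbitrary: f)
  case 0 then show ?case by (simp add: continuous_on_subset)
qed auto

lemma Ck_on_const: "Ck_on k U (\<lambda>x. c)"
  by (induction k arbitrary: c) auto

lemma Ck_on_bounded_linear:
  "open U \<Longrightarrow> bounded_linear T \<Longrightarrow> Ck_on k U f \<Longrightarrow> Ck_on k U (\<lambda>x. T (f x))"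
proof (induction k arbitrary: f)
  case 0 then show ?case
    by (simp add: bounded_linear.continuous_on)
next
  case (Suc k)
  have "Ck_on k U (\<lambda>x. D (\<lambda>x. T (f x)) x v)" for v
    by (rule Ck_on_cong[OF \<open>open U\<close> _ Suc.IH[of "\<lambda>x. D f x v"]])
      (use Suc.prems in \<open>auto simp: D_bounded_linear\<close>)
  then show ?case using Suc.prems by (auto intro: differentiable_bounded_linear)
qed

lemma Ck_on_add:
  "open U \<Longrightarrow> Ck_on k U f \<Longrightarrow> Ck_on k U g \<Longrightarrow> Ck_on k U (\<lambda>x. f x + g x)"
proof (induction k arbitrary: f g)
  case 0 then show ?case by (simp add: continuous_on_add)
next
  case (Suc k)
  have "Ck_on k U (\<lambda>x. D (\<lambda>x. f x + g x) x v)" for v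
    by (rule Ck_on_cong[OF \<open>open U\<close> _ Suc.IH[of "\<lambda>x. D f x v" "\<lambda>x. D g x v"]])
      (use Suc.prems in \<open>auto simp: D_add\<close>)
  then show ?case using Suc.prems by auto
qed

lemma Ck_on_bilinear:
  "open U \<Longrightarrow> bounded_bilinear b \<Longrightarrow> Ck_on k U f \<Longrightarrow> Ck_on k U g \<Longrightarrow> Ck_on k U (\<lambda>x. b (f x) (g x))"
proof (induction k arbitrary: f g)
  case 0 then show ?case by (simp add: bounded_bilinear.continuous_on)
next
  case (Suc k)
  have "Ck_on k U (\<lambda>x. D (\<lambda>x. b (f x) (g x)) x v)" for v
  proof (rule Ck_on_cong[OF \<open>open U\<close>])
    show "Ck_on k U (\<lambda>x. b (f x) (D g x v) + b (D f x v) (g x))"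
      by (intro Ck_on_add Suc.IH) (use Suc.prems Ck_on_Suc_imp in auto)
  qed (use Suc.prems in \<open>auto simp: D_bilinear\<close>)
  then show ?case using Suc.prems by (auto intro: differentiable_bilinear)
qed

lemma Ck_on_sum:
  "open U \<Longrightarrow> (\<And>i. i \<in> I \<Longrightarrow> Ck_on k U (f i)) \<Longrightarrow> Ck_on k U (\<lambda>x. \<Sum>i\<in>I. f i x)"
  by (induction I rule: infinite_finite_induct) (auto intro: Ck_on_const Ck_on_add)

text \<open>The chain rule inserts the moving vector \<open>D f x v\<close> into
  \<open>D g (f x)\<close>, while the induction hypothesis covers fixed directions only. Expanding
  in the basis restores fixed directions.\<close>

lemma Ck_on_compose:
  fixes f :: "'a::real_normed_vector \<Rightarrow> 'b::euclidean_space"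
  shows "open U \<Longrightarrow> Ck_on k U f \<Longrightarrow> Ck_on k V g \<Longrightarrow> (\<And>x. x \<in> U \<Longrightarrow> f x \<in> V) \<Longrightarrow>
     Ck_on k U (\<lambda>x. g (f x))"
proof (induction k arbitrary: g)
  case 0
  then show ?case using continuous_on_compose2[of V g U f] by auto
next
  case (Suc k)
  have "Ck_on k U (\<lambda>x. D (\<lambda>x. g (f x)) x v)" for v
  proof (rule Ck_on_cong[OF \<open>open U\<close>])
    show "Ck_on k U (\<lambda>x. \<Sum>b\<in>Basis. (D f x v \<bullet> b) *\<^sub>R D g (f x) b)"
      using Suc.prems Ck_on_Suc_imp
      by (intro Ck_on_sum Ck_on_bilinear[OF _ bounded_bilinear_scaleR]
         Ck_on_bounded_linear[OF _ bounded_linear_inner_left] Suc.IH) auto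
    fix x assume "x \<in> U"
    then have "f differentiable (at x)" "g differentiable (at (f x))" using Suc.prems by auto
    then show "(\<Sum>b\<in>Basis. (D f x v \<bullet> b) *\<^sub>R D g (f x) b) = D (\<lambda>x. g (f x)) x v"
      by (simp add: D_compose linear_basis_sum[OF D_linear, symmetric])
  qed
  then show ?case using Suc.prems by (auto intro: differentiable_comp)
qed

lemma Ck_on_inverse: "Ck_on k (- {0::real}) inverse"
proof (induction k)
  case 0
  show ?case by (auto intro!: continuous_intros)
next
  case (Suc k)
  have d: "(inverse has_derivative (\<lambda>v. - (inverse x * v * inverse x))) (at x)" if "x \<noteq> 0" for x :: real
    using has_derivative_inverse'[OF that] by simp
  have "Ck_on k (- {0::real}) (\<lambda>x. D inverse x v)" for v
  proof (rule Ck_on_cong)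
    show "Ck_on k (- {0::real}) (\<lambda>x. - v * (inverse x * inverse x))"
      by (intro Ck_on_bilinear[OF _ bounded_bilinear_mult] Ck_on_const Suc) auto
  qed (auto simp: D_eq[OF d])
  then show ?case using d by (auto simp: differentiable_def)
qed

lemma smooth_on_differentiable: "smooth_on U f \<Longrightarrow> x \<in> U \<Longrightarrow> f differentiable (at x)"
  unfolding smooth_on_def by (metis Ck_on.simps(2))

lemma smooth_on_D_const: "smooth_on U f \<Longrightarrow> smooth_on U (\<lambda>x. D f x v)"
  unfolding smooth_on_def by (metis Ck_on.simps(2))

lemma smooth_on_cong: "smooth_on U f \<Longrightarrow> open U \<Longrightarrow> (\<And>x. x \<in> U \<Longrightarrow> g x = f x) \<Longrightarrow> smooth_on U g"
  unfolding smooth_on_def using Ck_on_cong by metis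

lemma smooth_on_subset: "smooth_on U f \<Longrightarrow> V \<subseteq> U \<Longrightarrow> smooth_on V f"
  unfolding smooth_on_def using Ck_on_subset by metis

named_theorems smooth_intros

lemma smooth_on_const [smooth_intros]: "smooth_on U (\<lambda>x. c)"
  unfolding smooth_on_def by (simp add: Ck_on_const)

lemma smooth_on_bounded_linear:
  "bounded_linear T \<Longrightarrow> open U \<Longrightarrow> smooth_on U f \<Longrightarrow> smooth_on U (\<lambda>x. T (f x))"
  unfolding smooth_on_def by (simp add: Ck_on_bounded_linear)

lemma smooth_on_bilinear:
  "bounded_bilinear b \<Longrightarrow> open U \<Longrightarrow> smooth_on U f \<Longrightarrow> smooth_on U g \<Longrightarrow> smooth_on U (\<lambda>x. b (f x) (g x))"
  unfolding smooth_on_def by (simp add: Ck_on_bilinear)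

lemmas smooth_on_scaleR [smooth_intros] = smooth_on_bilinear[OF bounded_bilinear_scaleR]
lemmas smooth_on_mult [smooth_intros] = smooth_on_bilinear[OF bounded_bilinear_mult]
lemmas smooth_on_inner [smooth_intros] = smooth_on_bilinear[OF bounded_bilinear_inner]

lemma smooth_on_id [smooth_intros]: "smooth_on U (\<lambda>x. x)"
proof -
  have "Ck_on k U (\<lambda>x::'a. x)" for k by (cases k) (auto simp: Ck_on_const)
  then show ?thesis by (simp add: smooth_on_def)
qed

lemma smooth_on_add [smooth_intros]:
  "open U \<Longrightarrow> smooth_on U f \<Longrightarrow> smooth_on U g \<Longrightarrow> smooth_on U (\<lambda>x. f x + g x)"
  unfolding smooth_on_def by (simp add: Ck_on_add)

lemma smooth_on_sum [smooth_intros]: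
  "open U \<Longrightarrow> (\<And>i. i \<in> I \<Longrightarrow> smooth_on U (f i)) \<Longrightarrow> smooth_on U (\<lambda>x. \<Sum>i\<in>I. f i x)"
  unfolding smooth_on_def by (simp add: Ck_on_sum)

lemma smooth_on_minus [smooth_intros]: "open U \<Longrightarrow> smooth_on U f \<Longrightarrow> smooth_on U (\<lambda>x. - f x)"
  by (rule smooth_on_bounded_linear[OF bounded_linear_minus[OF bounded_linear_ident]])

lemma smooth_on_diff [smooth_intros]:
  "open U \<Longrightarrow> smooth_on U f \<Longrightarrow> smooth_on U g \<Longrightarrow> smooth_on U (\<lambda>x. f x - g x)"
  using smooth_on_add[of U f "\<lambda>x. - g x"] smooth_on_minus[of U g] by simp

lemma smooth_on_fst [smooth_intros]: "open U \<Longrightarrow> smooth_on U f \<Longrightarrow> smooth_on U (\<lambda>x. fst (f x))"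
  by (rule smooth_on_bounded_linear[OF bounded_linear_fst])

lemma smooth_on_snd [smooth_intros]: "open U \<Longrightarrow> smooth_on U f \<Longrightarrow> smooth_on U (\<lambda>x. snd (f x))"
  by (rule smooth_on_bounded_linear[OF bounded_linear_snd])

lemma smooth_on_vec_nth [smooth_intros]: "open U \<Longrightarrow> smooth_on U f \<Longrightarrow> smooth_on U (\<lambda>x. f x $ i)"
  by (rule smooth_on_bounded_linear[OF bounded_linear_vec_nth])

lemma smooth_on_Pair [smooth_intros]:
  assumes "open U" "smooth_on U f" "smooth_on U g" shows "smooth_on U (\<lambda>x. (f x, g x))"
proof -
  have l: "bounded_linear (\<lambda>a. (a, 0))" "bounded_linear (\<lambda>a. (0, a))"
    by (auto intro: bounded_linear_Pair bounded_linear_ident bounded_linear_zero)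
  show ?thesis
    using smooth_on_add[OF assms(1) smooth_on_bounded_linear[OF l(1) assms(1,2)]
       smooth_on_bounded_linear[OF l(2) assms(1,3)]] by simp
qed

lemma smooth_on_compose:
  fixes f :: "'a::real_normed_vector \<Rightarrow> 'b::euclidean_space"
  shows "open U \<Longrightarrow> smooth_on U f \<Longrightarrow> smooth_on V g \<Longrightarrow> (\<And>x. x \<in> U \<Longrightarrow> f x \<in> V) \<Longrightarrow>
     smooth_on U (\<lambda>x. g (f x))"
  unfolding smooth_on_def using Ck_on_compose by blast

lemma smooth_on_divide [smooth_intros]:
  fixes f g :: "'a::real_normed_vector \<Rightarrow> real"
  assumes "open U" "smooth_on U f" "smooth_on U g" "\<And>x. x \<in> U \<Longrightarrow> g x \<noteq> 0"
  shows "smooth_on U (\<lambda>x. f x / g x)"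
proof -
  have "smooth_on U (\<lambda>x. inverse (g x))"
    by (rule smooth_on_compose[of U g "- {0}"])
      (use assms Ck_on_inverse in \<open>auto simp: smooth_on_def\<close>)
  then show ?thesis using smooth_on_mult[OF assms(1,2)] by (simp add: divide_inverse)
qed

lemma smooth_on_linear_family:
  fixes m :: "'a::real_normed_vector \<Rightarrow> 'b::euclidean_space"
    and g :: "'a \<Rightarrow> 'c::euclidean_space"
  assumes "open U" "smooth_on U m" "smooth_on U g" "\<And>x. x \<in> U \<Longrightarrow> g x \<in> V"
    and "\<And>x. x \<in> V \<Longrightarrow> linear (k x)" "\<And>b. smooth_on V (\<lambda>x. k x b)"
  shows "smooth_on U (\<lambda>x. k (g x) (m x))"
proof (rule smooth_on_cong)
  have "smooth_on U (\<lambda>x. k (g x) b)" for b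
    by (rule smooth_on_compose[OF assms(1,3,6,4)])
  then show "smooth_on U (\<lambda>x. \<Sum>b\<in>Basis. (m x \<bullet> b) *\<^sub>R k (g x) b)"
    by (intro smooth_intros assms(1,2))
  show "k (g x) (m x) = (\<Sum>b\<in>Basis. (m x \<bullet> b) *\<^sub>R k (g x) b)" if "x \<in> U" for x
    by (rule linear_basis_sum[OF assms(5)[OF assms(4)[OF that]]])
qed (rule assms)

lemma smooth_on_D [smooth_intros]:
  fixes f :: "'a::euclidean_space \<Rightarrow> 'b::real_normed_vector"
  assumes "open U" "smooth_on U f" "smooth_on U A"
  shows "smooth_on U (\<lambda>x. D f x (A x))"
  by (rule smooth_on_linear_family[where g = "\<lambda>x. x" and V = U])
    (use assms in \<open>auto intro: smooth_intros D_linear smooth_on_differentiable smooth_on_D_const\<close>)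

section \<open>Symmetry of second derivatives\<close>

text \<open>The second difference over the parallelogram spanned by \<open>u\<close> and
  \<open>v\<close>, scaled by \<open>h\<close>, is evaluated by the mean value theorem twice: in
  \<open>s\<close> for the difference of \<open>f\<close> along two opposite edges, then in
  \<open>t\<close>.\<close>

lemma second_difference:
  fixes f :: "'a::real_normed_vector \<Rightarrow> real"
  assumes f: "smooth_on U f" and h: "h > 0"
    and sub: "\<And>s t. 0 \<le> s \<Longrightarrow> s \<le> h \<Longrightarrow> 0 \<le> t \<Longrightarrow> t \<le> h \<Longrightarrow> z + s *\<^sub>R u + t *\<^sub>R v \<in> U"
  shows "\<exists>s t. 0 < s \<and> s < h \<and> 0 < t \<and> t < h \<and>
    f (z + h *\<^sub>R u + h *\<^sub>R v) - f (z + h *\<^sub>R u) - f (z + h *\<^sub>R v) + f z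
     = h * (h * D (\<lambda>x. D f x u) (z + s *\<^sub>R u + t *\<^sub>R v) v)"
proof -
  have lin: "((\<lambda>s. z + s *\<^sub>R u + t *\<^sub>R v) has_vector_derivative u) (at s)" for s t
    by (auto intro!: derivative_eq_intros)
  have lin': "((\<lambda>t. z + s *\<^sub>R u + t *\<^sub>R v) has_vector_derivative v) (at t)" for s t
    by (auto intro!: derivative_eq_intros)
  have 1: "((\<lambda>s. f (z + s *\<^sub>R u + t *\<^sub>R v)) has_real_derivative D f (z + s *\<^sub>R u + t *\<^sub>R v) u) (at s)"
    if "0 \<le> s" "s \<le> h" "0 \<le> t" "t \<le> h" for s t
    using vector_derivative_diff_chain_within[OF lin, of f]
      has_derivative_at_withinI[OF has_derivative_D[OF smooth_on_differentiable[OF f sub[OF that]]]]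
    by (simp add: has_real_derivative_iff_has_vector_derivative comp_def)
  have 2: "((\<lambda>t. D f (z + s *\<^sub>R u + t *\<^sub>R v) u) has_real_derivative
      D (\<lambda>x. D f x u) (z + s *\<^sub>R u + t *\<^sub>R v) v) (at t)"
    if "0 \<le> s" "s \<le> h" "0 \<le> t" "t \<le> h" for s t
    using vector_derivative_diff_chain_within[OF lin', of "\<lambda>x. D f x u"]
      has_derivative_at_withinI[OF has_derivative_D[OF smooth_on_differentiable[OF
        smooth_on_D_const[OF f] sub[OF that]]]]
    by (simp add: has_real_derivative_iff_has_vector_derivative comp_def)
  have "\<exists>s. 0 < s \<and> s < h \<and>
      (f (z + h *\<^sub>R u + h *\<^sub>R v) - f (z + h *\<^sub>R u + 0 *\<^sub>R v)) - (f (z + 0 *\<^sub>R u + h *\<^sub>R v) - f (z + 0 *\<^sub>R u + 0 *\<^sub>R v))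
      = (h - 0) * (D f (z + s *\<^sub>R u + h *\<^sub>R v) u - D f (z + s *\<^sub>R u + 0 *\<^sub>R v) u)"
    by (rule MVT2[OF h]) (use h in \<open>intro DERIV_diff 1; simp\<close>)
  then obtain s where s: "0 < s" "s < h" "(f (z + h *\<^sub>R u + h *\<^sub>R v) - f (z + h *\<^sub>R u)) - (f (z + h *\<^sub>R v) - f z)
      = h * (D f (z + s *\<^sub>R u + h *\<^sub>R v) u - D f (z + s *\<^sub>R u + 0 *\<^sub>R v) u)" by auto
  have "\<exists>t. 0 < t \<and> t < h \<and> D f (z + s *\<^sub>R u + h *\<^sub>R v) u - D f (z + s *\<^sub>R u + 0 *\<^sub>R v) u
      = (h - 0) * D (\<lambda>x. D f x u) (z + s *\<^sub>R u + t *\<^sub>R v) v"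
    by (rule MVT2[OF h]) (use s 2 in auto)
  then obtain t where "0 < t" "t < h" "D f (z + s *\<^sub>R u + h *\<^sub>R v) u - D f (z + s *\<^sub>R u + 0 *\<^sub>R v) u
      = h * D (\<lambda>x. D f x u) (z + s *\<^sub>R u + t *\<^sub>R v) v" by auto
  with s show ?thesis by (intro exI[of _ s] exI[of _ t]) (simp add: algebra_simps)
qed

text \<open>The second difference is unchanged when \<open>u\<close> and \<open>v\<close> are
  exchanged. Hence every small parallelogram contains a point for each mixed derivative at which the
  two have a common value, and continuity carries the equality to \<open>z\<close>.\<close>

lemma symmetric_second_D_real:
  fixes f :: "'a::real_normed_vector \<Rightarrow> real"
  assumes U: "open U" "z \<in> U" and f: "smooth_on U f"
  shows "D (\<lambda>x. D f x u) z v = D (\<lambda>x. D f x v) z u"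
proof -
  have cont: "continuous_on U (\<lambda>x. D (\<lambda>x. D f x u) x v)" for u v
    using smooth_on_D_const[OF smooth_on_D_const[OF f], of u v]
    unfolding smooth_on_def by (metis Ck_on.simps(1))
  have close: "\<bar>D (\<lambda>x. D f x u) z v - D (\<lambda>x. D f x v) z u\<bar> \<le> 2 * e" if e: "e > 0" for e
  proof -
    have "\<exists>d>0. \<forall>x. dist x z < d \<longrightarrow> x \<in> U \<and> \<bar>D (\<lambda>x. D f x u) x v - D (\<lambda>x. D f x u) z v\<bar> < e" for u v
    proof -
      have "isCont (\<lambda>x. D (\<lambda>x. D f x u) x v) z"
        using cont U by (simp add: continuous_on_eq_continuous_at)
      then obtain d where "d > 0" "\<forall>x. dist x z < d \<longrightarrow> \<bar>D (\<lambda>x. D f x u) x v - D (\<lambda>x. D f x u) z v\<bar> < e"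
        unfolding continuous_at_eps_delta using e by (metis dist_real_def)
      moreover obtain d' where "d' > 0" "\<forall>x. dist x z < d' \<longrightarrow> x \<in> U"
        using U unfolding open_dist by blast
      ultimately show ?thesis by (intro exI[of _ "min d d'"]) auto
    qed
    from this[of u v] this[of v u] obtain d1 d2 where d: "d1 > 0" "d2 > 0"
      "\<And>x. dist x z < d1 \<Longrightarrow> x \<in> U \<and> \<bar>D (\<lambda>x. D f x u) x v - D (\<lambda>x. D f x u) z v\<bar> < e"
      "\<And>x. dist x z < d2 \<Longrightarrow> x \<in> U \<and> \<bar>D (\<lambda>x. D f x v) x u - D (\<lambda>x. D f x v) z u\<bar> < e" by metis
    \<comment> \<open>This scale keeps the parallelogram within \<open>min d1 d2 / 2\<close> of
      \<open>z\<close>; the summand 1 keeps the denominator positive even if \<open>u\<close> and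
      \<open>v\<close> are zero.\<close>
    define h where "h = min d1 d2 / 2 / (norm u + norm v + 1)"
    have nuv: "norm u + norm v + 1 > 0" by (simp add: add_nonneg_pos)
    have h: "h > 0" using d nuv by (simp add: h_def)
    have near: "dist (z + s *\<^sub>R u + t *\<^sub>R v) z < min d1 d2" if "0 \<le> s" "s \<le> h" "0 \<le> t" "t \<le> h" for s t
    proof -
      have "norm (s *\<^sub>R u + t *\<^sub>R v) \<le> s * norm u + t * norm v"
        using that norm_triangle_ineq[of "s *\<^sub>R u" "t *\<^sub>R v"] by simp
      also have "\<dots> \<le> h * norm u + h * norm v" using that by (intro add_mono mult_right_mono) auto
      also have "\<dots> \<le> h * (norm u + norm v + 1)" using h by (simp add: algebra_simps)
      also have "\<dots> = min d1 d2 / 2"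
        using nonzero_eq_divide_eq[THEN iffD1, OF _ h_def] nuv by simp
      also have "\<dots> < min d1 d2" using d by auto
      finally show ?thesis by (simp add: dist_norm add.assoc)
    qed
    obtain s t where 1: "0 < s \<and> s < h \<and> 0 < t \<and> t < h \<and>
       f (z + h *\<^sub>R u + h *\<^sub>R v) - f (z + h *\<^sub>R u) - f (z + h *\<^sub>R v) + f z
     = h * (h * D (\<lambda>x. D f x u) (z + s *\<^sub>R u + t *\<^sub>R v) v)"
      using second_difference[OF f h, of z u v] near d by (metis min_less_iff_conj)
    have near': "dist (z + s *\<^sub>R v + t *\<^sub>R u) z < min d1 d2" if "0 \<le> s" "s \<le> h" "0 \<le> t" "t \<le> h" for s t
      using near[of t s] that by (simp add: algebra_simps)
    obtain s' t' where 2: "0 < s' \<and> s' < h \<and> 0 < t' \<and> t' < h \<and>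
       f (z + h *\<^sub>R v + h *\<^sub>R u) - f (z + h *\<^sub>R v) - f (z + h *\<^sub>R u) + f z
     = h * (h * D (\<lambda>x. D f x v) (z + s' *\<^sub>R v + t' *\<^sub>R u) u)"
      using second_difference[OF f h, of z v u] near' d by (metis min_less_iff_conj)
    have sw: "z + h *\<^sub>R v + h *\<^sub>R u = z + h *\<^sub>R u + h *\<^sub>R v" by (simp add: algebra_simps)
    have "h * (h * D (\<lambda>x. D f x u) (z + s *\<^sub>R u + t *\<^sub>R v) v)
        = h * (h * D (\<lambda>x. D f x v) (z + s' *\<^sub>R v + t' *\<^sub>R u) u)"
      using 1 2 unfolding sw by linarith
    then have "D (\<lambda>x. D f x u) (z + s *\<^sub>R u + t *\<^sub>R v) v = D (\<lambda>x. D f x v) (z + s' *\<^sub>R v + t' *\<^sub>R u) u"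
      using h by simp
    moreover have "\<bar>D (\<lambda>x. D f x u) (z + s *\<^sub>R u + t *\<^sub>R v) v - D (\<lambda>x. D f x u) z v\<bar> < e"
      using d(3) near[of s t] 1 by auto
    moreover have "\<bar>D (\<lambda>x. D f x v) (z + s' *\<^sub>R v + t' *\<^sub>R u) u - D (\<lambda>x. D f x v) z u\<bar> < e"
      using d(4) near'[of s' t'] 2 by auto
    ultimately show ?thesis by linarith
  qed
  show ?thesis
  proof (rule ccontr)
    assume "\<not> ?thesis"
    then show False using close[of "\<bar>D (\<lambda>x. D f x u) z v - D (\<lambda>x. D f x v) z u\<bar> / 4"] by auto
  qed
qed

lemma symmetric_second_D:
  fixes f :: "'a::real_normed_vector \<Rightarrow> 'b::euclidean_space"
  assumes U: "open U" "z \<in> U" and f: "smooth_on U f"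
  shows "D (\<lambda>x. D f x u) z v = D (\<lambda>x. D f x v) z u"
proof (rule euclidean_eqI)
  fix b :: 'b assume "b \<in> Basis"
  have *: "D (\<lambda>x. D f x u) z v \<bullet> b = D (\<lambda>x. D (\<lambda>x. f x \<bullet> b) x u) z v" for u v
  proof -
    have "D (\<lambda>x. D (\<lambda>x. f x \<bullet> b) x u) z v = D (\<lambda>x. D f x u \<bullet> b) z v"
      by (subst D_cong_open[OF U])
        (auto simp: D_bounded_linear[OF bounded_linear_inner_left smooth_on_differentiable[OF f]])
    also have "\<dots> = D (\<lambda>x. D f x u) z v \<bullet> b"
      by (rule D_bounded_linear[OF bounded_linear_inner_left smooth_on_differentiable[OF smooth_on_D_const[OF f] U(2)]])
    finally show ?thesis ..
  qed
  have "smooth_on U (\<lambda>x. f x \<bullet> b)" by (intro smooth_intros U f)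
  then show "D (\<lambda>x. D f x u) z v \<bullet> b = D (\<lambda>x. D f x v) z u \<bullet> b"
    unfolding * by (rule symmetric_second_D_real[OF U])
qed

text \<open>For a vector field \<open>A\<close>, \<open>D (\<lambda>x. D f x (B x)) z (A z)\<close> is \<open>A (B f)\<close>; the difference of
  the two orders is \<open>[A,B] f\<close>.\<close>

lemma D_D:
  fixes f :: "'a::euclidean_space \<Rightarrow> 'b::real_normed_vector"
  assumes "open U" "z \<in> U" "smooth_on U f" "smooth_on U B"
  shows "D (\<lambda>x. D f x (B x)) z a = D (\<lambda>x. D f x (B z)) z a + D f z (D B z a)"
  using D_linear_family[of B z "\<lambda>x. x" U "D f" a] assms
    smooth_on_differentiable[OF smooth_on_D_const[OF assms(3)] assms(2)]
  by (auto simp: D_linear smooth_on_differentiable)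

lemma D_commute:
  fixes f :: "'a::euclidean_space \<Rightarrow> 'b::euclidean_space"
  assumes "open U" "z \<in> U" "smooth_on U f" "smooth_on U A" "smooth_on U B"
  shows "D (\<lambda>x. D f x (B x)) z (A z) - D (\<lambda>x. D f x (A x)) z (B z)
    = D f z (D B z (A z) - D A z (B z))"
  using D_D[OF assms(1-3,5)] D_D[OF assms(1-4)] symmetric_second_D[OF assms(1-3), of "B z" "A z"]
    linear_diff[OF D_linear[OF smooth_on_differentiable[OF assms(3,2)]]] by simp

section \<open>Sprays in coordinates\<close>

lemma ex_not_in_line:
  assumes "DIM('e::euclidean_space) > 1"
  shows "\<exists>X::'e. \<forall>c. X \<noteq> c *\<^sub>R y"
proof -
  have "dim (span {y}) < DIM('e)"
    using assms dim_le_card'[of "{y}"] by (simp add: dim_span)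
  then have "span {y} \<noteq> UNIV" by (metis dim_UNIV less_irrefl)
  then show ?thesis by (auto simp: span_singleton)
qed

lemma ex_not_in_plane:
  assumes "DIM('e::euclidean_space) > 2"
  shows "\<exists>Z::'e. \<forall>c d. Z \<noteq> c *\<^sub>R X + d *\<^sub>R y"
proof -
  have "card {X, y} \<le> 2" by (simp add: card_insert_le_m1)
  then have "dim (span {X, y}) < DIM('e)"
    using assms dim_le_card'[of "{X, y}"] by (simp add: dim_span)
  then have "span {X, y} \<noteq> UNIV" by (metis dim_UNIV less_irrefl)
  then obtain Z where Z: "Z \<notin> span {X, y}" by blast
  have "c *\<^sub>R X + d *\<^sub>R y \<in> span {X, y}" for c d
    by (intro span_add span_scale span_base) auto
  with Z show ?thesis by metis
qed

text \<open>\<open>W\<close> stands for the image of a chart of the slit bundle and \<open>G\<close>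
  for the spray coefficients. The homogeneity \<open>euler\<close> is what \<open>[C, S] = S\<close>
  amounts to in coordinates.\<close>

locale local_spray =
  fixes W :: "('e::euclidean_space \<times> 'e) set" and G :: "'e \<times> 'e \<Rightarrow> 'e"
  assumes W: "open W" and G: "smooth_on W G"
    and euler: "z \<in> W \<Longrightarrow> D G z (0, snd z) = 2 *\<^sub>R G z"
begin

definition spr :: "'e \<times> 'e \<Rightarrow> 'e \<times> 'e" where
  "spr z = (snd z, - 2 *\<^sub>R G z)"

text \<open>The nonlinear connection \<open>N^i_j = dG^i/dy^j\<close>, contracted with
  \<open>X\<close>.\<close>

definition N :: "'e \<Rightarrow> 'e \<times> 'e \<Rightarrow> 'e" where
  "N X = (\<lambda>z. D G z (0, X))"

definition hor :: "'e \<Rightarrow> 'e \<times> 'e \<Rightarrow> 'e \<times> 'e" where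
  "hor X z = (X, - N X z)"

text \<open>The classical formula \<open>2 dG^i/dx^j - S(N^i_j) - N^i_k N^k_j\<close> for the Jacobi
  endomorphism, contracted with \<open>X\<close>; \<open>jacobi_comp\<close> matches it with the
  invariant definition.\<close>

definition jac :: "'e \<Rightarrow> 'e \<times> 'e \<Rightarrow> 'e" where
  "jac X z = 2 *\<^sub>R D G z (X, 0) - D (N X) z (spr z) - D G z (0, N X z)"

text \<open>\<open>[\<delta>\<^sub>X, \<delta>\<^sub>Y] = - (0, curv X Y)\<close> for the horizontal lifts \<open>\<delta>\<^sub>X\<close> of constant vectors.\<close>

definition curv :: "'e \<Rightarrow> 'e \<Rightarrow> 'e \<times> 'e \<Rightarrow> 'e" where
  "curv X Y z = D (N Y) z (hor X z) - D (N X) z (hor Y z)"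

lemma sdiff: "smooth_on W f \<Longrightarrow> z \<in> W \<Longrightarrow> f differentiable (at z)"
  by (rule smooth_on_differentiable)

lemma lin: "smooth_on W f \<Longrightarrow> z \<in> W \<Longrightarrow> linear (D f z)"
  by (intro D_linear sdiff)

lemma D_split: "smooth_on W f \<Longrightarrow> z \<in> W \<Longrightarrow> D f z (a, b) = D f z (a, 0) + D f z (0, b)"
  using linear_add[OF lin, of f z "(a, 0)" "(0, b)"] by simp

lemma D_neg2: "smooth_on W f \<Longrightarrow> z \<in> W \<Longrightarrow> D f z (0, - b) = - D f z (0, b)"
  using linear_neg[OF lin, of f z "(0, b)"] by simp

lemma D_scale2: "smooth_on W f \<Longrightarrow> z \<in> W \<Longrightarrow> D f z (0, c *\<^sub>R b) = c *\<^sub>R D f z (0, b)"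
  using linear_scale[OF lin, of f z c "(0, b)"] by simp

lemma D_add2: "smooth_on W f \<Longrightarrow> z \<in> W \<Longrightarrow> D f z (0, a + b) = D f z (0, a) + D f z (0, b)"
  using linear_add[OF lin, of f z "(0, a)" "(0, b)"] by simp

lemma D_diff2: "smooth_on W f \<Longrightarrow> z \<in> W \<Longrightarrow> D f z (0, a - b) = D f z (0, a) - D f z (0, b)"
  using linear_diff[OF lin, of f z "(0, a)" "(0, b)"] by simp

lemma D_zero: "smooth_on W f \<Longrightarrow> z \<in> W \<Longrightarrow> D f z 0 = 0"
  by (rule linear_0[OF lin])

lemma D_congW: "z \<in> W \<Longrightarrow> (\<And>x. x \<in> W \<Longrightarrow> f x = g x) \<Longrightarrow> D f z = D g z"
  by (rule D_cong_open[OF W])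

lemma D_const_W: "z \<in> W \<Longrightarrow> (\<And>x. x \<in> W \<Longrightarrow> f x = c) \<Longrightarrow> D f z v = 0"
  using D_congW[of z f "\<lambda>_. c"] by simp

lemma commute:
  fixes f :: "'e \<times> 'e \<Rightarrow> 'f::euclidean_space"
  assumes "z \<in> W" "smooth_on W f" "smooth_on W A" "smooth_on W B"
  shows "D (\<lambda>x. D f x (B x)) z (A z) = D (\<lambda>x. D f x (A x)) z (B z) + D f z (D B z (A z) - D A z (B z))"
  using D_commute[OF W assms] by (simp add: algebra_simps)

lemma smooth_N [smooth_intros]: "smooth_on W (N X)"
  unfolding N_def by (intro smooth_intros G W)

lemma smooth_hor [smooth_intros]: "smooth_on W (hor X)"
  unfolding hor_def[abs_def] by (intro smooth_intros W)

lemma smooth_spr [smooth_intros]: "smooth_on W spr"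
  unfolding spr_def[abs_def] by (intro smooth_intros W G)

lemma smooth_liouville [smooth_intros]: "smooth_on W (\<lambda>x. (0, snd x))"
  by (intro smooth_intros W)

lemma smooth_jac [smooth_intros]: "smooth_on W (jac X)"
  unfolding jac_def[abs_def] by (intro smooth_intros W G)

lemma D_hor: "z \<in> W \<Longrightarrow> D (hor X) z v = (0, - D (N X) z v)"
  unfolding hor_def[abs_def]
  by (subst D_Pair) (auto simp: D_minus[OF sdiff[OF smooth_N]] intro!: sdiff smooth_intros W)

lemma D_spr: "z \<in> W \<Longrightarrow> D spr z v = (snd v, - 2 *\<^sub>R D G z v)"
  unfolding spr_def[abs_def]
  by (subst D_Pair)
    (auto simp: D_bounded_linear[OF bounded_linear_snd] D_bounded_linear[OF bounded_linear_scaleR_right]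
      D_minus[OF differentiable_bounded_linear[OF bounded_linear_scaleR_right]] sdiff[OF G]
      intro!: sdiff smooth_intros W G)

lemma D_liouville: "z \<in> W \<Longrightarrow> D (\<lambda>x. (0, snd x)) z v = (0, snd v)"
  by (subst D_Pair) (auto simp: D_bounded_linear[OF bounded_linear_snd] intro!: sdiff smooth_intros W)

lemma D_vert: "z \<in> W \<Longrightarrow> smooth_on W f \<Longrightarrow> D (\<lambda>x. (0, f x)) z v = (0, D f z v)"
  by (subst D_Pair) (auto intro!: sdiff)

lemma euler_D: "z \<in> W \<Longrightarrow> D (\<lambda>x. D G x (0, snd x)) z v = 2 *\<^sub>R D G z v"
  using D_congW[of z "\<lambda>x. D G x (0, snd x)" "\<lambda>x. 2 *\<^sub>R G x"] euler
  by (simp add: D_bounded_linear[OF bounded_linear_scaleR_right sdiff[OF G]])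

lemma N_sym: "z \<in> W \<Longrightarrow> D (N X) z (0, Y) = D (N Y) z (0, X)"
  unfolding N_def by (rule symmetric_second_D[OF W _ G])

lemma N_snd: "z \<in> W \<Longrightarrow> N (snd z) z = 2 *\<^sub>R G z"
  by (simp add: N_def euler)

lemma spr_hor: "z \<in> W \<Longrightarrow> spr z = hor (snd z) z"
  by (simp add: spr_def hor_def N_snd)

text \<open>The commutator of the Liouville field with the constant field \<open>(0, X)\<close> is
  minus the latter, so a vertical derivative lowers the degree of homogeneity by one, here from 2 to
  1.\<close>

lemma N_euler:
  assumes z: "z \<in> W" shows "D (N X) z (0, snd z) = N X z"
proof -
  have "D (N X) z (0, snd z) = D (\<lambda>x. D G x (0, snd x)) z (0, X) + D G z (0 - (0, X))"
    using commute[OF z G, of "\<lambda>x. (0, snd x)" "\<lambda>x. (0, X)"]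
    by (simp add: N_def D_liouville[OF z] smooth_intros W)
  then show ?thesis using z by (simp add: euler_D N_def D_neg2 G scaleR_2)
qed

lemma jac_snd:
  assumes z: "z \<in> W" shows "jac (snd z) z = 0"
proof -
  \<comment> \<open>In \<open>N (snd z)\<close> the argument \<open>snd z\<close> is frozen at the
    point. The derivative of Euler's relation along the spray also contains the motion of that
    argument, which \<open>D_D\<close> separates off.\<close>
  have "D (\<lambda>x. D G x (0, snd x)) z (spr z) = D (N (snd z)) z (spr z) + D G z (0, snd (spr z))"
    using D_D[OF W z G smooth_liouville, of "spr z"] by (simp add: N_def D_liouville[OF z])
  then have "D (N (snd z)) z (spr z) = 2 *\<^sub>R D G z (spr z) - D G z (0, snd (spr z))"
    using z by (simp add: euler_D)
  moreover have "D G z (snd z, 0) = D G z (spr z) + 2 *\<^sub>R D G z (0, G z)"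
    using D_split[OF G z, of "snd z" "- 2 *\<^sub>R G z"] z by (simp add: spr_def D_neg2[OF G] D_scale2[OF G])
  ultimately show ?thesis
    using z by (simp add: jac_def N_snd D_neg2[OF G] D_scale2[OF G] spr_def algebra_simps
      scaleR_left_distrib[of 2 2, simplified])
qed

lemma D_jac:
  assumes z: "z \<in> W"
  shows "D (jac X) z v = 2 *\<^sub>R D (\<lambda>x. D G x (X, 0)) z v
    - D (\<lambda>x. D (N X) x (spr x)) z v - D (\<lambda>x. D G x (0, N X x)) z v"
proof -
  have s1: "smooth_on W (\<lambda>x. D G x (X, 0))"
    by (intro smooth_intros W G)
  have s2: "smooth_on W (\<lambda>x. 2 *\<^sub>R D G x (X, 0))"
    by (intro smooth_intros W G)
  have s3: "smooth_on W (\<lambda>x. D (N X) x (spr x))"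
    by (intro smooth_intros W G)
  have s4: "smooth_on W (\<lambda>x. D G x (0, N X x))"
    by (intro smooth_intros W G)
  note d = s1[THEN sdiff, OF z] s2[THEN sdiff, OF z] s3[THEN sdiff, OF z] s4[THEN sdiff, OF z]
    smooth_on_diff[OF W s2 s3, THEN sdiff, OF z]
  show ?thesis
    unfolding jac_def[abs_def] D_diff[OF d(5,4)] D_diff[OF d(2,3)]
      D_bounded_linear[OF bounded_linear_scaleR_right d(1)] ..
qed

lemma jac_euler:
  assumes z: "z \<in> W" shows "D (jac X) z (0, snd z) = 2 *\<^sub>R jac X z"
proof -
  have 1: "D (\<lambda>x. D G x (X, 0)) z (0, snd z) = 2 *\<^sub>R D G z (X, 0)"
    using commute[OF z G, of "\<lambda>x. (0, snd x)" "\<lambda>x. (X, 0)"] z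
    by (simp add: D_liouville euler_D smooth_intros W zero_prod_def[symmetric] D_zero[OF G])
  have "D (\<lambda>x. D (N X) x (0, snd x)) z (spr z) = D (N X) z (spr z)"
    by (rule fun_cong[OF D_congW]) (auto simp: z N_euler)
  then have 2: "D (\<lambda>x. D (N X) x (spr x)) z (0, snd z) = 2 *\<^sub>R D (N X) z (spr z)"
    using commute[OF z smooth_N[of X], of "\<lambda>x. (0, snd x)" spr] z
    by (simp add: D_liouville D_spr smooth_intros W euler scaleR_2)
      (simp add: spr_def scaleR_2)
  have 3: "D (\<lambda>x. D G x (0, N X x)) z (0, snd z) = 2 *\<^sub>R D G z (0, N X z)"
    using commute[OF z G, of "\<lambda>x. (0, snd x)" "\<lambda>x. (0, N X x)"] z
    by (simp add: D_liouville D_vert smooth_intros W N_euler euler_D zero_prod_def[symmetric] D_zero[OF G])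
  show ?thesis unfolding D_jac[OF z] 1 2 3 by (simp add: jac_def algebra_simps)
qed

text \<open>Coordinate form of \<open>[J, Phi] = 3 R\<close>, where \<open>curv\<close> is minus the
  vertical component of \<open>R\<close>. Third derivatives of \<open>G\<close> along the spray are
  symmetric in \<open>X\<close> and \<open>Y\<close> and drop out. Of the three copies of the
  curvature's x-derivatives, two come from the first term of \<open>jac\<close> and one from the
  commutator of the spray with the vertical derivative.\<close>

lemma vert_jac:
  assumes z: "z \<in> W"
  shows "D (jac X) z (0, Y) - D (jac Y) z (0, X) = 3 *\<^sub>R curv X Y z"
proof -
  have 1: "D (\<lambda>x. D G x (X, 0)) z (0, Y) = D (N Y) z (X, 0)" for X Y
    unfolding N_def by (rule symmetric_second_D[OF W z G])
  have 2: "D (\<lambda>x. D (N X) x (spr x)) z (0, Y) = D (\<lambda>x. D (N X) x (0, Y)) z (spr z)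
      + D (N X) z (Y, - 2 *\<^sub>R N Y z)" for X Y
    using commute[OF z smooth_N[of X], of "\<lambda>x. (0, Y)" spr] z
    by (simp add: D_spr smooth_intros N_def)
  have 3: "D (\<lambda>x. D G x (0, N X x)) z (0, Y) = D (N Y) z (0, N X z) + D G z (0, D (N X) z (0, Y))" for X Y
  proof -
    have "D (\<lambda>x. D G x (0, N X x)) z (0, Y) = D (\<lambda>x. D G x (0, Y)) z (0, N X z) + D G z (0, D (N X) z (0, Y))"
      using commute[OF z G, of "\<lambda>x. (0, Y)" "\<lambda>x. (0, N X x)"] z
      by (simp add: D_vert smooth_intros W)
    then show ?thesis by (simp add: N_def)
  qed
  have 4: "D (\<lambda>x. D (N X) x (0, Y)) z = D (\<lambda>x. D (N Y) x (0, X)) z"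
    by (rule D_congW) (auto simp: z N_sym)
  have 5: "D (N X) z (Y, - 2 *\<^sub>R N Y z) = D (N X) z (Y, 0) - 2 *\<^sub>R D (N X) z (0, N Y z)" for X Y
    using z D_split[OF smooth_N z, of X Y "- 2 *\<^sub>R N Y z"] by (simp add: D_neg2 D_scale2 smooth_N)
  have 6: "D (N X) z (hor Y z) = D (N X) z (Y, 0) - D (N X) z (0, N Y z)" for X Y
    using z D_split[OF smooth_N z, of X Y "- N Y z"] by (simp add: hor_def D_neg2 smooth_N)
  have s3: "3 *\<^sub>R a = a + a + a" for a :: 'e using scaleR_left_distrib[of 2 1 a] by (simp add: scaleR_2)
  show ?thesis
    unfolding D_jac[OF z] 1 2 3 4 5 curv_def 6 N_sym[OF z, of X Y]
    by (simp add: s3 scaleR_2 algebra_simps)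
qed

lemma D_curv:
  assumes z: "z \<in> W"
  shows "D (curv X Y) z v = D (\<lambda>x. D (N Y) x (hor X x)) z v - D (\<lambda>x. D (N X) x (hor Y x)) z v"
  unfolding curv_def[abs_def]
  by (rule D_diff) (intro sdiff[OF _ z] smooth_intros W)+

text \<open>The Jacobi identity for three horizontal lifts.\<close>

lemma bianchi:
  assumes z: "z \<in> W"
  shows "D (curv X Y) z (hor Z z) + D (curv Y Z) z (hor X z) + D (curv Z X) z (hor Y z)
    + D (N Z) z (0, curv X Y z) + D (N X) z (0, curv Y Z z) + D (N Y) z (0, curv Z X z) = 0"
proof -
  have *: "D (\<lambda>x. D (N Y) x (hor X x)) z (hor Z z)
      = D (\<lambda>x. D (N Y) x (hor Z x)) z (hor X z) - D (N Y) z (0, curv Z X z)" for X Y Z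
  proof -
    have "D (hor X) z (hor Z z) - D (hor Z) z (hor X z) = (0, - curv Z X z)"
      by (simp add: D_hor[OF z] curv_def)
    then show ?thesis
      using commute[OF z smooth_N[of Y] smooth_hor[of Z] smooth_hor[of X]]
      by (simp add: D_neg2[OF smooth_N z])
  qed
  show ?thesis
    unfolding D_curv[OF z] *[of Y X Z] *[of Z Y X] *[of X Z Y] by (simp add: algebra_simps)
qed

end

lemma off_line:
  fixes X y :: "'a::real_vector"
  assumes "a *\<^sub>R X = b *\<^sub>R y" "\<And>c. X \<noteq> c *\<^sub>R y" shows "a = 0"
proof (rule ccontr)
  assume "a \<noteq> 0"
  then have "X = inverse a *\<^sub>R (a *\<^sub>R X)" by simp
  then show False using assms by (metis scaleR_scaleR)
qed

lemma off_plane: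
  fixes X y Z :: "'a::real_vector"
  assumes "a *\<^sub>R Z = b *\<^sub>R X + c *\<^sub>R y" "\<And>c d. Z \<noteq> c *\<^sub>R X + d *\<^sub>R y" shows "a = 0"
proof (rule ccontr)
  assume "a \<noteq> 0"
  then have "Z = inverse a *\<^sub>R (a *\<^sub>R Z)" by simp
  then show False using assms by (metis scaleR_scaleR scaleR_right_distrib)
qed

context local_spray begin

lemma D_vert_hor:
  fixes f :: "'e \<times> 'e \<Rightarrow> 'f::euclidean_space"
  assumes "z \<in> W" "smooth_on W f"
  shows "D (\<lambda>x. D f x (0, X)) z (hor Z z) = D (\<lambda>x. D f x (hor Z x)) z (0, X) + D f z (0, D (N Z) z (0, X))"
  using commute[OF assms(1,2) smooth_hor[of Z], of "\<lambda>_. (0, X)"] assms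
  by (simp add: D_hor smooth_intros)

lemma D_euler_hor:
  fixes f :: "'e \<times> 'e \<Rightarrow> 'f::euclidean_space"
  assumes "z \<in> W" "smooth_on W f"
  shows "D (\<lambda>x. D f x (hor X x)) z (0, snd z) = D (\<lambda>x. D f x (0, snd x)) z (hor X z)"
  using commute[OF assms smooth_liouville smooth_hor[of X]] assms
  by (simp add: D_hor D_liouville N_euler hor_def D_zero)

lemma D_euler_vert:
  fixes f :: "'e \<times> 'e \<Rightarrow> 'f::euclidean_space"
  assumes "z \<in> W" "smooth_on W f"
  shows "D (\<lambda>x. D f x (0, X)) z (0, snd z) = D (\<lambda>x. D f x (0, snd x)) z (0, X) - D f z (0, X)"
  using commute[OF assms smooth_liouville, of "\<lambda>_. (0, X)"] assms
  by (simp add: D_liouville D_neg2 smooth_intros)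

end

lemma (in local_spray) linear_jac:
  assumes z: "z \<in> W" shows "linear (\<lambda>X. jac X z)"
proof -
  have N: "linear (\<lambda>X. N X z)" if "z \<in> W" for z
    by (rule linearI) (auto simp: N_def D_add2[OF G that] D_scale2[OF G that])
  have "linear (\<lambda>X. D (N X) z v)" for v
  proof (rule linearI)
    fix X Y :: 'e and c :: real
    have "D (N (X + Y)) z = D (\<lambda>z. N X z + N Y z) z"
      by (rule D_congW[OF z]) (rule linear_add[OF N])
    then show "D (N (X + Y)) z v = D (N X) z v + D (N Y) z v"
      by (simp add: D_add[OF sdiff[OF smooth_N z] sdiff[OF smooth_N z]])
    have "D (N (c *\<^sub>R X)) z = D (\<lambda>z. c *\<^sub>R N X z) z"
      by (rule D_congW[OF z]) (rule linear_scale[OF N])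
    then show "D (N (c *\<^sub>R X)) z v = c *\<^sub>R D (N X) z v"
      by (simp only: D_bounded_linear[OF bounded_linear_scaleR_right sdiff[OF smooth_N z]])
  qed
  moreover have "linear (\<lambda>X. D G z (X, 0))" "linear (\<lambda>X. D G z (0, X))"
    using linear_add[OF lin[OF G z], of "(_, 0)" "(_, 0)"] linear_scale[OF lin[OF G z], of _ "(_, 0)"]
    by (auto intro!: linearI simp: D_add2[OF G z] D_scale2[OF G z])
  ultimately show ?thesis
    unfolding jac_def
    using linear_compose[OF N[OF z], of "\<lambda>X. D G z (0, X)"]
    by (intro linear_compose_sub linear_compose_scale_right) (auto simp: comp_def)
qed

subsection \<open>Isotropic sprays\<close>

locale local_isotropic = local_spray W G
  for W :: "('e::euclidean_space \<times> 'e) set" and G +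
  fixes \<rho> :: "'e \<times> 'e \<Rightarrow> real" and \<alpha> :: "'e \<Rightarrow> 'e \<times> 'e \<Rightarrow> real"
  assumes \<rho>: "smooth_on W \<rho>" and \<alpha>: "smooth_on W (\<alpha> X)"
    and linear_\<alpha>: "z \<in> W \<Longrightarrow> linear (\<lambda>X. \<alpha> X z)"
    and iso: "z \<in> W \<Longrightarrow> jac X z = \<rho> z *\<^sub>R X - \<alpha> X z *\<^sub>R snd z"
    and nz: "z \<in> W \<Longrightarrow> snd z \<noteq> 0"
    and dim: "DIM('e) > 1"
begin

definition \<xi> :: "'e \<Rightarrow> 'e \<times> 'e \<Rightarrow> real" where
  "\<xi> X = (\<lambda>z. (\<alpha> X z + D \<rho> z (0, X)) / 3)"

definition d\<^sub>J\<xi> :: "'e \<Rightarrow> 'e \<Rightarrow> 'e \<times> 'e \<Rightarrow> real" where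
  "d\<^sub>J\<xi> X Y z = D (\<xi> Y) z (0, X) - D (\<xi> X) z (0, Y)"

definition d\<^sub>h\<xi> :: "'e \<Rightarrow> 'e \<Rightarrow> 'e \<times> 'e \<Rightarrow> real" where
  "d\<^sub>h\<xi> X Y z = D (\<xi> Y) z (hor X z) - D (\<xi> X) z (hor Y z)"

lemma smooth_\<xi> [smooth_intros]: "smooth_on W (\<xi> X)"
  unfolding \<xi>_def by (intro smooth_intros W \<alpha> \<rho>) auto

lemma smooth_dJ\<xi> [smooth_intros]: "smooth_on W (d\<^sub>J\<xi> X Y)"
  unfolding d\<^sub>J\<xi>_def[abs_def] by (intro smooth_intros W)

lemma smooth_dh\<xi> [smooth_intros]: "smooth_on W (d\<^sub>h\<xi> X Y)"
  unfolding d\<^sub>h\<xi>_def[abs_def] by (intro smooth_intros W)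

lemma D_jac_iso:
  assumes z: "z \<in> W"
  shows "D (jac X) z v = D \<rho> z v *\<^sub>R X - D (\<alpha> X) z v *\<^sub>R snd z - \<alpha> X z *\<^sub>R snd v"
proof -
  have s: "smooth_on W (\<lambda>z. \<rho> z *\<^sub>R X)" "smooth_on W (\<lambda>z. \<alpha> X z *\<^sub>R snd z)"
    "smooth_on W (\<lambda>z::'e\<times>'e. X)" "smooth_on W (\<lambda>z. snd z)"
    by (intro smooth_intros W \<alpha> \<rho>)+
  have "D (jac X) z = D (\<lambda>z. \<rho> z *\<^sub>R X - \<alpha> X z *\<^sub>R snd z) z"
    by (rule D_congW[OF z iso])
  then show ?thesis
    using D_bounded_linear[OF bounded_linear_snd differentiable_ident, of z v]
    by (simp add: D_diff s(1,2)[THEN sdiff, OF z] D_scaleR[OF sdiff[OF \<rho> z] sdiff[OF s(3) z]]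
        D_scaleR[OF sdiff[OF \<alpha> z] sdiff[OF s(4) z]])
qed

text \<open>Homogeneity of degree two of \<open>jac\<close> is split into coefficients: in dimension
  at least two some \<open>X\<close> lies off the line of \<open>y\<close>, so the coefficient of
  \<open>X\<close> can be isolated. The coefficient of \<open>y\<close> then gives
  \<open>\<alpha>_euler\<close>.\<close>

lemma \<rho>_euler:
  assumes z: "z \<in> W" shows "D \<rho> z (0, snd z) = 2 * \<rho> z"
proof -
  obtain X :: 'e where X: "\<And>c. X \<noteq> c *\<^sub>R snd z" using ex_not_in_line[OF dim] by metis
  have "(D \<rho> z (0, snd z) - 2 * \<rho> z) *\<^sub>R X = (D (\<alpha> X) z (0, snd z) - \<alpha> X z) *\<^sub>R snd z"
    using jac_euler[OF z, of X] scaleR_left_distrib[of "\<alpha> X z" "\<alpha> X z" "snd z"]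
    unfolding D_jac_iso[OF z] iso[OF z] by (simp add: algebra_simps)
  from off_line[OF this X] show ?thesis by simp
qed

lemma \<alpha>_euler:
  assumes z: "z \<in> W" shows "D (\<alpha> X) z (0, snd z) = \<alpha> X z"
proof -
  have "(D (\<alpha> X) z (0, snd z) - \<alpha> X z) *\<^sub>R snd z = 0"
    using jac_euler[OF z, of X] scaleR_left_distrib[of "\<alpha> X z" "\<alpha> X z" "snd z"]
    unfolding D_jac_iso[OF z] iso[OF z] \<rho>_euler[OF z] by (simp add: algebra_simps)
  then show ?thesis using nz[OF z] by simp
qed

lemma D_\<xi>: "z \<in> W \<Longrightarrow> D (\<xi> X) z v = (D (\<alpha> X) z v + D (\<lambda>z. D \<rho> z (0, X)) z v) / 3"
  using D_bounded_linear[OF bounded_linear_divide[of 3], of "\<lambda>z. \<alpha> X z + D \<rho> z (0, X)" z v]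
    D_add[OF sdiff[OF \<alpha>] sdiff, of z "\<lambda>z. D \<rho> z (0, X)" X v]
    smooth_on_add[OF W \<alpha>, of "\<lambda>z. D \<rho> z (0, X)" X]
  by (simp add: \<xi>_def sdiff smooth_intros W \<rho>)

lemma \<xi>_euler:
  assumes z: "z \<in> W" shows "D (\<xi> X) z (0, snd z) = \<xi> X z"
proof -
  have "D (\<lambda>x. D \<rho> x (0, snd x)) z = D (\<lambda>x. 2 * \<rho> x) z"
    by (rule D_congW[OF z \<rho>_euler])
  then have "D (\<lambda>z. D \<rho> z (0, X)) z (0, snd z) = D \<rho> z (0, X)"
    using D_euler_vert[OF z \<rho>, of X]
    by (simp add: D_bounded_linear[OF bounded_linear_mult_right sdiff[OF \<rho> z]])
  then show ?thesis unfolding D_\<xi>[OF z] \<alpha>_euler[OF z] by (simp add: \<xi>_def)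
qed

lemma D_dh\<xi>:
  assumes z: "z \<in> W"
  shows "D (d\<^sub>h\<xi> X Y) z v = D (\<lambda>x. D (\<xi> Y) x (hor X x)) z v - D (\<lambda>x. D (\<xi> X) x (hor Y x)) z v"
  unfolding d\<^sub>h\<xi>_def[abs_def] by (rule D_diff) (intro sdiff[OF _ z] smooth_intros W)+

lemma D_dJ\<xi>:
  assumes z: "z \<in> W"
  shows "D (d\<^sub>J\<xi> X Y) z v = D (\<lambda>x. D (\<xi> Y) x (0, X)) z v - D (\<lambda>x. D (\<xi> X) x (0, Y)) z v"
  unfolding d\<^sub>J\<xi>_def[abs_def] by (rule D_diff) (intro sdiff[OF _ z] smooth_intros W)+

lemma dh\<xi>_euler:
  assumes z: "z \<in> W" shows "D (d\<^sub>h\<xi> X Y) z (0, snd z) = d\<^sub>h\<xi> X Y z"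
proof -
  have "D (\<lambda>x. D (\<xi> X) x (0, snd x)) z = D (\<xi> X) z" for X
    by (rule D_congW[OF z \<xi>_euler])
  then show ?thesis
    unfolding D_dh\<xi>[OF z] by (simp add: D_euler_hor[OF z smooth_\<xi>] d\<^sub>h\<xi>_def)
qed

text \<open>This is \<open>R = \<xi> \<and> J - d_J \<xi> \<otimes> C\<close> up to the sign of
  \<open>curv\<close>. Inserting the isotropic form of \<open>jac\<close> into
  \<open>vert_jac\<close> produces \<open>\<alpha> + d_J \<rho>\<close>, and its third part on both
  sides explains the definition of \<open>\<xi>\<close>; \<open>d_J d_J \<rho> = 0\<close> lets
  \<open>\<xi>\<close> replace \<open>\<alpha> / 3\<close> in the \<open>y\<close> term.\<close>

lemma curv_iso:
  assumes z: "z \<in> W"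
  shows "curv X Y z = \<xi> Y z *\<^sub>R X - \<xi> X z *\<^sub>R Y + d\<^sub>J\<xi> X Y z *\<^sub>R snd z"
proof -
  have sym: "D (\<lambda>z. D \<rho> z (0, X)) z (0, Y) = D (\<lambda>z. D \<rho> z (0, Y)) z (0, X)"
    by (rule symmetric_second_D[OF W z \<rho>])
  have "3 *\<^sub>R curv X Y z = 3 *\<^sub>R (\<xi> Y z *\<^sub>R X - \<xi> X z *\<^sub>R Y + d\<^sub>J\<xi> X Y z *\<^sub>R snd z)"
    unfolding vert_jac[OF z, symmetric] D_jac_iso[OF z] d\<^sub>J\<xi>_def D_\<xi>[OF z] sym
    by (simp add: \<xi>_def algebra_simps diff_divide_distrib add_divide_distrib)
  then show ?thesis by simp
qed

lemma D_curv_iso: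
  assumes z: "z \<in> W"
  shows "D (curv X Y) z v = D (\<xi> Y) z v *\<^sub>R X - D (\<xi> X) z v *\<^sub>R Y + D (d\<^sub>J\<xi> X Y) z v *\<^sub>R snd z
    + d\<^sub>J\<xi> X Y z *\<^sub>R snd v"
proof -
  have s: "smooth_on W (\<lambda>z. \<xi> Y z *\<^sub>R X)" "smooth_on W (\<lambda>z. \<xi> X z *\<^sub>R Y)"
    "smooth_on W (\<lambda>z. \<xi> Y z *\<^sub>R X - \<xi> X z *\<^sub>R Y)"
    "smooth_on W (\<lambda>z. d\<^sub>J\<xi> X Y z *\<^sub>R snd z)" "smooth_on W (\<lambda>z::'e\<times>'e. snd z)"
    by (intro smooth_intros W)+
  have c: "D (\<lambda>z. \<xi> Y z *\<^sub>R X) z v = D (\<xi> Y) z v *\<^sub>R X" for X Y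
    using D_scaleR[OF sdiff[OF smooth_\<xi> z] differentiable_const, of Y X v] by simp
  have "D (curv X Y) z = D (\<lambda>z. \<xi> Y z *\<^sub>R X - \<xi> X z *\<^sub>R Y + d\<^sub>J\<xi> X Y z *\<^sub>R snd z) z"
    by (rule D_congW[OF z curv_iso])
  then show ?thesis
    using D_bounded_linear[OF bounded_linear_snd differentiable_ident, of z v]
    by (simp add: D_add[OF s(3,4)[THEN sdiff, OF z]] D_diff[OF s(1,2)[THEN sdiff, OF z]] c
        D_scaleR[OF sdiff[OF smooth_dJ\<xi> z] sdiff[OF s(5) z]])
qed

text \<open>When \<open>curv_iso\<close> is inserted into \<open>bianchi\<close>, the products of
  \<open>\<xi>\<close> with derivatives of \<open>N\<close> cancel in the cyclic sum by
  \<open>N_sym\<close>, and the terms \<open>d\<^sub>J\<xi> X Y z\<close> times \<open>N Z z\<close>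
  cancel against the derivative of the factor \<open>y\<close> along the lift of
  \<open>Z\<close>.\<close>

lemma bianchi_iso:
  assumes z: "z \<in> W"
  shows "d\<^sub>h\<xi> X Y z *\<^sub>R Z + d\<^sub>h\<xi> Y Z z *\<^sub>R X + d\<^sub>h\<xi> Z X z *\<^sub>R Y =
    - (D (d\<^sub>h\<xi> X Y) z (0, Z) + D (d\<^sub>h\<xi> Y Z) z (0, X) + D (d\<^sub>h\<xi> Z X) z (0, Y)) *\<^sub>R snd z"
proof -
  have N: "D (N Z) z (0, curv X Y z) = \<xi> Y z *\<^sub>R D (N X) z (0, Z) - \<xi> X z *\<^sub>R D (N Y) z (0, Z)
      + d\<^sub>J\<xi> X Y z *\<^sub>R N Z z" for X Y Z
    unfolding curv_iso[OF z]
    by (simp add: D_add2[OF smooth_N z] D_diff2[OF smooth_N z] D_scale2[OF smooth_N z] N_euler[OF z]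
        N_sym[OF z, of Z])
  \<comment> \<open>This is \<open>d_h d_J \<xi> = - d_J d_h \<xi>\<close>: the commutators of
    vertical and horizontal fields involve only the symmetric derivative of
    \<open>N\<close>.\<close>
  have "D (d\<^sub>J\<xi> X Y) z (hor Z z) + D (d\<^sub>J\<xi> Y Z) z (hor X z) + D (d\<^sub>J\<xi> Z X) z (hor Y z)
      = - (D (d\<^sub>h\<xi> X Y) z (0, Z) + D (d\<^sub>h\<xi> Y Z) z (0, X) + D (d\<^sub>h\<xi> Z X) z (0, Y))"
    unfolding D_dJ\<xi>[OF z] D_dh\<xi>[OF z] D_vert_hor[OF z smooth_\<xi>]
    by (simp add: N_sym[OF z, of Y X] N_sym[OF z, of Z X] N_sym[OF z, of Z Y])
  moreover have "d\<^sub>h\<xi> X Y z *\<^sub>R Z + d\<^sub>h\<xi> Y Z z *\<^sub>R X + d\<^sub>h\<xi> Z X z *\<^sub>R Y =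
    (D (d\<^sub>J\<xi> X Y) z (hor Z z) + D (d\<^sub>J\<xi> Y Z) z (hor X z) + D (d\<^sub>J\<xi> Z X) z (hor Y z)) *\<^sub>R snd z"
    using bianchi[OF z, of X Y Z] unfolding N D_curv_iso[OF z]
    by (simp add: N_sym[OF z, of Y X] N_sym[OF z, of Z X] N_sym[OF z, of Z Y] hor_def d\<^sub>h\<xi>_def
        algebra_simps)
  ultimately show ?thesis by simp
qed

lemma linear_\<xi>: "z \<in> W \<Longrightarrow> linear (\<lambda>X. \<xi> X z)"
proof (rule linearI)
  fix X Y :: 'e and c :: real assume z: "z \<in> W"
  show "\<xi> (X + Y) z = \<xi> X z + \<xi> Y z"
    using linear_add[OF linear_\<alpha>[OF z], of X Y] by (simp add: \<xi>_def D_add2[OF \<rho> z] add_divide_distrib)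
  show "\<xi> (c *\<^sub>R X) z = c *\<^sub>R \<xi> X z"
    using linear_scale[OF linear_\<alpha>[OF z], of c X] by (simp add: \<xi>_def D_scale2[OF \<rho> z] algebra_simps)
qed

lemma linear_D_\<xi>:
  assumes z: "z \<in> W" shows "linear (\<lambda>X. D (\<xi> X) z v)"
proof (rule linearI)
  fix X Y :: 'e and c :: real
  have "D (\<xi> (X + Y)) z = D (\<lambda>z. \<xi> X z + \<xi> Y z) z"
    by (rule D_congW[OF z]) (rule linear_add[OF linear_\<xi>])
  then show "D (\<xi> (X + Y)) z v = D (\<xi> X) z v + D (\<xi> Y) z v"
    by (simp add: D_add[OF sdiff[OF smooth_\<xi> z] sdiff[OF smooth_\<xi> z]])
  have "D (\<xi> (c *\<^sub>R X)) z = D (\<lambda>z. c *\<^sub>R \<xi> X z) z"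
    by (rule D_congW[OF z]) (rule linear_scale[OF linear_\<xi>])
  then show "D (\<xi> (c *\<^sub>R X)) z v = c *\<^sub>R D (\<xi> X) z v"
    by (simp only: D_bounded_linear[OF bounded_linear_scaleR_right sdiff[OF smooth_\<xi> z]])
qed

lemma linear_dh\<xi>:
  assumes z: "z \<in> W" shows "linear (\<lambda>Y. d\<^sub>h\<xi> X Y z)"
proof -
  have "linear (\<lambda>Y. hor Y z)"
    by (rule linearI) (auto simp: hor_def N_def D_add2[OF G z] D_scale2[OF G z])
  from linear_compose[OF this lin[OF smooth_\<xi>[of X] z]]
  show ?thesis unfolding d\<^sub>h\<xi>_def comp_def by (intro linear_compose_sub linear_D_\<xi> z)
qed

theorem dh\<xi>_eq_0:
  assumes dim3: "DIM('e) > 2" and z: "z \<in> W"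
  shows "d\<^sub>h\<xi> X Y z = 0"
proof -
  have anti: "d\<^sub>h\<xi> Y X w = - d\<^sub>h\<xi> X Y w" for X Y w by (simp add: d\<^sub>h\<xi>_def)
  text \<open>Contraction with \<open>\<C>\<close>: compare the coefficients of \<open>Z \<notin> span {X, y}\<close> in the Bianchi identity.\<close>
  have y: "d\<^sub>h\<xi> X (snd w) w = 0" if w: "w \<in> W" for X w
  proof -
    obtain Z :: 'e where Z: "\<And>c d. Z \<noteq> c *\<^sub>R X + d *\<^sub>R snd w" using ex_not_in_plane[OF dim3] by metis
    define T where "T = D (d\<^sub>h\<xi> X (snd w)) w (0, Z) + D (d\<^sub>h\<xi> (snd w) Z) w (0, X) + D (d\<^sub>h\<xi> Z X) w (0, snd w)"
    have "d\<^sub>h\<xi> X (snd w) w *\<^sub>R Z = (- d\<^sub>h\<xi> (snd w) Z w) *\<^sub>R X + (- T - d\<^sub>h\<xi> Z X w) *\<^sub>R snd w"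
      using bianchi_iso[OF w, of X "snd w" Z] unfolding T_def[symmetric] by (simp add: algebra_simps)
    from off_plane[OF this Z] show ?thesis .
  qed
  \<comment> \<open>The contraction with \<open>y\<close> vanishes identically, so it may be
    differentiated vertically; the product rule \<open>e1\<close> then expresses the derivative at
    frozen \<open>y\<close> by \<open>d\<^sub>h\<xi>\<close> itself.\<close>
  have e0: "D (\<lambda>w. d\<^sub>h\<xi> X (snd w) w) z (0, Y) = 0" for X Y
    by (rule D_const_W[OF z y])
  have e1: "D (\<lambda>w. d\<^sub>h\<xi> X (snd w) w) z (0, Y) = D (d\<^sub>h\<xi> X (snd z)) z (0, Y) + d\<^sub>h\<xi> X Y z" for X Y
    using D_linear_family[where k = "\<lambda>x Y. d\<^sub>h\<xi> X Y x" and g = "\<lambda>x. x" and m = snd and V = W and z = z and x = "(0, Y)"]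
      sdiff[OF smooth_dh\<xi> z] linear_dh\<xi> W z D_bounded_linear[OF bounded_linear_snd differentiable_ident, of z "(0, Y)"]
      sdiff[OF smooth_on_snd[OF W smooth_on_id] z]
    by simp
  have e: "D (d\<^sub>h\<xi> X (snd z)) z (0, Y) = - d\<^sub>h\<xi> X Y z" for X Y
    using e0[of X Y] unfolding e1 by (simp add: eq_neg_iff_add_eq_0)
  have e': "D (d\<^sub>h\<xi> (snd z) X) z (0, Y) = d\<^sub>h\<xi> X Y z" for X Y
  proof -
    have "d\<^sub>h\<xi> (snd z) X = (\<lambda>w. - d\<^sub>h\<xi> X (snd z) w)" using anti by blast
    then show ?thesis by (simp add: D_minus[OF sdiff[OF smooth_dh\<xi> z]] e)
  qed
  \<comment> \<open>Each of the three vertical derivatives in the Bianchi identity contributes one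
    \<open>d\<^sub>h\<xi> X Y z\<close>: one by homogeneity, the other two by \<open>e\<close> and
    \<open>e'\<close>.\<close>
  have "d\<^sub>h\<xi> X Y z *\<^sub>R snd z = - (3 * d\<^sub>h\<xi> X Y z) *\<^sub>R snd z"
    using bianchi_iso[OF z, of X Y "snd z"]
    by (simp add: y[OF z] anti[of "snd z"] dh\<xi>_euler[OF z] e e' anti[of Y X])
  then have "d\<^sub>h\<xi> X Y z = - (3 * d\<^sub>h\<xi> X Y z)" using nz[OF z] unfolding scaleR_cancel_right by blast
  then show ?thesis by simp
qed

end


subsection \<open>Geodesic sprays of Finsler functions\<close>

text \<open>\<open>EL\<close> is assumed at \<open>z\<close> only, since it is available just in the
  chart selected at that point. The second conclusion asks for the first one on all of
  \<open>W\<close> because it differentiates it.\<close>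

lemma (in local_spray) euler_lagrange:
  fixes L :: "'e \<times> 'e \<Rightarrow> real"
  assumes z: "z \<in> W" and L: "smooth_on W L" and eL: "\<And>x. x \<in> W \<Longrightarrow> D L x (0, snd x) = 2 * L x"
    and EL: "\<And>X. D (\<lambda>x. D L x (0, X)) z (spr z) = D L z (X, 0)"
  shows euler_lagrange_spr: "D L z (spr z) = 0"
    and euler_lagrange_hor: "(\<And>x. x \<in> W \<Longrightarrow> D L x (spr x) = 0) \<Longrightarrow> D L z (hor X z) = 0"
proof -
  have "D (\<lambda>x. D L x (0, snd x)) z = D (\<lambda>x. 2 * L x) z"
    by (rule D_congW[OF z eL])
  then have "2 * D L z (spr z) = D L z (snd z, 0) + D L z (0, - 2 *\<^sub>R G z)"
    using D_D[OF W z L smooth_liouville, of "spr z"]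
    using EL[of "snd z"]
    by (simp add: D_liouville[OF z] spr_def D_bounded_linear[OF bounded_linear_mult_right sdiff[OF L z]])
  also have "\<dots> = D L z (spr z)"
    using D_split[OF L z, of "snd z" "- 2 *\<^sub>R G z"] by (simp add: spr_def)
  finally show "D L z (spr z) = 0" by simp
  show "D L z (hor X z) = 0" if 0: "\<And>x. x \<in> W \<Longrightarrow> D L x (spr x) = 0"
  proof -
    \<comment> \<open>The commutator of \<open>(0, X)\<close> with the spray is
      \<open>(X, - 2 N X)\<close>. Together with \<open>EL\<close>, the vertical derivative of
      \<open>S L\<close> becomes twice the horizontal derivative of \<open>L\<close>.\<close>
    have "D (\<lambda>x. D L x (spr x)) z (0, X) = 0" by (rule D_const_W[OF z 0])
    then have "D L z (X, 0) = D L z (- (X, - 2 *\<^sub>R N X z))"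
      using commute[OF z L smooth_spr, of "\<lambda>_. (0, X)"]
      by (simp add: EL D_spr[OF z] smooth_intros N_def)
    moreover have "D L z (X, - 2 *\<^sub>R N X z) = D L z (X, 0) - 2 * D L z (0, N X z)"
      using D_split[OF L z, of X "- 2 *\<^sub>R N X z"] by (simp add: D_neg2[OF L z] D_scale2[OF L z])
    moreover have "D L z (hor X z) = D L z (X, 0) - D L z (0, N X z)"
      using D_split[OF L z, of X "- N X z"] by (simp add: D_neg2[OF L z] hor_def)
    ultimately show ?thesis by (simp only: linear_neg[OF lin[OF L z]])
  qed
qed

text \<open>Constancy along horizontal lifts takes the place of the Euler-Lagrange equation, as it
  is available in every chart on the whole domain.\<close>

locale local_finsler = local_spray W G
  for W :: "('e::euclidean_space \<times> 'e) set" and G +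
  fixes L :: "'e \<times> 'e \<Rightarrow> real"
  assumes L: "smooth_on W L" and L_pos: "z \<in> W \<Longrightarrow> L z > 0"
    and L_euler: "z \<in> W \<Longrightarrow> D L z (0, snd z) = 2 * L z"
    and L_hor: "z \<in> W \<Longrightarrow> D L z (hor X z) = 0"
begin

lemma L_jac:
  assumes z: "z \<in> W" shows "D L z (0, jac X z) = 0"
proof -
  have 1: "D (\<lambda>x. D L x (hor X x)) z (spr z) = 0" by (rule D_const_W[OF z L_hor])
  have 2: "D (\<lambda>x. D L x (spr x)) z (hor X z) = 0"
    by (rule D_const_W[OF z]) (simp add: spr_hor L_hor)
  have "D spr z (hor X z) = (- N X z, - 2 *\<^sub>R (D G z (X, 0) - D G z (0, N X z)))"
    using D_split[OF G z, of X "- N X z"] by (simp add: D_spr[OF z] hor_def D_neg2[OF G z])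
  \<comment> \<open>The bracket of the spray with the lift of \<open>X\<close> is the lift of
    \<open>N X\<close> plus the vertical vector \<open>jac X\<close>; the lift does not change
    \<open>L\<close>.\<close>
  then have "D (hor X) z (spr z) - D spr z (hor X z) = hor (N X z) z + (0, jac X z)"
    by (simp add: D_hor[OF z] hor_def jac_def N_def algebra_simps scaleR_2)
  then have "D L z (hor (N X z) z + (0, jac X z)) = 0"
    using commute[OF z L smooth_spr smooth_hor, of X] 1 2 by simp
  then show ?thesis by (simp add: linear_add[OF lin[OF L z]] L_hor[OF z])
qed

text \<open>This is \<open>d_h d_J L = 0\<close>: horizontal derivatives of \<open>L\<close> vanish,
  so only a commutator of a vertical and a horizontal field remains, and it is symmetric by
  \<open>N_sym\<close>. It removes the second derivatives of \<open>L\<close> from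
  \<open>d\<^sub>h\<xi>\<close>.\<close>

lemma L_vert_hor_sym:
  assumes z: "z \<in> W"
  shows "D (\<lambda>x. D L x (0, Y)) z (hor X z) = D (\<lambda>x. D L x (0, X)) z (hor Y z)"
proof -
  have "D (\<lambda>x. D L x (hor X x)) z v = 0" for X v by (rule D_const_W[OF z L_hor])
  then show ?thesis by (simp add: D_vert_hor[OF z L] N_sym[OF z, of Y])
qed

end

locale local_isotropic_finsler = local_isotropic W G \<rho> \<alpha> + local_finsler W G L
  for W :: "('e::euclidean_space \<times> 'e) set" and G \<rho> \<alpha> L
begin

definition \<kappa> :: "'e \<times> 'e \<Rightarrow> real" where "\<kappa> z = \<rho> z / L z"

lemma smooth_\<kappa> [smooth_intros]: "smooth_on W \<kappa>"
proof -
  have "L z \<noteq> 0" if "z \<in> W" for z using L_pos[OF that] by simp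
  then show ?thesis unfolding \<kappa>_def[abs_def] by (intro smooth_intros W \<rho> L)
qed

lemma \<rho>_\<kappa>: "z \<in> W \<Longrightarrow> \<rho> z = \<kappa> z * L z"
  using L_pos[of z] by (simp add: \<kappa>_def)

text \<open>The differential of \<open>L\<close> kills the image of \<open>jac\<close>; applied to
  its isotropic form it expresses \<open>\<alpha>\<close> by \<open>\<rho>\<close>. The 2 is the
  degree of \<open>L\<close>.\<close>

lemma \<alpha>_\<kappa>:
  assumes z: "z \<in> W" shows "\<alpha> X z = \<kappa> z / 2 * D L z (0, X)"
proof -
  have "\<rho> z * D L z (0, X) = \<alpha> X z * (2 * L z)"
    using L_jac[OF z, of X] unfolding iso[OF z]
    by (simp add: D_diff2[OF L z] D_scale2[OF L z] L_euler[OF z])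
  then show ?thesis using L_pos[OF z] by (simp add: \<kappa>_def field_simps)
qed

lemma D_\<rho>_\<kappa>:
  assumes z: "z \<in> W" shows "D \<rho> z v = \<kappa> z * D L z v + D \<kappa> z v * L z"
  using D_congW[OF z \<rho>_\<kappa>] D_mult[OF sdiff[OF smooth_\<kappa> z] sdiff[OF L z]] by simp

lemma \<kappa>_euler:
  assumes z: "z \<in> W" shows "D \<kappa> z (0, snd z) = 0"
  using \<rho>_euler[OF z] L_pos[OF z] unfolding D_\<rho>_\<kappa>[OF z] L_euler[OF z] \<rho>_\<kappa>[OF z] by simp

lemma \<xi>_\<kappa>:
  assumes z: "z \<in> W" shows "\<xi> X z = \<kappa> z * D L z (0, X) / 2 + D \<kappa> z (0, X) * L z / 3"
  unfolding \<xi>_def \<alpha>_\<kappa>[OF z] D_\<rho>_\<kappa>[OF z] by (simp add: field_simps)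

lemma D_\<xi>_\<kappa>:
  assumes z: "z \<in> W"
  shows "D (\<xi> X) z v = (D \<kappa> z v * D L z (0, X) + \<kappa> z * D (\<lambda>z. D L z (0, X)) z v) / 2
    + (D (\<lambda>z. D \<kappa> z (0, X)) z v * L z + D \<kappa> z (0, X) * D L z v) / 3"
proof -
  have s: "smooth_on W (\<lambda>z. D L z (0, X))" "smooth_on W (\<lambda>z. D \<kappa> z (0, X))"
    "smooth_on W (\<lambda>z. \<kappa> z * D L z (0, X))" "smooth_on W (\<lambda>z. D \<kappa> z (0, X) * L z)"
    "smooth_on W (\<lambda>z. \<kappa> z * D L z (0, X) / 2)" "smooth_on W (\<lambda>z. D \<kappa> z (0, X) * L z / 3)"
    by (intro smooth_intros W L; simp)+
  have "D (\<xi> X) z v = D (\<lambda>z. \<kappa> z * D L z (0, X) / 2 + D \<kappa> z (0, X) * L z / 3) z v"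
    by (rule fun_cong[OF D_congW[OF z \<xi>_\<kappa>]])
  also have "\<dots> = D (\<lambda>z. \<kappa> z * D L z (0, X)) z v / 2 + D (\<lambda>z. D \<kappa> z (0, X) * L z) z v / 3"
    unfolding D_add[OF s(5,6)[THEN sdiff, OF z]]
      D_bounded_linear[OF bounded_linear_divide s(3)[THEN sdiff, OF z]]
      D_bounded_linear[OF bounded_linear_divide s(4)[THEN sdiff, OF z]] ..
  finally show ?thesis
    unfolding D_mult[OF sdiff[OF smooth_\<kappa> z] sdiff[OF s(1) z]] D_mult[OF sdiff[OF s(2) z] sdiff[OF L z]]
    by (simp only: add.commute)
qed

text \<open>Symmetric second derivatives cancel, and the condition says that
  \<open>1/2 - 1/3\<close> times the wedge of the vertical differentials of \<open>\<kappa>\<close>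
  and \<open>L\<close> is zero. Contraction with \<open>y\<close> decides, because
  \<open>\<kappa>\<close> has degree 0 and \<open>L\<close> degree 2.\<close>

lemma \<kappa>_vert:
  assumes z: "z \<in> W" and 0: "\<And>X Y. d\<^sub>J\<xi> X Y z = 0"
  shows "D \<kappa> z (0, X) = 0"
proof -
  have "D (\<lambda>z. D \<kappa> z (0, X)) z (0, Y) = D (\<lambda>z. D \<kappa> z (0, Y)) z (0, X)"
    "D (\<lambda>z. D L z (0, X)) z (0, Y) = D (\<lambda>z. D L z (0, Y)) z (0, X)" for Y
    by (rule symmetric_second_D[OF W z]; intro smooth_intros L)+
  then have "D \<kappa> z (0, X) * D L z (0, Y) = D \<kappa> z (0, Y) * D L z (0, X)" for Y
    using 0[of X Y] unfolding d\<^sub>J\<xi>_def D_\<xi>_\<kappa>[OF z] by (simp add: field_simps)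
  from this[of "snd z"] show ?thesis using L_pos[OF z] by (simp add: \<kappa>_euler[OF z] L_euler[OF z])
qed

text \<open>Contracting the wedge of the differentials of \<open>\<kappa>\<close> and
  \<open>L\<close> with \<open>y\<close> leaves the value on \<open>y\<close> as the only
  obstruction, which the last hypothesis removes. Vertical constancy is required on all of
  \<open>W\<close>, since it is differentiated along horizontal lifts.\<close>

lemma \<kappa>_hor:
  assumes z: "z \<in> W" and v: "\<And>x X. x \<in> W \<Longrightarrow> D \<kappa> x (0, X) = 0" and 1: "\<And>X Y. d\<^sub>h\<xi> X Y z = 0"
    and 2: "D \<kappa> z (snd z, 0) = 0"
  shows "D \<kappa> z (X, 0) = 0"
proof -
  have "D (\<lambda>z. D \<kappa> z (0, X)) z u = 0" for X u by (rule D_const_W[OF z v])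
  then have "D \<kappa> z (hor X z) * D L z (0, Y) = D \<kappa> z (hor Y z) * D L z (0, X)" for Y
    using 1[of X Y] L_vert_hor_sym[OF z, of X Y] unfolding d\<^sub>h\<xi>_def D_\<xi>_\<kappa>[OF z] by (simp add: v[OF z])
  moreover have "D \<kappa> z (hor X z) = D \<kappa> z (X, 0)" for X
    using D_split[OF smooth_\<kappa> z, of X "- N X z"] v[OF z] by (simp add: hor_def)
  ultimately have "D \<kappa> z (X, 0) * D L z (0, Y) = D \<kappa> z (Y, 0) * D L z (0, X)" for Y by simp
  from this[of "snd z"] show ?thesis using L_pos[OF z] 2 by (simp add: L_euler[OF z])
qed

lemma const_\<xi>:
  assumes z: "z \<in> W" and c: "\<And>x. x \<in> W \<Longrightarrow> \<kappa> x = c"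
  shows "d\<^sub>J\<xi> X Y z = 0" "d\<^sub>h\<xi> X Y z = 0"
proof -
  have 0: "D \<kappa> x v = 0" if "x \<in> W" for x v by (rule D_const_W[OF that c])
  have 1: "D (\<lambda>z. D \<kappa> z (0, X)) z u = 0" for X u by (rule D_const_W[OF z 0])
  show "d\<^sub>J\<xi> X Y z = 0"
    using symmetric_second_D[OF W z L, of "(0, X)" "(0, Y)"]
    unfolding d\<^sub>J\<xi>_def D_\<xi>_\<kappa>[OF z] by (simp add: 0[OF z] 1)
  show "d\<^sub>h\<xi> X Y z = 0"
    using L_vert_hor_sym[OF z, of X Y]
    unfolding d\<^sub>h\<xi>_def D_\<xi>_\<kappa>[OF z] by (simp add: 0[OF z] 1)
qed

end

section \<open>Tensoriality\<close>

text \<open>Openness is imposed on coordinate images and not on sets of points, so the same locale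
  serves for \<open>A\<close> and for \<open>slit_atlas A\<close>, whose points carry no topology
  here.\<close>

locale atlas =
  fixes B :: "('x, 'e::euclidean_space) chart set"
  assumes inj: "c \<in> B \<Longrightarrow> inj_on (cmap c) (cdom c)"
    and open_cimg: "c \<in> B \<Longrightarrow> open (cimg c)"
    and open_overlap: "c \<in> B \<Longrightarrow> c' \<in> B \<Longrightarrow> open (cmap c ` (cdom c \<inter> cdom c'))"
    and smooth_transition: "c \<in> B \<Longrightarrow> c' \<in> B \<Longrightarrow>
      smooth_on (cmap c ` (cdom c \<inter> cdom c')) (transition c c')"
begin

abbreviation overlap where "overlap c c' \<equiv> cmap c ` (cdom c \<inter> cdom c')"

definition jacobian :: "('x, 'e) chart \<Rightarrow> ('x, 'e) chart \<Rightarrow> 'x \<Rightarrow> 'e \<Rightarrow> 'e" where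
  "jacobian c c' u = D (transition c c') (cmap c u)"

abbreviation T where "T \<equiv> tangent_space B"

lemma cinv_cmap: "c \<in> B \<Longrightarrow> u \<in> cdom c \<Longrightarrow> cinv c (cmap c u) = u"
  by (simp add: cinv_def inj)

lemma cinv_in: "z \<in> cimg c \<Longrightarrow> cinv c z \<in> cdom c"
  by (auto simp: cinv_def cimg_def intro: inv_into_into)

lemma cmap_cinv: "z \<in> cimg c \<Longrightarrow> cmap c (cinv c z) = z"
  by (auto simp: cinv_def cimg_def f_inv_into_f)

lemma cmap_in: "u \<in> cdom c \<Longrightarrow> cmap c u \<in> cimg c"
  by (simp add: cimg_def)

lemma transition_cmap: "c \<in> B \<Longrightarrow> u \<in> cdom c \<Longrightarrow> transition c c' (cmap c u) = cmap c' u"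
  by (simp add: transition_def cinv_cmap)

lemma overlap_subset: "overlap c c' \<subseteq> cimg c"
  by (auto simp: cimg_def)

lemma transition_differentiable:
  "c \<in> B \<Longrightarrow> c' \<in> B \<Longrightarrow> u \<in> cdom c \<Longrightarrow> u \<in> cdom c' \<Longrightarrow> transition c c' differentiable (at (cmap c u))"
  by (rule smooth_on_differentiable[OF smooth_transition]) auto

lemma linear_jacobian:
  "c \<in> B \<Longrightarrow> c' \<in> B \<Longrightarrow> u \<in> cdom c \<Longrightarrow> u \<in> cdom c' \<Longrightarrow> linear (jacobian c c' u)"
  unfolding jacobian_def by (intro D_linear transition_differentiable)

lemma jacobian_self: "c \<in> B \<Longrightarrow> u \<in> cdom c \<Longrightarrow> jacobian c c u w = w"
  using D_cong_open[OF open_cimg cmap_in, of c u "transition c c" "\<lambda>z. z"]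
  by (simp add: jacobian_def transition_def cmap_cinv)

lemma jacobian_comp:
  assumes c: "c \<in> B" "c' \<in> B" "c'' \<in> B" and u: "u \<in> cdom c" "u \<in> cdom c'" "u \<in> cdom c''"
  shows "jacobian c c'' u w = jacobian c' c'' u (jacobian c c' u w)"
proof -
  let ?O = "overlap c c' \<inter> overlap c c''"
  have "D (transition c c'') (cmap c u) = D (\<lambda>z. transition c' c'' (transition c c' z)) (cmap c u)"
  proof (rule D_cong_open)
    show "open ?O" by (intro open_Int open_overlap c)
    show "cmap c u \<in> ?O" using u by auto
    fix z assume "z \<in> ?O"
    then obtain p where "p \<in> cdom c" "p \<in> cdom c'" "z = cmap c p" by auto
    then show "transition c c'' z = transition c' c'' (transition c c' z)"
      by (simp add: transition_cmap c)
  qed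
  then show ?thesis
    using D_compose[of "transition c c'" "cmap c u" "transition c' c''" w]
    by (simp add: jacobian_def transition_cmap transition_differentiable c u)
qed

lemma tangent_comp:
  "X \<in> T u \<Longrightarrow> c \<in> B \<Longrightarrow> c' \<in> B \<Longrightarrow> u \<in> cdom c \<Longrightarrow> u \<in> cdom c' \<Longrightarrow> X c' = jacobian c c' u (X c)"
  unfolding tangent_space_def jacobian_def by blast

lemma tangent_zero: "X \<in> T u \<Longrightarrow> \<not> (c \<in> B \<and> u \<in> cdom c) \<Longrightarrow> X c = 0"
  unfolding tangent_space_def by blast

lemma tangentI:
  assumes "\<And>c. \<not> (c \<in> B \<and> u \<in> cdom c) \<Longrightarrow> X c = 0"
    and "\<And>c c'. c \<in> B \<Longrightarrow> c' \<in> B \<Longrightarrow> u \<in> cdom c \<Longrightarrow> u \<in> cdom c' \<Longrightarrow> X c' = jacobian c c' u (X c)"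
  shows "X \<in> T u"
  using assms unfolding tangent_space_def jacobian_def by blast

lemma tangent_eqI:
  assumes "X \<in> T u" "Y \<in> T u" "c \<in> B" "u \<in> cdom c" "X c = Y c" shows "X = Y"
proof
  fix c' show "X c' = Y c'"
    using assms tangent_comp[of _ u c c'] tangent_zero[of _ u c'] by metis
qed

lemma tangent_combine:
  assumes "X \<in> T u" "Y \<in> T u" shows "(\<lambda>c. a *\<^sub>R X c + b *\<^sub>R Y c) \<in> T u"
proof (rule tangentI)
  fix c c' assume c: "c \<in> B" "c' \<in> B" "u \<in> cdom c" "u \<in> cdom c'"
  show "a *\<^sub>R X c' + b *\<^sub>R Y c' = jacobian c c' u (a *\<^sub>R X c + b *\<^sub>R Y c)"
    using linear_jacobian[OF c] tangent_comp[OF _ c] assms by (simp add: linear_add linear_scale)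
qed (use assms[THEN tangent_zero] in auto)

lemma coord_vec_comp:
  "c' \<in> B \<Longrightarrow> u \<in> cdom c' \<Longrightarrow> coord_vec B c w u c' = jacobian c c' u w"
  by (simp add: coord_vec_def jacobian_def)

lemma coord_vec_self: "c \<in> B \<Longrightarrow> u \<in> cdom c \<Longrightarrow> coord_vec B c w u c = w"
  by (simp add: coord_vec_comp jacobian_self)

lemma coord_vec_tangent:
  assumes "c \<in> B" "u \<in> cdom c" shows "coord_vec B c w u \<in> T u"
proof (rule tangentI)
  show "coord_vec B c w u c' = 0" if "\<not> (c' \<in> B \<and> u \<in> cdom c')" for c'
    using that by (auto simp: coord_vec_def)
next
  fix c1 c2 assume "c1 \<in> B" "c2 \<in> B" "u \<in> cdom c1" "u \<in> cdom c2"
  then show "coord_vec B c w u c2 = jacobian c1 c2 u (coord_vec B c w u c1)"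
    using assms by (simp add: coord_vec_comp jacobian_comp[of c c1 c2])
qed

lemma coord_vec_combine:
  assumes "c \<in> B" "u \<in> cdom c"
  shows "coord_vec B c (a *\<^sub>R v + b *\<^sub>R w) u = (\<lambda>c'. a *\<^sub>R coord_vec B c v u c' + b *\<^sub>R coord_vec B c w u c')"
  by (rule tangent_eqI[of _ u _ c]) (use assms in \<open>auto simp: coord_vec_tangent coord_vec_self tangent_combine\<close>)

lemma chart_at:
  assumes "c \<in> B" "u \<in> cdom c" shows "chart_at B u \<in> B" "u \<in> cdom (chart_at B u)"
  using someI[of "\<lambda>c. c \<in> B \<and> u \<in> cdom c" c] assms by (auto simp: chart_at_def)

lemma smooth_funD: "smooth_fun B f \<Longrightarrow> c \<in> B \<Longrightarrow> smooth_on (cimg c) (\<lambda>z. f (cinv c z))"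
  by (simp add: smooth_fun_def comp_def)

text \<open>Independence of the chart selected by \<open>chart_at\<close>: the chain rule through
  the transition map meets the transformation law of tangent vectors. All transport between charts
  below rests on it.\<close>

lemma d0_eq:
  assumes f: "smooth_fun B f" and c: "c \<in> B" "u \<in> cdom c" and X: "X \<in> T u"
  shows "d0 B f u X = D (\<lambda>z. f (cinv c z)) (cmap c u) (X c)"
proof -
  define c' where "c' = chart_at B u"
  have c': "c' \<in> B" "u \<in> cdom c'" using chart_at[OF c] by (auto simp: c'_def)
  have "D (\<lambda>z. f (cinv c z)) (cmap c u) = D (\<lambda>z. f (cinv c' (transition c c' z))) (cmap c u)"
  proof (rule D_cong_open[OF open_overlap[OF c(1) c'(1)]])
    show "f (cinv c z) = f (cinv c' (transition c c' z))" if "z \<in> overlap c c'" for z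
      using that c(1) c'(1) by (auto simp: transition_cmap cinv_cmap)
  qed (use c c' in auto)
  then show ?thesis
    using D_compose[OF transition_differentiable[OF c(1) c'(1) c(2) c'(2)], of "\<lambda>z. f (cinv c' z)" "X c"]
      smooth_on_differentiable[OF smooth_funD[OF f c'(1)] cmap_in[OF c'(2)]]
      tangent_comp[OF X c(1) c'(1) c(2) c'(2)]
    by (simp add: d0_def c'_def[symmetric] comp_def transition_cmap c jacobian_def)
qed

text \<open>The component in \<open>c\<close> is determined by the component \<open>X c\<close> of
  an arbitrary family \<open>X\<close>, tangent or not. \<open>lie_tensor\<close> applies
  \<open>K\<close> to brackets with coordinate fields, and this permits evaluating them before any
  tangency is known.\<close>

definition local_rep :: "('x, 'e) tensor11 \<Rightarrow> (('x, 'e) chart \<Rightarrow> 'e \<Rightarrow> 'e \<Rightarrow> 'e) \<Rightarrow> bool" where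
  "local_rep K k \<longleftrightarrow>
    (\<forall>c\<in>B. \<forall>p\<in>cdom c. \<forall>X. K p X c = k c (cmap c p) (X c)) \<and>
    (\<forall>c p X. \<not> (c \<in> B \<and> p \<in> cdom c) \<longrightarrow> X c = 0 \<longrightarrow> K p X c = 0) \<and>
    (\<forall>c\<in>B. \<forall>w. smooth_on (cimg c) (\<lambda>z. k c z w)) \<and>
    (\<forall>c\<in>B. \<forall>z\<in>cimg c. linear (k c z))"

definition tangential :: "('x, 'e) tensor11 \<Rightarrow> bool" where
  "tangential K \<longleftrightarrow> (\<forall>p\<in>carrier_of B. \<forall>X\<in>T p. K p X \<in> T p)"

lemma lie_tensor_comp:
  assumes K: "local_rep K k" and c: "c \<in> B" "u \<in> cdom c"
  shows "lie_tensor B S K u X c = D (\<lambda>z. k c z (X c)) (cmap c u) (S u c)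
    - D (\<lambda>z. S (cinv c z) c) (cmap c u) (k c (cmap c u) (X c))
    + k c (cmap c u) (D (\<lambda>z. S (cinv c z) c) (cmap c u) (X c))"
proof -
  note z = cmap_in[OF c(2)]
  have 1: "D (\<lambda>z. K (cinv c z) (coord_vec B c (X c) (cinv c z)) c) (cmap c u) = D (\<lambda>z. k c z (X c)) (cmap c u)"
    by (rule D_cong_open[OF open_cimg[OF c(1)] z])
      (use K c in \<open>simp add: local_rep_def cinv_in cmap_cinv coord_vec_self\<close>)
  have "D (\<lambda>z. coord_vec B c (X c) (cinv c z) c) (cmap c u) = D (\<lambda>z. X c) (cmap c u)"
    by (rule D_cong_open[OF open_cimg[OF c(1)] z]) (use c in \<open>simp add: cinv_in coord_vec_self\<close>)
  moreover have "linear (k c (cmap c u))" "K p Y c = k c (cmap c p) (Y c)" if "p \<in> cdom c" for p Y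
    using K c z that by (auto simp: local_rep_def)
  ultimately show ?thesis
    using c by (simp add: lie_tensor_def lie_bracket_def coord_vec_self 1 linear_neg)
qed

text \<open>\<open>lie_tensor\<close> extends the vector by constant coordinates in a different way
  for each chart, so the transformation law of its components needs an argument.\<close>

lemma tangential_lie_tensor:
  assumes K: "local_rep K k" "tangential K" and S: "smooth_vfield B S"
  shows "tangential (lie_tensor B S K)"
  unfolding tangential_def
proof (intro ballI tangentI)
  fix u X c assume X: "X \<in> T u" and c: "\<not> (c \<in> B \<and> u \<in> cdom c)"
  have "K u Y c = 0" if "Y c = 0" for Y
    using K(1) c that unfolding local_rep_def by blast
  then show "lie_tensor B S K u X c = 0"
    using c by (auto simp: lie_tensor_def lie_bracket_def)
next
  fix u X c c' assume X: "X \<in> T u" and c: "c \<in> B" "c' \<in> B" "u \<in> cdom c" "u \<in> cdom c'"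
  let ?O = "overlap c c'" and ?\<phi> = "transition c c'" and ?z = "cmap c u"
  let ?S = "\<lambda>c z. S (cinv c z) c"
  note O = open_overlap[OF c(1,2)] and \<phi> = smooth_transition[OF c(1,2)]
  have z: "?z \<in> ?O" using c by auto
  have z': "?\<phi> ?z = cmap c' u" by (simp add: transition_cmap c)
  have d\<phi>: "?\<phi> differentiable (at ?z)" by (rule smooth_on_differentiable[OF \<phi> z])
  have S_smooth: "smooth_on (cimg c) (?S c)" if "c \<in> B" for c using S that by (simp add: smooth_vfield_def)
  have k_smooth: "smooth_on (cimg c) (\<lambda>z. k c z w)" if "c \<in> B" for c w using K(1) that by (simp add: local_rep_def)
  \<comment> \<open>\<open>H\<close> holds the second derivatives of the transition map. They enter
    through \<open>dS\<close> and \<open>dK\<close>, and by the symmetry of \<open>H\<close> they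
    cancel in the Lie derivative.\<close>
  define H where "H a b = D (\<lambda>x. D ?\<phi> x a) ?z b" for a b
  have H: "H a b = H b a" for a b unfolding H_def by (rule symmetric_second_D[OF O z \<phi>])
  have S_eq: "?S c' (?\<phi> x) = D ?\<phi> x (?S c x)" if "x \<in> ?O" for x
  proof -
    obtain p where p: "p \<in> cdom c" "p \<in> cdom c'" "x = cmap c p" using \<open>x \<in> ?O\<close> by auto
    have "S p \<in> T p" using S p c by (auto simp: smooth_vfield_def carrier_of_def)
    then show ?thesis
      using tangent_comp[of "S p" p c c'] p c by (simp add: transition_cmap cinv_cmap jacobian_def)
  qed
  have K_eq: "k c' (?\<phi> x) (D ?\<phi> x w) = D ?\<phi> x (k c x w)" if "x \<in> ?O" for x w
  proof -
    obtain p where p: "p \<in> cdom c" "p \<in> cdom c'" "x = cmap c p" using \<open>x \<in> ?O\<close> by auto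
    let ?X = "coord_vec B c w p"
    have "K p ?X \<in> T p"
      using K(2) p c coord_vec_tangent[of c p w] by (auto simp: tangential_def carrier_of_def)
    then show ?thesis
      using tangent_comp[of "K p ?X" p c c'] p c K(1)
      by (simp add: local_rep_def coord_vec_self coord_vec_comp transition_cmap jacobian_def)
  qed
  have dS: "D (?S c') (cmap c' u) (D ?\<phi> ?z v) = H (?S c ?z) v + D ?\<phi> ?z (D (?S c) ?z v)" for v
  proof -
    have "D (\<lambda>x. ?S c' (?\<phi> x)) ?z v = D (\<lambda>x. D ?\<phi> x (?S c x)) ?z v"
      by (rule fun_cong[OF D_cong_open[OF O z S_eq]])
    then show ?thesis
      using D_compose[OF d\<phi>, of "?S c'" v] smooth_on_differentiable[OF S_smooth[OF c(2)] cmap_in[OF c(4)]]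
        D_D[OF O z \<phi> smooth_on_subset[OF S_smooth[OF c(1)] overlap_subset], of v]
      by (simp add: z' H_def)
  qed
  have dK: "D (\<lambda>z. k c' z (D ?\<phi> ?z w)) (cmap c' u) (D ?\<phi> ?z v) + k c' (cmap c' u) (H w v)
      = H (k c ?z w) v + D ?\<phi> ?z (D (\<lambda>z. k c z w) ?z v)" for v w
  proof -
    have "D (\<lambda>x. k c' (?\<phi> x) (D ?\<phi> x w)) ?z v = D (\<lambda>x. D ?\<phi> x (k c x w)) ?z v"
      by (rule fun_cong[OF D_cong_open[OF O z K_eq]])
    moreover have "D (\<lambda>x. k c' (?\<phi> x) (D ?\<phi> x w)) ?z v
        = D (\<lambda>x. k c' x (D ?\<phi> ?z w)) (?\<phi> ?z) (D ?\<phi> ?z v) + k c' (?\<phi> ?z) (D (\<lambda>x. D ?\<phi> x w) ?z v)"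
    proof (rule D_linear_family[OF _ d\<phi> open_cimg[OF c(2)]])
      show "(\<lambda>x. D ?\<phi> x w) differentiable (at ?z)"
        by (rule smooth_on_differentiable[OF smooth_on_D_const[OF \<phi>] z])
      show "?\<phi> ?z \<in> cimg c'" unfolding z' by (rule cmap_in[OF c(4)])
      show "linear (k c' x)" if "x \<in> cimg c'" for x using K(1) c(2) that by (simp add: local_rep_def)
      show "(\<lambda>x. k c' x b) differentiable (at (?\<phi> ?z))" for b
        unfolding z' by (rule smooth_on_differentiable[OF k_smooth[OF c(2)] cmap_in[OF c(4)]])
    qed
    ultimately show ?thesis
      using D_D[OF O z \<phi> smooth_on_subset[OF k_smooth[OF c(1)] overlap_subset], of w v]
      by (simp add: z' H_def)
  qed
  have lin: "linear (k c' (cmap c' u))" "linear (D ?\<phi> ?z)"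
    using K(1) c(2) cmap_in[OF c(4)] D_linear[OF d\<phi>] by (auto simp: local_rep_def)
  have Xc: "X c' = D ?\<phi> ?z (X c)" using tangent_comp[OF X c] by (simp add: jacobian_def)
  have s: "?S c ?z = S u c" by (simp add: cinv_cmap c)
  have s': "S u c' = D ?\<phi> ?z (S u c)" using S_eq[OF z] by (simp add: z' cinv_cmap c)
  have kX: "k c' (cmap c' u) (X c') = D ?\<phi> ?z (k c ?z (X c))" using K_eq[OF z] by (simp add: z' Xc)
  have "D (\<lambda>z. k c' z (X c')) (cmap c' u) (S u c') = H (k c ?z (X c)) (S u c)
      + D ?\<phi> ?z (D (\<lambda>z. k c z (X c)) ?z (S u c)) - k c' (cmap c' u) (H (X c) (S u c))"
    using dK[of "X c" "S u c"] by (simp add: Xc s' algebra_simps)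
  moreover have "D (?S c') (cmap c' u) (k c' (cmap c' u) (X c'))
      = H (k c ?z (X c)) (S u c) + D ?\<phi> ?z (D (?S c) ?z (k c ?z (X c)))"
    unfolding kX dS s H[of "S u c"] ..
  moreover have "k c' (cmap c' u) (D (?S c') (cmap c' u) (X c'))
      = k c' (cmap c' u) (H (X c) (S u c)) + D ?\<phi> ?z (k c ?z (D (?S c) ?z (X c)))"
    unfolding Xc dS s H[of "S u c"] linear_add[OF lin(1)] K_eq[OF z, unfolded z'] ..
  ultimately show "lie_tensor B S K u X c' = jacobian c c' u (lie_tensor B S K u X c)"
    unfolding lie_tensor_comp[OF K(1) c(1,3)] lie_tensor_comp[OF K(1) c(2,4)] jacobian_def
    by (simp add: linear_add[OF lin(2)] linear_diff[OF lin(2)])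
qed

end

section \<open>The slit tangent bundle\<close>

lemma open_Times_punctured:
  "open (U :: 'a::topological_space set) \<Longrightarrow> open (U \<times> (- {0 :: 'b::{t1_space, zero}}))"
  by (intro open_Times open_Compl closed_singleton)

lemma atlas_smooth_atlas:
  assumes "smooth_atlas A" shows "atlas A"
proof
  fix c assume c: "c \<in> A"
  then have h: "homeomorphism (cdom c) (cimg c) (cmap c) (cinv c)" and o: "open (cimg c)"
    using assms by (auto simp: smooth_atlas_def)
  show "inj_on (cmap c) (cdom c)" using h by (metis homeomorphism_def inj_on_inverseI)
  show "open (cimg c)" by (rule o)
  fix c' assume c': "c' \<in> A"
  then have "openin (top_of_set (cdom c)) (cdom c \<inter> cdom c')"
    using assms by (auto simp: smooth_atlas_def openin_open)
  from homeomorphism_imp_open_map[OF h this] o show "open (cmap c ` (cdom c \<inter> cdom c'))"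
    by (rule openin_open_trans)
  show "smooth_on (cmap c ` (cdom c \<inter> cdom c')) (transition c c')"
    using assms c c' by (simp add: smooth_atlas_def)
qed

locale manifold =
  fixes A :: "('m::topological_space, 'e::euclidean_space) chart set"
  assumes smooth_atlas: "smooth_atlas A"
begin

sublocale base: atlas A
  by (rule atlas_smooth_atlas[OF smooth_atlas])

abbreviation "slc \<equiv> slit_chart A"

lemma carrier_A: "carrier_of A = UNIV"
  using smooth_atlas by (simp add: smooth_atlas_def carrier_of_def)

lemma cdom_slc: "cdom (slc c) = {u \<in> slit_bundle A. fst u \<in> cdom c}"
  by (simp add: slit_chart_def)

lemma cmap_slc: "cmap (slc c) u = (cmap c (fst u), snd u c)"
  by (simp add: slit_chart_def induced_coords_def case_prod_beta)

lemma slit_bundle_iff: "u \<in> slit_bundle A \<longleftrightarrow> snd u \<in> tangent_space A (fst u) \<and> snd u \<noteq> (\<lambda>_. 0)"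
  by (auto simp: slit_bundle_def tangent_bundle_def carrier_A)

lemma zero_tangent: "(\<lambda>_. 0) \<in> tangent_space A p"
  by (rule base.tangentI) (auto simp: linear_0[OF base.linear_jacobian])

lemma slit_nonzero:
  assumes "u \<in> slit_bundle A" "c \<in> A" "fst u \<in> cdom c" shows "snd u c \<noteq> 0"
  using base.tangent_eqI[of "snd u" "fst u" "\<lambda>_. 0" c] assms zero_tangent by (auto simp: slit_bundle_iff)

lemma coord_vec_slit:
  assumes "c \<in> A" "p \<in> cdom c" "y \<noteq> 0" shows "(p, coord_vec A c y p) \<in> cdom (slc c)"
  using assms base.coord_vec_tangent[OF assms(1,2), of y] base.coord_vec_self[OF assms(1,2), of y]
  by (auto simp: cdom_slc slit_bundle_iff)

lemma inj_slc: "c \<in> A \<Longrightarrow> inj_on (cmap (slc c)) (cdom (slc c))"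
proof (rule inj_onI)
  fix u v assume c: "c \<in> A" and u: "u \<in> cdom (slc c)" and v: "v \<in> cdom (slc c)"
    and eq: "cmap (slc c) u = cmap (slc c) v"
  have "fst u = fst v"
    using base.inj[OF c] u v eq by (auto simp: cdom_slc cmap_slc dest: inj_onD)
  moreover from this have "snd u = snd v"
    using base.tangent_eqI[of "snd u" "fst u" "snd v" c] u v eq c
    by (auto simp: cdom_slc cmap_slc slit_bundle_iff)
  ultimately show "u = v" by (rule prod_eqI)
qed

lemma image_slc:
  assumes c: "c \<in> A"
  shows "cmap (slc c) ` (cdom (slc c) \<inter> cdom (slc c')) = (cmap c ` (cdom c \<inter> cdom c')) \<times> (- {0})"
proof (intro equalityI subsetI)
  fix z assume "z \<in> cmap (slc c) ` (cdom (slc c) \<inter> cdom (slc c'))"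
  then show "z \<in> (cmap c ` (cdom c \<inter> cdom c')) \<times> (- {0})"
    using slit_nonzero[OF _ c] by (auto simp: cdom_slc cmap_slc)
next
  fix z :: "'e \<times> 'e" assume "z \<in> (cmap c ` (cdom c \<inter> cdom c')) \<times> (- {0})"
  then have "fst z \<in> cmap c ` (cdom c \<inter> cdom c')" and 0: "snd z \<noteq> 0" by auto
  then obtain p where p: "p \<in> cdom c" "p \<in> cdom c'" "fst z = cmap c p" by blast
  let ?u = "(p, coord_vec A c (snd z) p)"
  have "?u \<in> cdom (slc c) \<inter> cdom (slc c')"
    using coord_vec_slit[OF c p(1) 0] p by (simp add: cdom_slc)
  moreover have "cmap (slc c) ?u = z"
    using p c by (simp add: cmap_slc base.coord_vec_self prod_eq_iff)
  ultimately show "z \<in> cmap (slc c) ` (cdom (slc c) \<inter> cdom (slc c'))" by (metis imageI)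
qed

lemma cimg_slc: "c \<in> A \<Longrightarrow> cimg (slc c) = cimg c \<times> (- {0})"
  using image_slc[of c c] by (simp add: cimg_def)

lemma transition_slc:
  assumes c: "c \<in> A" "c' \<in> A" and z: "z \<in> (cmap c ` (cdom c \<inter> cdom c')) \<times> (- {0})"
  shows "transition (slc c) (slc c') z = (transition c c' (fst z), D (transition c c') (fst z) (snd z))"
proof -
  obtain u where u: "u \<in> cdom (slc c)" "u \<in> cdom (slc c')" "z = cmap (slc c) u"
    using z image_slc[OF c(1), of c'] by blast
  then have p: "fst u \<in> cdom c" "fst u \<in> cdom c'" "snd u \<in> tangent_space A (fst u)"
    by (auto simp: cdom_slc slit_bundle_iff)
  have "cinv (slc c) z = u" using inj_slc[OF c(1)] u by (simp add: cinv_def)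
  then show ?thesis
    using base.tangent_comp[OF p(3) c p(1,2)] base.transition_cmap[OF c(1) p(1)]
    by (simp add: transition_def[of "slc c"] u(3) cmap_slc base.jacobian_def)
qed

lemma slit_atlasE: "c \<in> slit_atlas A \<Longrightarrow> (\<And>c0. c0 \<in> A \<Longrightarrow> c = slc c0 \<Longrightarrow> P) \<Longrightarrow> P"
  by (auto simp: slit_atlas_def)

sublocale slit: atlas "slit_atlas A"
proof
  fix c assume "c \<in> slit_atlas A"
  then obtain c0 where c0: "c0 \<in> A" "c = slc c0" by (rule slit_atlasE)
  show "inj_on (cmap c) (cdom c)" using inj_slc c0 by simp
  show "open (cimg c)" using c0 cimg_slc base.open_cimg by (simp add: open_Times_punctured)
  fix c' assume "c' \<in> slit_atlas A"
  then obtain c1 where c1: "c1 \<in> A" "c' = slc c1" by (rule slit_atlasE)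
  let ?O = "cmap c0 ` (cdom c0 \<inter> cdom c1)" and ?\<phi> = "transition c0 c1"
  have O: "open ?O" by (rule base.open_overlap[OF c0(1) c1(1)])
  then have O': "open (?O \<times> (- {0::'e}))" by (simp add: open_Times_punctured)
  then show "open (cmap c ` (cdom c \<inter> cdom c'))" by (simp add: c0(2) c1(2) image_slc[OF c0(1)])
  have \<phi>: "smooth_on ?O ?\<phi>" by (rule base.smooth_transition[OF c0(1) c1(1)])
  have "smooth_on (?O \<times> (- {0::'e})) (\<lambda>z. (?\<phi> (fst z), D ?\<phi> (fst z) (snd z)))"
  proof (rule smooth_on_Pair[OF O'])
    have f: "smooth_on (?O \<times> (- {0::'e})) (\<lambda>z. fst z)" "smooth_on (?O \<times> (- {0::'e})) (\<lambda>z. snd z)"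
      by (intro smooth_intros O')+
    show "smooth_on (?O \<times> (- {0::'e})) (\<lambda>z. ?\<phi> (fst z))"
      by (rule smooth_on_compose[OF O' f(1) \<phi>]) auto
    show "smooth_on (?O \<times> (- {0::'e})) (\<lambda>z. D ?\<phi> (fst z) (snd z))"
    proof (rule smooth_on_linear_family[OF O' f(2,1)])
      show "fst z \<in> ?O" if "z \<in> ?O \<times> (- {0})" for z :: "'e \<times> 'e" using that by auto
      show "linear (D ?\<phi> x)" if "x \<in> ?O" for x
        by (rule D_linear[OF smooth_on_differentiable[OF \<phi> that]])
    qed (rule smooth_on_D_const[OF \<phi>])
  qed
  then show "smooth_on (cmap c ` (cdom c \<inter> cdom c')) (transition c c')"
    unfolding c0(2) c1(2) image_slc[OF c0(1)]
    by (rule smooth_on_cong[OF _ O']) (rule transition_slc[OF c0(1) c1(1)])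
qed

abbreviation "SA \<equiv> slit_atlas A"
abbreviation "TS \<equiv> tangent_space (slit_atlas A)"

text \<open>The Jacobian of an induced coordinate change is block triangular with the base Jacobian
  in both diagonal blocks. Hence \<open>vert_endo\<close>, \<open>liouville\<close> and verticality
  have the same meaning in all charts.\<close>

lemma slit_jacobian:
  assumes c: "c \<in> A" "c' \<in> A" and u: "u \<in> cdom (slc c)" "u \<in> cdom (slc c')"
  shows "fst (slit.jacobian (slc c) (slc c') u w) = base.jacobian c c' (fst u) (fst w)"
    and "slit.jacobian (slc c) (slc c') u (0, b) = (0, base.jacobian c c' (fst u) b)"
proof -
  let ?O = "cmap c ` (cdom c \<inter> cdom c')" and ?\<phi> = "transition c c'" and ?z = "cmap (slc c) u"
  have O: "open ?O" by (rule base.open_overlap[OF c])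
  then have O': "open (?O \<times> (- {0::'e}))" by (simp add: open_Times_punctured)
  have z: "?z \<in> ?O \<times> (- {0})" using u image_slc[OF c(1), of c'] by blast
  have x: "fst ?z = cmap c (fst u)" by (simp add: cmap_slc)
  have xO: "cmap c (fst u) \<in> ?O" using z unfolding mem_Times_iff x by blast
  have \<phi>: "smooth_on ?O ?\<phi>" by (rule base.smooth_transition[OF c])
  have fs: "(fst :: 'e \<times> 'e \<Rightarrow> 'e) differentiable (at ?z)" "(snd :: 'e \<times> 'e \<Rightarrow> 'e) differentiable (at ?z)"
    "\<And>w. D (fst :: 'e \<times> 'e \<Rightarrow> 'e) ?z w = fst w" "\<And>w. D (snd :: 'e \<times> 'e \<Rightarrow> 'e) ?z w = snd w"
    using D_bounded_linear[OF bounded_linear_fst differentiable_ident, of ?z]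
      D_bounded_linear[OF bounded_linear_snd differentiable_ident, of ?z]
      bounded_linear_imp_differentiable bounded_linear_fst bounded_linear_snd by auto
  have d\<phi>: "?\<phi> differentiable (at (fst ?z))" unfolding x by (rule smooth_on_differentiable[OF \<phi> xO])
  have d1: "(\<lambda>z. ?\<phi> (fst z)) differentiable (at ?z)"
    by (rule differentiable_comp[OF fs(1) d\<phi>])
  have d2: "((\<lambda>z. D ?\<phi> (fst z) (snd z)) has_derivative
     (\<lambda>w. D (\<lambda>x. D ?\<phi> x (snd ?z)) (fst ?z) (D fst ?z w) + D ?\<phi> (fst ?z) (D snd ?z w))) (at ?z)"
  proof (rule has_derivative_linear_family[OF fs(2,1) O])
    show "fst ?z \<in> ?O" using z by auto
    show "linear (D ?\<phi> x)" if "x \<in> ?O" for x by (rule D_linear[OF smooth_on_differentiable[OF \<phi> that]])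
    show "(\<lambda>x. D ?\<phi> x b) differentiable (at (fst ?z))" for b
      unfolding x by (rule smooth_on_differentiable[OF smooth_on_D_const[OF \<phi>] xO])
  qed
  have "slit.jacobian (slc c) (slc c') u w
      = (D ?\<phi> (cmap c (fst u)) (fst w), D (\<lambda>x. D ?\<phi> x (snd u c)) (cmap c (fst u)) (fst w) + D ?\<phi> (cmap c (fst u)) (snd w))" for w
  proof -
    have "slit.jacobian (slc c) (slc c') u w = D (\<lambda>z. (?\<phi> (fst z), D ?\<phi> (fst z) (snd z))) ?z w"
      unfolding slit.jacobian_def by (rule fun_cong[OF D_cong_open[OF O' z transition_slc[OF c]]])
    also have "\<dots> = (D (\<lambda>z. ?\<phi> (fst z)) ?z w, D (\<lambda>z. D ?\<phi> (fst z) (snd z)) ?z w)"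
      by (rule D_Pair[OF d1 differentiableI[OF d2]])
    finally show ?thesis
      unfolding D_compose[OF fs(1) d\<phi>] D_eq[OF d2] fs(3,4) unfolding cmap_slc fst_conv snd_conv .
  qed
  moreover have "linear (D (\<lambda>x. D ?\<phi> x (snd u c)) (cmap c (fst u)))"
    by (rule D_linear[OF smooth_on_differentiable[OF smooth_on_D_const[OF \<phi>] xO]])
  moreover have "linear (D ?\<phi> (cmap c (fst u)))" using D_linear[OF d\<phi>] by (simp add: x)
  ultimately show "fst (slit.jacobian (slc c) (slc c') u w) = base.jacobian c c' (fst u) (fst w)"
    "slit.jacobian (slc c) (slc c') u (0, b) = (0, base.jacobian c c' (fst u) b)"
    by (simp_all add: base.jacobian_def linear_0)
qed

lemma carrier_SA: "carrier_of SA = slit_bundle A"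
proof -
  have "\<exists>c\<in>A. p \<in> cdom c" for p using carrier_A by (auto simp: carrier_of_def)
  then show ?thesis by (auto simp: carrier_of_def slit_atlas_def cdom_slc)
qed

lemma slit_chart_at: "u \<in> slit_bundle A \<Longrightarrow> chart_at SA u \<in> SA \<and> u \<in> cdom (chart_at SA u)"
  using slit.chart_at carrier_SA[unfolded carrier_of_def] by blast

lemma cdom_SA: "c \<in> SA \<Longrightarrow> u \<in> cdom c \<Longrightarrow> u \<in> slit_bundle A"
  using carrier_SA[unfolded carrier_of_def] by blast

lemma snd_cimg: "c \<in> SA \<Longrightarrow> z \<in> cimg c \<Longrightarrow> snd z \<noteq> 0"
  by (erule slit_atlasE) (auto simp: cimg_slc)

lemma vert_endo_tangent:
  assumes X: "X \<in> TS u" shows "vert_endo u X \<in> TS u"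
proof (rule slit.tangentI)
  show "vert_endo u X c = 0" if "\<not> (c \<in> SA \<and> u \<in> cdom c)" for c
    using slit.tangent_zero[OF X that] by (simp add: vert_endo_def zero_prod_def)
  fix c c' assume c: "c \<in> SA" "c' \<in> SA" "u \<in> cdom c" "u \<in> cdom c'"
  then obtain d d' where d: "d \<in> A" "c = slc d" "d' \<in> A" "c' = slc d'" by (metis slit_atlasE)
  have "fst (X c') = base.jacobian d d' (fst u) (fst (X c))"
    unfolding slit.tangent_comp[OF X c] using slit_jacobian(1)[OF d(1,3)] c d by simp
  then show "vert_endo u X c' = slit.jacobian c c' u (vert_endo u X c)"
    using slit_jacobian(2)[OF d(1,3)] c d by (simp add: vert_endo_def)
qed

lemma tangential_vert_endo: "slit.tangential vert_endo"
  unfolding slit.tangential_def using vert_endo_tangent by blast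

lemma rep_vert_endo: "slit.local_rep vert_endo (\<lambda>c z w. (0, fst w))"
  unfolding slit.local_rep_def
  by (auto simp: vert_endo_def zero_prod_def smooth_on_const intro!: linearI)

lemma liouville_comp: "c \<in> SA \<Longrightarrow> u \<in> cdom c \<Longrightarrow> liouville A u c = (0, snd (cmap c u))"
  by (simp add: liouville_def)

lemma liouville_tangent: "liouville A u \<in> TS u"
proof (rule slit.tangentI)
  show "liouville A u c = 0" if "\<not> (c \<in> SA \<and> u \<in> cdom c)" for c
    using that unfolding liouville_def by presburger
  fix c c' assume c: "c \<in> SA" "c' \<in> SA" "u \<in> cdom c" "u \<in> cdom c'"
  then obtain d d' where d: "d \<in> A" "c = slc d" "d' \<in> A" "c' = slc d'" by (metis slit_atlasE)
  have u: "fst u \<in> cdom d" "fst u \<in> cdom d'" "snd u \<in> tangent_space A (fst u)"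
    using c d by (auto simp: cdom_slc slit_bundle_iff)
  then show "liouville A u c' = slit.jacobian c c' u (liouville A u c)"
    using slit_jacobian(2)[OF d(1,3)] c d base.tangent_comp[OF u(3) d(1,3) u(1,2)]
    by (simp add: liouville_comp cmap_slc)
qed

lemma vertical_iff:
  assumes X: "X \<in> TS u" and c: "c \<in> SA" "u \<in> cdom c"
  shows "vertical A u X \<longleftrightarrow> fst (X c) = 0"
proof
  assume 0: "fst (X c) = 0"
  have "fst (X c') = 0" if c': "c' \<in> SA" "u \<in> cdom c'" for c'
  proof -
    obtain d d' where d: "d \<in> A" "c = slc d" "d' \<in> A" "c' = slc d'" by (metis slit_atlasE c(1) c'(1))
    then have "linear (base.jacobian d d' (fst u))"
      using c c' by (intro base.linear_jacobian) (auto simp: cdom_slc)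
    then show ?thesis
      unfolding slit.tangent_comp[OF X c(1) c'(1) c(2) c'(2)]
      using slit_jacobian(1)[OF d(1,3)] c c' d 0 by (simp add: linear_0)
  qed
  then show "vertical A u X" using X by (simp add: vertical_def)
qed (use c in \<open>simp add: vertical_def\<close>)

lemma dK0_vert:
  assumes f: "smooth_fun SA f" and c: "c \<in> SA" "u \<in> cdom c" and X: "X \<in> TS u"
  shows "dK0 SA vert_endo f u X = D (\<lambda>z. f (cinv c z)) (cmap c u) (0, fst (X c))"
  unfolding dK0_def i1_def slit.d0_eq[OF f c vert_endo_tangent[OF X]] by (simp add: vert_endo_def)

text \<open>Supplies the isotropy forms: with \<open>f\<close> the squared metric, \<open>g\<close>
  is half the constant curvature, or in dimension two the Ricci scalar divided by twice the squared
  metric.\<close>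

lemma semibasic_dK0:
  assumes f: "smooth_fun SA f" and g: "smooth_fun SA g"
  shows "semibasic1 A (\<lambda>u X. g u * dK0 SA vert_endo f u X)"
  unfolding semibasic1_def smooth_form1_def
proof (intro conjI ballI allI impI)
  fix u X Y a b assume u: "u \<in> carrier_of SA" and X: "X \<in> TS u" and Y: "Y \<in> TS u"
  obtain c where c: "c \<in> SA" "u \<in> cdom c" using u by (auto simp: carrier_of_def)
  have "linear (D (\<lambda>z. f (cinv c z)) (cmap c u))"
    by (rule D_linear[OF smooth_on_differentiable[OF slit.smooth_funD[OF f c(1)] slit.cmap_in[OF c(2)]]])
  from linear_add[OF this, of "a *\<^sub>R (0, fst (X c))" "b *\<^sub>R (0, fst (Y c))"]
    linear_scale[OF this, of a "(0, fst (X c))"] linear_scale[OF this, of b "(0, fst (Y c))"]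
  show "g u * dK0 SA vert_endo f u (\<lambda>c. a *\<^sub>R X c + b *\<^sub>R Y c)
      = a * (g u * dK0 SA vert_endo f u X) + b * (g u * dK0 SA vert_endo f u Y)"
    by (simp add: dK0_vert[OF f c] X Y slit.tangent_combine algebra_simps)
next
  fix c w assume c: "c \<in> SA"
  show "smooth_on (cimg c) (\<lambda>z. g (cinv c z) * dK0 SA vert_endo f (cinv c z) (coord_vec SA c w (cinv c z)))"
  proof (rule smooth_on_cong[OF _ slit.open_cimg[OF c]])
    show "smooth_on (cimg c) (\<lambda>z. g (cinv c z) * D (\<lambda>z. f (cinv c z)) z (0, fst w))"
      by (intro smooth_on_mult smooth_on_D_const slit.open_cimg slit.smooth_funD f g c)
    show "g (cinv c z) * dK0 SA vert_endo f (cinv c z) (coord_vec SA c w (cinv c z))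
        = g (cinv c z) * D (\<lambda>z. f (cinv c z)) z (0, fst w)" if z: "z \<in> cimg c" for z
      using slit.cinv_in[OF z] slit.cmap_cinv[OF z] c
      by (simp add: dK0_vert[OF f c] slit.coord_vec_tangent slit.coord_vec_self)
  qed
next
  fix u X assume u: "u \<in> slit_bundle A" and X: "vertical A u X"
  obtain c where c: "c \<in> SA" "u \<in> cdom c" using slit_chart_at[OF u] by blast
  have "linear (D (\<lambda>z. f (cinv c z)) (cmap c u))"
    by (rule D_linear[OF smooth_on_differentiable[OF slit.smooth_funD[OF f c(1)] slit.cmap_in[OF c(2)]]])
  moreover have "X \<in> TS u" "fst (X c) = 0" using X c by (auto simp: vertical_def)
  ultimately show "g u * dK0 SA vert_endo f u X = 0"
    using linear_0 by (fastforce simp: dK0_vert[OF f c] zero_prod_def[symmetric])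
qed

text \<open>The form has to be known on tangent vectors only, as the constant extensions used by
  \<open>d1\<close> are tangent. The chart is the selected one, which is why the consequences are
  stated in \<open>chart_at SA u\<close>.\<close>

lemma d1_eq:
  assumes u: "u \<in> slit_bundle A" and c: "c = chart_at SA u"
    and m: "\<And>p Y. p \<in> cdom c \<Longrightarrow> Y \<in> TS p \<Longrightarrow> \<omega> p Y = m (cmap c p) (Y c)"
  shows "d1 SA \<omega> u X Y = D (\<lambda>z. m z (Y c)) (cmap c u) (X c) - D (\<lambda>z. m z (X c)) (cmap c u) (Y c)"
proof -
  have cc: "c \<in> SA" "u \<in> cdom c" using slit_chart_at[OF u] c by auto
  have "D (\<lambda>z. \<omega> (cinv c z) (coord_vec SA c w (cinv c z))) (cmap c u) = D (\<lambda>z. m z w) (cmap c u)" for w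
    by (rule D_cong_open[OF slit.open_cimg[OF cc(1)] slit.cmap_in[OF cc(2)]])
      (use cc in \<open>simp add: m slit.cinv_in slit.cmap_cinv slit.coord_vec_tangent slit.coord_vec_self\<close>)
  then show ?thesis by (simp add: d1_def c[symmetric] Let_def)
qed

end

section \<open>Sprays on a manifold\<close>

locale spray_manifold = manifold A
  for A :: "('m::topological_space, 'e::euclidean_space) chart set" +
  fixes S :: "(('m, 'e) tpoint, 'e \<times> 'e) vfield"
  assumes spray: "is_spray A S"
begin

definition G :: "(('m, 'e) tpoint, 'e \<times> 'e) chart \<Rightarrow> 'e \<times> 'e \<Rightarrow> 'e" where
  "G c z = (- 1/2) *\<^sub>R snd (S (cinv c z) c)"

lemma smooth_S: "smooth_vfield SA S"
  using spray by (simp add: is_spray_def)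

lemma S_tangent: "u \<in> slit_bundle A \<Longrightarrow> S u \<in> TS u"
  using smooth_S carrier_SA by (simp add: smooth_vfield_def)

lemma smooth_S_comp: "c \<in> SA \<Longrightarrow> smooth_on (cimg c) (\<lambda>z. S (cinv c z) c)"
  using smooth_S by (simp add: smooth_vfield_def)

lemma S_comp: "c \<in> SA \<Longrightarrow> z \<in> cimg c \<Longrightarrow> S (cinv c z) c = (snd z, - 2 *\<^sub>R G c z)"
proof -
  assume c: "c \<in> SA" and z: "z \<in> cimg c"
  note u = slit.cinv_in[OF z]
  have "vert_endo (cinv c z) (S (cinv c z)) c = liouville A (cinv c z) c"
    using spray cdom_SA[OF c u] by (simp add: is_spray_def)
  then show ?thesis using c u z by (simp add: vert_endo_def liouville_comp slit.cmap_cinv G_def prod_eq_iff)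
qed

lemma local_spray: "c \<in> SA \<Longrightarrow> local_spray (cimg c) (G c)"
proof
  assume c: "c \<in> SA"
  show o: "open (cimg c)" by (rule slit.open_cimg[OF c])
  note sS = smooth_S_comp[OF c]
  show G: "smooth_on (cimg c) (G c)"
    unfolding G_def[abs_def]
    by (rule smooth_on_bounded_linear[OF bounded_linear_scaleR_right o smooth_on_snd[OF o sS]])
  fix z assume z: "z \<in> cimg c"
  note u = slit.cinv_in[OF z]
  have dS: "(\<lambda>z. S (cinv c z) c) differentiable (at z)" by (rule smooth_on_differentiable[OF sS z])
  have "D (\<lambda>z. liouville A (cinv c z) c) z v = D (\<lambda>z. (0, snd z)) z v" for v
    by (rule fun_cong[OF D_cong_open[OF o z]])
      (simp add: liouville_comp c slit.cinv_in slit.cmap_cinv)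
  moreover have "D (\<lambda>z. (0 :: 'e, snd z)) z v = (0, snd v)" for v :: "'e \<times> 'e"
    by (rule fun_cong[OF D_eq]) (auto intro!: derivative_eq_intros)
  moreover have "lie_bracket SA (liouville A) S (cinv c z) c = S (cinv c z) c"
    using spray cdom_SA[OF c u] by (simp add: is_spray_def)
  ultimately have "D (\<lambda>z. S (cinv c z) c) z (0, snd z) - (0, snd (S (cinv c z) c)) = S (cinv c z) c"
    using c u z by (simp add: lie_bracket_def slit.cmap_cinv liouville_comp)
  from arg_cong[OF this, of snd]
  have "snd (D (\<lambda>z. S (cinv c z) c) z (0, snd z)) = 2 *\<^sub>R snd (S (cinv c z) c)"
    by (simp add: scaleR_2 algebra_simps)
  moreover have "D (G c) z (0, snd z) = (- 1/2) *\<^sub>R snd (D (\<lambda>z. S (cinv c z) c) z (0, snd z))"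
    unfolding G_def[abs_def]
    by (simp only: D_bounded_linear[OF bounded_linear_scaleR_right
          differentiable_bounded_linear[OF bounded_linear_snd dS]] D_bounded_linear[OF bounded_linear_snd dS])
  ultimately show "D (G c) z (0, snd z) = 2 *\<^sub>R G c z" by (simp add: G_def)
qed

abbreviation "hor c \<equiv> local_spray.hor (G c)"
abbreviation "jac c \<equiv> local_spray.jac (G c)"
abbreviation "NN c \<equiv> local_spray.N (G c)"
abbreviation "spr c \<equiv> local_spray.spr (G c)"

lemma S_spr: "c \<in> SA \<Longrightarrow> u \<in> cdom c \<Longrightarrow> S u c = spr c (cmap c u)"
  using S_comp[OF _ slit.cmap_in] local_spray.spr_def[OF local_spray] by (simp add: slit.cinv_cmap)

lemma D_S_comp:
  assumes c: "c \<in> SA" "u \<in> cdom c"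
  shows "D (\<lambda>z. S (cinv c z) c) (cmap c u) v = (snd v, - 2 *\<^sub>R D (G c) (cmap c u) v)"
proof -
  interpret L: local_spray "cimg c" "G c" by (rule local_spray[OF c(1)])
  have "D (\<lambda>z. S (cinv c z) c) (cmap c u) = D L.spr (cmap c u)"
    by (rule L.D_congW[OF slit.cmap_in[OF c(2)]]) (simp add: S_comp[OF c(1)] L.spr_def)
  then show ?thesis by (simp add: L.D_spr slit.cmap_in c)
qed

lemma lie_vert:
  assumes c: "c \<in> SA" "u \<in> cdom c"
  shows "lie_tensor SA S vert_endo u X c
    = (- fst (X c), snd (X c) + 2 *\<^sub>R NN c (fst (X c)) (cmap c u))"
proof -
  interpret L: local_spray "cimg c" "G c" by (rule local_spray[OF c(1)])
  show ?thesis
    unfolding slit.lie_tensor_comp[OF rep_vert_endo c] D_S_comp[OF c] by (simp add: L.N_def)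
qed

lemma hor_proj_comp:
  assumes c: "c \<in> SA" "u \<in> cdom c"
  shows "hor_proj A S u X c = hor c (fst (X c)) (cmap c u)"
proof -
  interpret L: local_spray "cimg c" "G c" by (rule local_spray[OF c(1)])
  show ?thesis
    unfolding hor_proj_def lie_vert[OF c] L.hor_def
    by (simp add: prod_eq_iff scaleR_2[symmetric])
qed

lemma vert_proj_comp:
  assumes c: "c \<in> SA" "u \<in> cdom c"
  shows "vert_proj A S u X c = (0, snd (X c) + NN c (fst (X c)) (cmap c u))"
  unfolding vert_proj_def lie_vert[OF c]
  by (simp add: prod_eq_iff scaleR_2[symmetric] scaleR_right_distrib add.assoc[symmetric])

lemma rep_hor: "slit.local_rep (hor_proj A S) (\<lambda>c z w. hor c (fst w) z)"
  unfolding slit.local_rep_def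
proof (intro conjI ballI allI impI)
  fix c assume c: "c \<in> SA"
  interpret L: local_spray "cimg c" "G c" by (rule local_spray[OF c])
  show "hor_proj A S p X c = hor c (fst (X c)) (cmap c p)" if "p \<in> cdom c" for p X
    by (rule hor_proj_comp[OF c that])
  show "smooth_on (cimg c) (\<lambda>z. hor c (fst w) z)" for w using L.smooth_hor[of "fst w"] by (simp add: eta_contract_eq)
  show "linear (\<lambda>w. hor c (fst w) z)" if "z \<in> cimg c" for z
    by (rule linearI) (use that in \<open>auto simp: L.hor_def L.N_def L.D_add2[OF L.G] L.D_scale2[OF L.G]\<close>)
next
  fix c p and X :: "(('m, 'e) tpoint, 'e \<times> 'e) tvec"
  assume "\<not> (c \<in> SA \<and> p \<in> cdom c)" "X c = 0"
  then show "hor_proj A S p X c = 0"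
    by (auto simp: hor_proj_def lie_tensor_def lie_bracket_def vert_endo_def zero_prod_def)
qed

lemma tangential_hor: "slit.tangential (hor_proj A S)"
  unfolding slit.tangential_def
proof (intro ballI)
  fix u X assume u: "u \<in> carrier_of SA" and X: "X \<in> TS u"
  have "lie_tensor SA S vert_endo u X \<in> TS u"
    using slit.tangential_lie_tensor[OF rep_vert_endo tangential_vert_endo smooth_S] u X
    by (simp add: slit.tangential_def)
  from slit.tangent_combine[OF X this, of "1/2" "-1/2"]
  show "hor_proj A S u X \<in> TS u" by (simp add: hor_proj_def[abs_def] scaleR_right_diff_distrib)
qed

lemma tangential_jacobi: "slit.tangential (jacobi_endo A S)"
  unfolding slit.tangential_def
proof (intro ballI)
  fix u X assume u: "u \<in> carrier_of SA" and X: "X \<in> TS u"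
  let ?Y = "lie_tensor SA S (hor_proj A S) u X"
  have Y: "?Y \<in> TS u"
    using slit.tangential_lie_tensor[OF rep_hor tangential_hor smooth_S] u X
    by (simp add: slit.tangential_def)
  then have "lie_tensor SA S vert_endo u ?Y \<in> TS u"
    using slit.tangential_lie_tensor[OF rep_vert_endo tangential_vert_endo smooth_S] u
    by (simp add: slit.tangential_def)
  from slit.tangent_combine[OF Y this, of "1/2" "1/2"]
  show "jacobi_endo A S u X \<in> TS u"
    by (simp add: jacobi_endo_def vert_proj_def[abs_def] scaleR_right_distrib)
qed

lemma hor_proj_tangent: "u \<in> slit_bundle A \<Longrightarrow> X \<in> TS u \<Longrightarrow> hor_proj A S u X \<in> TS u"
  using tangential_hor by (simp add: slit.tangential_def carrier_SA)

lemma jacobi_tangent: "u \<in> slit_bundle A \<Longrightarrow> X \<in> TS u \<Longrightarrow> jacobi_endo A S u X \<in> TS u"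
  using tangential_jacobi by (simp add: slit.tangential_def carrier_SA)

lemma jacobi_comp:
  assumes c: "c \<in> SA" "u \<in> cdom c"
  shows "jacobi_endo A S u X c = (0, jac c (fst (X c)) (cmap c u))"
proof -
  interpret L: local_spray "cimg c" "G c" by (rule local_spray[OF c(1)])
  let ?z = "cmap c u" and ?a = "fst (X c)" and ?b = "snd (X c)"
  have z: "?z \<in> cimg c" by (rule slit.cmap_in[OF c(2)])
  have "D (L.hor ?a) ?z (S u c) = (0, - D (L.N ?a) ?z (L.spr ?z))"
    by (simp add: L.D_hor[OF z] S_spr[OF c])
  moreover have "D (G c) ?z (L.hor ?a ?z) = D (G c) ?z (?a, 0) - D (G c) ?z (0, L.N ?a ?z)"
    using L.D_split[OF L.G z, of ?a "- L.N ?a ?z"] by (simp add: L.hor_def L.D_neg2[OF L.G z])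
  ultimately have "lie_tensor SA S (hor_proj A S) u X c
      = (L.N ?a ?z + ?b, - D (L.N ?a) ?z (L.spr ?z) + 2 *\<^sub>R (D (G c) ?z (?a, 0) - D (G c) ?z (0, L.N ?a ?z)) - L.N ?b ?z)"
    unfolding slit.lie_tensor_comp[OF rep_hor c] D_S_comp[OF c] by (simp add: L.hor_def)
  \<comment> \<open>The vertical projector adds \<open>N\<close> of the first component. Its part
    \<open>N b\<close> cancels the dependence on \<open>b\<close>, and its part
    \<open>N (N a)\<close> reduces the coefficient of that term from -2 to -1.\<close>
  moreover have "L.N (L.N ?a ?z + ?b) ?z = L.N (L.N ?a ?z) ?z + L.N ?b ?z"
    by (simp add: L.N_def L.D_add2[OF L.G z])
  ultimately show ?thesis
    unfolding jacobi_endo_def vert_proj_comp[OF c]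
    by (simp add: L.jac_def L.N_def[of "L.N ?a ?z"] algebra_simps scaleR_2)
qed

end

section \<open>Finsler manifolds\<close>

text \<open>The map is \<open>r\<close> times the projection along \<open>y\<close> onto the kernel
  of \<open>p\<close>, of trace \<open>n - 1\<close>; the normalisation \<open>2 * l\<close> fits
  the derivative of \<open>L\<close> in the direction of \<open>y\<close>.\<close>

lemma trace_projection:
  fixes p :: "real^'n \<Rightarrow> real" and y :: "real^'n"
  assumes p: "linear p" "p y = 2 * l" "l \<noteq> 0"
  shows "(\<Sum>i\<in>UNIV. (r *\<^sub>R axis i 1 - (r / (2 * l) * p (axis i 1)) *\<^sub>R y) $ i) = (real CARD('n) - 1) * r"
proof -
  have "p y = (\<Sum>i\<in>UNIV. y $ i * p (axis i 1))"
    using arg_cong[OF basis_expansion[of y], of p]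
    by (simp add: linear_sum[OF p(1)] scalar_mult_eq_scaleR linear_scale[OF p(1)])
  then have "(\<Sum>i\<in>UNIV. r / (2 * l) * (y $ i * p (axis i 1))) = r"
    unfolding sum_distrib_left[symmetric] using p(2,3) by (metis nonzero_eq_divide_eq mult_eq_0_iff zero_neq_numeral)
  then show ?thesis by (simp add: sum_subtractf algebra_simps)
qed

locale finsler_manifold = spray_manifold A S
  for A :: "('m::topological_space, real^'n) chart set"
    and S :: "(('m, real^'n) tpoint, (real^'n) \<times> (real^'n)) vfield" +
  fixes F :: "('m, real^'n) tpoint \<Rightarrow> real"
  assumes card: "CARD('n) > 1"
    and finsler: "finsler_metric A F"
    and geodesic: "geodesic_spray A F S"
begin

abbreviation L where "L \<equiv> \<lambda>u. (F u)\<^sup>2"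
abbreviation "lc c \<equiv> \<lambda>z. L (cinv c z)"

lemma smooth_F: "smooth_fun SA F"
  using finsler by (simp add: finsler_metric_def)

lemma smooth_L: "smooth_fun SA L"
  unfolding smooth_fun_def comp_def power2_eq_square
  by (intro ballI smooth_on_mult slit.open_cimg slit.smooth_funD smooth_F)

lemma F_pos: "u \<in> slit_bundle A \<Longrightarrow> F u > 0"
  using finsler by (simp add: finsler_metric_def)

lemma smooth_lc: "c \<in> SA \<Longrightarrow> smooth_on (cimg c) (lc c)"
  by (rule slit.smooth_funD[OF smooth_L])

lemma F_scale: "u \<in> slit_bundle A \<Longrightarrow> t > 0 \<Longrightarrow> F (fibre_scale t u) = t * F u"
  using finsler by (auto simp: finsler_metric_def slit_bundle_def)

lemma fibre_scale_comp:
  assumes c: "c \<in> SA" "u \<in> cdom c" and t: "t > 0"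
  shows "fibre_scale t u \<in> cdom c" "cmap c (fibre_scale t u) = (fst (cmap c u), t *\<^sub>R snd (cmap c u))"
proof -
  obtain c0 where c0: "c0 \<in> A" "c = slc c0" using c(1) by (rule slit_atlasE)
  have "snd u \<in> tangent_space A (fst u)" "snd u \<noteq> (\<lambda>_. 0)"
    using c c0 by (auto simp: cdom_slc slit_bundle_iff)
  moreover from this have "(\<lambda>c. t *\<^sub>R snd u c) \<in> tangent_space A (fst u)"
    using base.tangent_combine[of "snd u" "fst u" "snd u" t 0] by simp
  moreover have "(\<lambda>c. t *\<^sub>R snd u c) \<noteq> (\<lambda>_. 0)"
    using calculation(2) t by (simp add: fun_eq_iff)
  ultimately show "fibre_scale t u \<in> cdom c"
    using c c0 by (simp add: cdom_slc slit_bundle_iff fibre_scale_def case_prod_beta)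
  show "cmap c (fibre_scale t u) = (fst (cmap c u), t *\<^sub>R snd (cmap c u))"
    using c0 by (simp add: cmap_slc fibre_scale_def case_prod_beta)
qed

lemma L_euler:
  assumes c: "c \<in> SA" and z: "z \<in> cimg c" shows "D (lc c) z (0, snd z) = 2 * lc c z"
proof -
  note u = slit.cinv_in[OF z]
  have scale: "lc c (fst z, t *\<^sub>R snd z) = t\<^sup>2 * lc c z" if "t > 0" for t
    using slit.cinv_cmap[OF c fibre_scale_comp(1)[OF c u that]] fibre_scale_comp(2)[OF c u that]
      F_scale[OF cdom_SA[OF c u] that]
    by (simp add: slit.cmap_cinv[OF z] power_mult_distrib)
  have line: "((\<lambda>t. (fst z, t *\<^sub>R snd z)) has_derivative (\<lambda>h. h *\<^sub>R (0, snd z))) (at 1)"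
    by (auto intro!: derivative_eq_intros)
  have "(lc c has_derivative D (lc c) z) (at (fst z, 1 *\<^sub>R snd z))"
    using has_derivative_D[OF smooth_on_differentiable[OF smooth_lc[OF c] z]] by simp
  from has_derivative_compose[OF line this]
  have "((\<lambda>t. lc c (fst z, t *\<^sub>R snd z)) has_derivative (\<lambda>h. D (lc c) z (h *\<^sub>R (0, snd z)))) (at 1)" .
  \<comment> \<open>Homogeneity is available for \<open>t > 0\<close> only, which is an open
    neighbourhood of 1.\<close>
  from has_derivative_transform_within_open[OF this open_greaterThan, of 0 "\<lambda>t. t\<^sup>2 * lc c z"]
  have "((\<lambda>t. t\<^sup>2 * lc c z) has_derivative (\<lambda>h. D (lc c) z (h *\<^sub>R (0, snd z)))) (at 1)"
    using scale by simp
  moreover have "((\<lambda>t::real. t\<^sup>2 * lc c z) has_derivative (\<lambda>h. h * (2 * lc c z))) (at 1)"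
    by (auto intro!: derivative_eq_intros)
  ultimately have "(\<lambda>h. D (lc c) z (h *\<^sub>R (0, snd z))) = (\<lambda>h. h * (2 * lc c z))"
    by (rule has_derivative_unique)
  from fun_cong[OF this, of 1] show ?thesis by simp
qed

lemma euler_lagrange_eq:
  assumes u: "u \<in> slit_bundle A" and c: "c = chart_at SA u"
  shows "D (\<lambda>z. D (lc c) z (0, X)) (cmap c u) (spr c (cmap c u)) = D (lc c) (cmap c u) (X, 0)"
proof -
  have cc: "c \<in> SA" "u \<in> cdom c" using slit_chart_at[OF u] c by auto
  note z = slit.cmap_in[OF cc(2)]
  interpret P: local_spray "cimg c" "G c" by (rule local_spray[OF cc(1)])
  let ?X = "coord_vec SA c (X, 0) u" and ?z = "cmap c u"
  have X: "?X \<in> TS u" "?X c = (X, 0)"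
    using cc by (auto simp: slit.coord_vec_tangent slit.coord_vec_self)
  have "d1 SA (dK0 SA vert_endo L) u (S u) ?X = - d0 SA L u ?X"
    using geodesic u X by (simp add: geodesic_spray_def)
  moreover have "d1 SA (dK0 SA vert_endo L) u (S u) ?X
      = D (\<lambda>z. D (lc c) z (0, fst (?X c))) ?z (S u c) - D (\<lambda>z. D (lc c) z (0, fst (S u c))) ?z (?X c)"
    by (rule d1_eq[where m = "\<lambda>z w. D (lc c) z (0, fst w)", OF u c]) (rule dK0_vert[OF smooth_L cc(1)])
  moreover have "d0 SA L u ?X = D (lc c) ?z (X, 0)"
    using slit.d0_eq[OF smooth_L cc X(1)] by (simp add: X)
  \<comment> \<open>The vector \<open>snd ?z\<close> is frozen, but the direction
    \<open>(X, 0)\<close> does not move \<open>y\<close>, so Euler's relation still gives twice the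
    x-derivative. One copy cancels against the right-hand side \<open>- d L\<close>.\<close>
  moreover have "D (\<lambda>z. D (lc c) z (0, snd z)) ?z = D (\<lambda>z. 2 * lc c z) ?z"
    by (rule P.D_congW[OF z L_euler[OF cc(1)]])
  then have "D (\<lambda>z. D (lc c) z (0, snd ?z)) ?z (X, 0) = 2 * D (lc c) ?z (X, 0)"
    using D_D[OF P.W z smooth_lc[OF cc(1)] P.smooth_liouville, of "(X, 0)"]
    by (simp add: P.D_liouville[OF z] P.D_zero[OF smooth_lc[OF cc(1)] z, unfolded zero_prod_def]
        D_bounded_linear[OF bounded_linear_mult_right smooth_on_differentiable[OF smooth_lc[OF cc(1)] z]])
  ultimately show ?thesis by (simp add: X S_spr[OF cc] P.spr_def)
qed

lemma L_S: "u \<in> slit_bundle A \<Longrightarrow> d0 SA L u (S u) = 0"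
proof -
  assume u: "u \<in> slit_bundle A"
  define c where "c = chart_at SA u"
  have c: "c \<in> SA" "u \<in> cdom c" using slit_chart_at[OF u] c_def by auto
  interpret P: local_spray "cimg c" "G c" by (rule local_spray[OF c(1)])
  have "D (lc c) (cmap c u) (P.spr (cmap c u)) = 0"
    by (rule P.euler_lagrange_spr[OF slit.cmap_in[OF c(2)] smooth_lc[OF c(1)] L_euler[OF c(1)]])
      (auto intro: euler_lagrange_eq[OF u c_def])
  then show ?thesis by (simp add: slit.d0_eq[OF smooth_L c S_tangent[OF u]] S_spr[OF c])
qed

text \<open>\<open>L_S\<close> was obtained in the chart selected at each point but is free of
  charts. Read in one fixed chart it holds on the whole domain, as \<open>euler_lagrange_hor\<close>
  requires.\<close>

lemma lc_spr:
  assumes c: "c \<in> SA" and z: "z \<in> cimg c" shows "D (lc c) z (spr c z) = 0"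
proof -
  note u = slit.cinv_in[OF z]
  show ?thesis
    using L_S[OF cdom_SA[OF c u]] S_spr[OF c u]
    by (simp add: slit.d0_eq[OF smooth_L c u S_tangent[OF cdom_SA[OF c u]]] slit.cmap_cinv[OF z])
qed

lemma L_hor:
  assumes u: "u \<in> slit_bundle A" and X: "X \<in> TS u" shows "d0 SA L u (hor_proj A S u X) = 0"
proof -
  define c where "c = chart_at SA u"
  have c: "c \<in> SA" "u \<in> cdom c" using slit_chart_at[OF u] c_def by auto
  interpret P: local_spray "cimg c" "G c" by (rule local_spray[OF c(1)])
  have "D (lc c) (cmap c u) (P.hor (fst (X c)) (cmap c u)) = 0"
    by (rule P.euler_lagrange_hor[OF slit.cmap_in[OF c(2)] smooth_lc[OF c(1)] L_euler[OF c(1)]])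
      (auto intro: euler_lagrange_eq[OF u c_def] lc_spr[OF c(1)])
  then show ?thesis by (simp add: slit.d0_eq[OF smooth_L c hor_proj_tangent[OF u X]] hor_proj_comp[OF c])
qed

lemma local_finsler:
  assumes c: "c \<in> SA" shows "local_finsler (cimg c) (G c) (lc c)"
proof -
  interpret P: local_spray "cimg c" "G c" by (rule local_spray[OF c])
  show ?thesis
  proof
    show "smooth_on (cimg c) (lc c)" by (rule smooth_lc[OF c])
    fix z X assume z: "z \<in> cimg c"
    note u = slit.cinv_in[OF z] and us = cdom_SA[OF c slit.cinv_in[OF z]]
    show "lc c z > 0" using F_pos[OF us] by simp
    show "D (lc c) z (0, snd z) = 2 * lc c z" by (rule L_euler[OF c z])
    have X: "coord_vec SA c (X, 0) (cinv c z) \<in> TS (cinv c z)" by (rule slit.coord_vec_tangent[OF c u])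
    show "D (lc c) z (P.hor X z) = 0"
      using L_hor[OF us X]
      by (simp add: slit.d0_eq[OF smooth_L c u hor_proj_tangent[OF us X]] hor_proj_comp[OF c u]
          slit.coord_vec_self[OF c u] slit.cmap_cinv[OF z])
  qed
qed

lemma dim: "DIM(real^'n) > 1"
  using card by simp

lemma F_dK0:
  assumes u: "u \<in> slit_bundle A" and X: "X \<in> TS u"
  shows "F u * dK0 SA vert_endo F u X = dK0 SA vert_endo L u X / 2"
proof -
  obtain c where c: "c \<in> SA" "u \<in> cdom c" using slit_chart_at[OF u] by blast
  have "(\<lambda>z. F (cinv c z)) differentiable (at (cmap c u))"
    by (rule smooth_on_differentiable[OF slit.smooth_funD[OF smooth_F c(1)] slit.cmap_in[OF c(2)]])
  from D_mult[OF this this] show ?thesis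
    unfolding dK0_vert[OF smooth_F c X] dK0_vert[OF smooth_L c X]
    by (simp add: power2_eq_square slit.cinv_cmap[OF c])
qed

lemma ricci_scalar_eq:
  assumes u: "u \<in> slit_bundle A" and c: "c = chart_at SA u"
  shows "(real CARD('n) - 1) * ricci_scalar A S u = (\<Sum>i\<in>UNIV. jac c (axis i 1) (cmap c u) $ i)"
proof -
  have cc: "c \<in> SA" "u \<in> cdom c" using slit_chart_at[OF u] c by auto
  then show ?thesis
    using card by (simp add: ricci_scalar_def semibasic_trace_def c[symmetric] Let_def jacobi_comp slit.coord_vec_self)
qed

text \<open>An isotropy form has to come with the Ricci scalar as coefficient of \<open>J\<close>,
  so the trace must be computed before \<open>k / 2\<close> times \<open>d_J L\<close>, which is
  \<open>k F d_J F\<close>, qualifies.\<close>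

lemma constant_curvature_isotropy:
  assumes "scalar_flag_curvature A F S \<kappa>" and k: "\<And>u. u \<in> slit_bundle A \<Longrightarrow> \<kappa> u = k"
  shows "\<And>u. u \<in> slit_bundle A \<Longrightarrow> ricci_scalar A S u = k * L u"
    and "isotropy_form A S (\<lambda>u X. (k / 2) * dK0 SA vert_endo L u X)"
proof -
  have jac: "jacobi_endo A S u X = (\<lambda>c. (k * L u) *\<^sub>R vert_endo u X c - ((k / 2) * dK0 SA vert_endo L u X) *\<^sub>R liouville A u c)"
    if u: "u \<in> slit_bundle A" and X: "X \<in> TS u" for u X
  proof -
    have "jacobi_endo A S u X = (\<lambda>c. k *\<^sub>R (L u *\<^sub>R vert_endo u X c
        - (F u * dK0 SA vert_endo F u X) *\<^sub>R liouville A u c))"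
      using assms(1) u X unfolding scalar_flag_curvature_def k[OF u, symmetric] by blast
    then show ?thesis unfolding F_dK0[OF u X] by (simp add: scaleR_right_diff_distrib)
  qed
  show \<rho>: "ricci_scalar A S u = k * L u" if u: "u \<in> slit_bundle A" for u
  proof -
    define c where "c = chart_at SA u"
    have c: "c \<in> SA" "u \<in> cdom c" using slit_chart_at[OF u] c_def by auto
    interpret P: local_finsler "cimg c" "G c" "lc c" by (rule local_finsler[OF c(1)])
    let ?z = "cmap c u"
    have z: "?z \<in> cimg c" by (rule slit.cmap_in[OF c(2)])
    have "P.jac X ?z = (k * lc c ?z) *\<^sub>R X - (k * lc c ?z / (2 * lc c ?z) * D (lc c) ?z (0, X)) *\<^sub>R snd ?z" for X
    proof -
      let ?X = "coord_vec SA c (X, 0) u"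
      have X: "?X \<in> TS u" "?X c = (X, 0)" using c by (auto simp: slit.coord_vec_tangent slit.coord_vec_self)
      show ?thesis
        using fun_cong[OF jac[OF u X(1)], of c] P.L_pos[OF z]
        unfolding jacobi_comp[OF c] dK0_vert[OF smooth_L c X(1)]
        by (simp add: X(2) vert_endo_def liouville_comp[OF c] slit.cinv_cmap[OF c])
    qed
    then have "(real CARD('n) - 1) * ricci_scalar A S u = (real CARD('n) - 1) * (k * lc c ?z)"
      unfolding ricci_scalar_eq[OF u c_def]
      using trace_projection[of "\<lambda>X. D (lc c) ?z (0, X)" "snd ?z" "lc c ?z" "k * lc c ?z"]
        P.L_euler[OF z] P.L_pos[OF z]
      by (simp add: linearI P.D_add2[OF P.L z] P.D_scale2[OF P.L z])
    then show ?thesis using card by (simp add: slit.cinv_cmap[OF c])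
  qed
  have "smooth_fun SA (\<lambda>u. k / 2)" by (simp add: smooth_fun_def comp_def smooth_on_const)
  from semibasic_dK0[OF smooth_L this]
  show "isotropy_form A S (\<lambda>u X. (k / 2) * dK0 SA vert_endo L u X)"
    unfolding isotropy_form_def using jac \<rho> by simp
qed

end

subsection \<open>Dimension two\<close>

lemma rank_one_projection:
  fixes T :: "real^'n \<Rightarrow> real^'n" and p :: "real^'n \<Rightarrow> real"
  assumes card: "CARD('n) = 2" and T: "linear T" and p: "linear p"
    and y: "T y = 0" "p y \<noteq> 0" and pT: "\<And>X. p (T X) = 0"
  shows "T X = (\<Sum>i\<in>UNIV. T (axis i 1) $ i) *\<^sub>R (X - (p X / p y) *\<^sub>R y)"
proof -
  obtain a b :: 'n where ab: "UNIV = {a, b}" "a \<noteq> b" using card by (metis card_2_iff)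
  define e where "e i = (axis i 1 :: real^'n)" for i
  have rep: "v = v $ a *\<^sub>R e a + v $ b *\<^sub>R e b" for v :: "real^'n"
    unfolding vec_eq_iff
  proof
    show "v $ i = (v $ a *\<^sub>R e a + v $ b *\<^sub>R e b) $ i" for i
      using ab(1,2) UNIV_I[of i] by (auto simp: e_def axis_def)
  qed
  define t where "t i j = T (e j) $ i" for i j
  have Tv: "T v = v $ a *\<^sub>R T (e a) + v $ b *\<^sub>R T (e b)" for v
    by (subst rep[of v]) (simp only: linear_add[OF T] linear_scale[OF T])
  have pv: "p v = v $ a * p (e a) + v $ b * p (e b)" for v
    by (subst rep[of v]) (simp only: linear_add[OF p] linear_scale[OF p] real_scaleR_def)
  have col: "t a j * p (e a) + t b j * p (e b) = 0" for j
    using pT[of "e j"] pv[of "T (e j)"] by (simp add: t_def)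
  have row: "y $ a * t i a + y $ b * t i b = 0" for i
    using arg_cong[OF Tv[of y], of "\<lambda>v. v $ i"] y(1) by (simp add: t_def)
  have tr: "(\<Sum>i\<in>UNIV. T (axis i 1) $ i) = t a a + t b b"
    unfolding ab(1) using ab(2) by (simp add: t_def e_def)
  \<comment> \<open>Entrywise, \<open>p y\<close> times the matrix is its trace times
    \<open>p y Id - y p\<close>. This follows polynomially from \<open>row\<close>
    (\<open>T y = 0\<close>) and \<open>col\<close> (\<open>p\<close> kills the image), without
    division.\<close>
  have q: "p y * t a a = (t a a + t b b) * (p y - p (e a) * y $ a)"
    "p y * t a b = - (t a a + t b b) * (p (e b) * y $ a)"
    "p y * t b a = - (t a a + t b b) * (p (e a) * y $ b)"
    "p y * t b b = (t a a + t b b) * (p y - p (e b) * y $ b)"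
    unfolding pv[of y] using row[of a] row[of b] col[of a] col[of b] by algebra+
  have ev: "e a $ a = 1" "e a $ b = 0" "e b $ a = 0" "e b $ b = 1"
    using ab(2) by (auto simp: e_def axis_def)
  have ij: "i = a \<or> i = b" for i using ab(1) by blast
  have key: "p y * t i j = (t a a + t b b) * (p y * e j $ i - p (e j) * y $ i)" for i j
    using ij[of i] ij[of j] by (elim disjE) (simp_all only: ev q mult_1_right mult_zero_right diff_0 mult_minus_left mult_minus_right)
  have "p y * T X $ i = p y * (t a a + t b b) * (X - (p X / p y) *\<^sub>R y) $ i" for i
  proof -
    have "p y * T X $ i = X $ a * (p y * t i a) + X $ b * (p y * t i b)"
      using arg_cong[OF Tv[of X], of "\<lambda>v. v $ i"] by (simp add: t_def algebra_simps)
    also have "\<dots> = (t a a + t b b) * (p y * (X $ a * e a $ i + X $ b * e b $ i)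
        - (X $ a * p (e a) + X $ b * p (e b)) * y $ i)"
      unfolding key by (simp add: algebra_simps)
    also have "\<dots> = (t a a + t b b) * (p y * X $ i - p X * y $ i)"
      using arg_cong[OF rep[of X], of "\<lambda>v. v $ i"] pv[of X] by simp
    also have "p y * X $ i - p X * y $ i = p y * (X - (p X / p y) *\<^sub>R y) $ i"
      using y(2) by (simp add: right_diff_distrib)
    finally show ?thesis by (simp only: mult_ac)
  qed
  then show ?thesis unfolding tr vec_eq_iff using y(2) by simp
qed

context finsler_manifold begin

lemma isotropic_dim_2:
  assumes 2: "CARD('n) = 2" shows "isotropic A S"
proof -
  let ?\<rho> = "ricci_scalar A S"
  \<comment> \<open>The factor comes from \<open>p X / p y\<close> in
    \<open>rank_one_projection\<close>, with \<open>p\<close> the vertical derivative of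
    \<open>L\<close> and hence \<open>p y = 2 L\<close>.\<close>
  let ?g = "\<lambda>u. ?\<rho> u / (2 * L u)"
  have jac: "jacobi_endo A S u X = (\<lambda>c. ?\<rho> u *\<^sub>R vert_endo u X c - (?g u * dK0 SA vert_endo L u X) *\<^sub>R liouville A u c)"
    (is "_ = ?Y") if u: "u \<in> slit_bundle A" and X: "X \<in> TS u" for u X
  proof -
    define c where "c = chart_at SA u"
    have c: "c \<in> SA" "u \<in> cdom c" using slit_chart_at[OF u] c_def by auto
    interpret P: local_finsler "cimg c" "G c" "lc c" by (rule local_finsler[OF c(1)])
    let ?z = "cmap c u" and ?X = "fst (X c)"
    have z: "?z \<in> cimg c" by (rule slit.cmap_in[OF c(2)])
    have "?\<rho> u = (\<Sum>i\<in>UNIV. P.jac (axis i 1) ?z $ i)"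
      using ricci_scalar_eq[OF u c_def] 2 by simp
    moreover have "P.jac ?X ?z = (\<Sum>i\<in>UNIV. P.jac (axis i 1) ?z $ i) *\<^sub>R
        (?X - (D (lc c) ?z (0, ?X) / D (lc c) ?z (0, snd ?z)) *\<^sub>R snd ?z)"
      by (rule rank_one_projection[OF 2 P.linear_jac[OF z]])
        (use P.L_pos[OF z] in \<open>auto simp: linearI P.D_add2[OF P.L z] P.D_scale2[OF P.L z] P.jac_snd[OF z] P.L_euler[OF z] P.L_jac[OF z]\<close>)
    ultimately have "jacobi_endo A S u X c = ?Y c"
      unfolding jacobi_comp[OF c] dK0_vert[OF smooth_L c X]
      by (simp add: vert_endo_def liouville_comp[OF c] P.L_euler[OF z] slit.cinv_cmap[OF c] scaleR_right_diff_distrib)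
    moreover have "?Y \<in> TS u"
      using slit.tangent_combine[OF vert_endo_tangent[OF X] liouville_tangent, of "?\<rho> u" "- (?g u * dK0 SA vert_endo L u X)"]
      by simp
    ultimately show ?thesis using slit.tangent_eqI[OF jacobi_tangent[OF u X] _ c] by blast
  qed
  \<comment> \<open>The Ricci scalar is a trace in a chart that varies with the point. Since
    \<open>jac\<close> is known on tangent vectors independently of charts, the trace can be
    recomputed in the fixed chart \<open>c\<close>, where it is visibly smooth.\<close>
  have "smooth_on (cimg c) (\<lambda>z. ?g (cinv c z))" if c: "c \<in> SA" for c
  proof -
    interpret P: local_finsler "cimg c" "G c" "lc c" by (rule local_finsler[OF c])
    have "smooth_on (cimg c) (\<lambda>z. \<Sum>i\<in>UNIV. P.jac (axis i 1) z $ i)"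
      by (intro smooth_on_sum smooth_on_vec_nth P.W P.smooth_jac)
    moreover have "?\<rho> (cinv c z) = (\<Sum>i\<in>UNIV. P.jac (axis i 1) z $ i)" if z: "z \<in> cimg c" for z
    proof -
      let ?u = "cinv c z"
      have u: "?u \<in> cdom c" "?u \<in> slit_bundle A" using slit.cinv_in[OF z] cdom_SA[OF c] by auto
      have "P.jac X z = ?\<rho> ?u *\<^sub>R X - (?\<rho> ?u / (2 * lc c z) * D (lc c) z (0, X)) *\<^sub>R snd z" for X
      proof -
        let ?X = "coord_vec SA c (X, 0) ?u"
        have X: "?X \<in> TS ?u" "?X c = (X, 0)" using c u by (auto simp: slit.coord_vec_tangent slit.coord_vec_self)
        show ?thesis
          using fun_cong[OF jac[OF u(2) X(1)], of c]
          unfolding jacobi_comp[OF c u(1)] dK0_vert[OF smooth_L c u(1) X(1)]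
          by (simp add: X(2) vert_endo_def liouville_comp[OF c u(1)] slit.cmap_cinv[OF z])
      qed
      then show ?thesis
        using trace_projection[of "\<lambda>X. D (lc c) z (0, X)" "snd z" "lc c z" "?\<rho> ?u"]
          P.L_euler[OF z] P.L_pos[OF z] 2
        by (simp add: linearI P.D_add2[OF P.L z] P.D_scale2[OF P.L z])
    qed
    ultimately have "smooth_on (cimg c) (\<lambda>z. ?\<rho> (cinv c z))"
      by (rule smooth_on_cong[OF _ P.W])
    moreover have "2 * lc c z \<noteq> 0" if "z \<in> cimg c" for z using P.L_pos[OF that] by simp
    ultimately show ?thesis
      by (intro smooth_on_divide smooth_on_mult smooth_on_const P.W P.L)
  qed
  then have "smooth_fun SA ?g" by (simp add: smooth_fun_def comp_def)
  from semibasic_dK0[OF smooth_L this] jac show ?thesis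
    unfolding isotropic_def isotropy_form_def by (intro exI[of _ "\<lambda>u X. ?g u * dK0 SA vert_endo L u X"]) simp
qed

end

subsection \<open>Isotropic Finsler manifolds\<close>

text \<open>Everything is derived for an arbitrary isotropy form; the choice inside
  \<open>curvature_form\<close> is substituted at the very end.\<close>

locale isotropic_finsler_manifold = finsler_manifold A S F
  for A :: "('m::topological_space, real^'n) chart set" and S F +
  fixes \<alpha> :: "(('m, real^'n) tpoint, (real^'n) \<times> (real^'n)) form1"
  assumes isotropy: "isotropy_form A S \<alpha>"
begin

abbreviation \<rho> where "\<rho> \<equiv> ricci_scalar A S"
abbreviation "\<rho>c c \<equiv> \<lambda>z. \<rho> (cinv c z)"

definition \<alpha>c :: "(('m, real^'n) tpoint, (real^'n) \<times> (real^'n)) chart \<Rightarrow> real^'n \<Rightarrow> (real^'n) \<times> (real^'n) \<Rightarrow> real" where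
  "\<alpha>c c X = (\<lambda>z. \<alpha> (cinv c z) (coord_vec SA c (X, 0) (cinv c z)))"

definition \<xi> :: "(('m, real^'n) tpoint, (real^'n) \<times> (real^'n)) form1" where
  "\<xi> u X = (1/3) * (\<alpha> u X + dK0 SA vert_endo \<rho> u X)"

lemma \<alpha>_combine:
  assumes "u \<in> slit_bundle A" "X \<in> TS u" "Y \<in> TS u"
  shows "\<alpha> u (\<lambda>c. a *\<^sub>R X c + b *\<^sub>R Y c) = a * \<alpha> u X + b * \<alpha> u Y"
  using isotropy assms unfolding isotropy_form_def semibasic1_def smooth_form1_def carrier_SA by blast

lemma \<alpha>_comp:
  assumes c: "c \<in> SA" "u \<in> cdom c" and X: "X \<in> TS u"
  shows "\<alpha> u X = \<alpha>c c (fst (X c)) (cmap c u)"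
proof -
  note u = cdom_SA[OF c]
  let ?H = "coord_vec SA c (fst (X c), 0) u" and ?V = "coord_vec SA c (0, snd (X c)) u"
  have HV: "?H \<in> TS u" "?V \<in> TS u" using c by (auto simp: slit.coord_vec_tangent)
  have "vertical A u ?V" using vertical_iff[OF HV(2) c] by (simp add: slit.coord_vec_self[OF c])
  then have "\<alpha> u ?V = 0" using isotropy u by (simp add: isotropy_form_def semibasic1_def)
  moreover have "X = (\<lambda>c'. 1 *\<^sub>R ?H c' + 1 *\<^sub>R ?V c')"
    by (rule slit.tangent_eqI[OF X slit.tangent_combine[OF HV] c]) (simp add: slit.coord_vec_self[OF c])
  ultimately have "\<alpha> u X = \<alpha> u ?H" using \<alpha>_combine[OF u HV, of 1 1] by simp
  then show ?thesis by (simp add: \<alpha>c_def slit.cinv_cmap[OF c])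
qed

lemma smooth_\<alpha>c: "c \<in> SA \<Longrightarrow> smooth_on (cimg c) (\<alpha>c c X)"
  using isotropy unfolding isotropy_form_def semibasic1_def smooth_form1_def \<alpha>c_def by blast

lemma linear_\<alpha>c:
  assumes c: "c \<in> SA" and z: "z \<in> cimg c" shows "linear (\<lambda>X. \<alpha>c c X z)"
proof -
  note u = slit.cinv_in[OF z] and us = cdom_SA[OF c slit.cinv_in[OF z]]
  have *: "\<alpha>c c (a *\<^sub>R X + b *\<^sub>R Y) z = a * \<alpha>c c X z + b * \<alpha>c c Y z" for a b X Y
    using \<alpha>_combine[OF us slit.coord_vec_tangent[OF c u] slit.coord_vec_tangent[OF c u], of a "(X, 0)" b "(Y, 0)"]
      slit.coord_vec_combine[OF c u, of a "(X, 0)" b "(Y, 0)"]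
    by (simp add: \<alpha>c_def)
  show ?thesis
    using *[of 1 _ 1] *[of _ _ 0] by (intro linearI) (metis scaleR_one mult_1, simp)
qed

lemma jac_iso:
  assumes c: "c \<in> SA" and z: "z \<in> cimg c"
  shows "jac c X z = \<rho>c c z *\<^sub>R X - \<alpha>c c X z *\<^sub>R snd z"
proof -
  note u = slit.cinv_in[OF z] and us = cdom_SA[OF c slit.cinv_in[OF z]]
  let ?X = "coord_vec SA c (X, 0) (cinv c z)"
  have X: "?X \<in> TS (cinv c z)" by (rule slit.coord_vec_tangent[OF c u])
  have "jacobi_endo A S (cinv c z) ?X c = \<rho>c c z *\<^sub>R vert_endo (cinv c z) ?X c - \<alpha> (cinv c z) ?X *\<^sub>R liouville A (cinv c z) c"
    using isotropy us X by (simp add: isotropy_form_def)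
  then show ?thesis
    unfolding jacobi_comp[OF c u] \<alpha>c_def
    by (simp add: slit.coord_vec_self[OF c u] vert_endo_def liouville_comp[OF c u] slit.cmap_cinv[OF z])
qed

text \<open>Smoothness of the Ricci scalar is deduced from that of \<open>\<alpha>\<close>: the
  Jacobi endomorphism kills the spray direction, so isotropy gives
  \<open>\<rho> = \<alpha>(S)\<close>.\<close>

lemma smooth_\<rho>c: assumes c: "c \<in> SA" shows "smooth_on (cimg c) (\<rho>c c)"
proof -
  interpret P: local_spray "cimg c" "G c" by (rule local_spray[OF c])
  have eq: "\<rho>c c z = \<alpha>c c (snd z) z" if z: "z \<in> cimg c" for z
    using jac_iso[OF c z, of "snd z"] snd_cimg[OF c z] P.jac_snd[OF z]
    by (simp add: scaleR_left_diff_distrib[symmetric])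
  have "smooth_on (cimg c) (\<lambda>z. \<alpha>c c (snd z) z)"
    by (rule smooth_on_linear_family[where g = "\<lambda>z. z" and V = "cimg c"])
      (auto intro!: smooth_intros P.W linear_\<alpha>c smooth_\<alpha>c c)
  from smooth_on_cong[OF this P.W eq] show ?thesis .
qed

lemma smooth_\<rho>: "smooth_fun SA \<rho>"
  using smooth_\<rho>c by (simp add: smooth_fun_def comp_def)

lemma local_isotropic:
  assumes c: "c \<in> SA" shows "local_isotropic_finsler (cimg c) (G c) (\<rho>c c) (\<alpha>c c) (lc c)"
proof -
  interpret P: local_finsler "cimg c" "G c" "lc c" by (rule local_finsler[OF c])
  show ?thesis
  proof (intro local_isotropic_finsler.intro local_isotropic.intro local_isotropic_axioms.intro)
    show "linear (\<lambda>X. \<alpha>c c X z)" if "z \<in> cimg c" for z by (rule linear_\<alpha>c[OF c that])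
    show "jac c X z = \<rho>c c z *\<^sub>R X - \<alpha>c c X z *\<^sub>R snd z" if "z \<in> cimg c" for z X
      by (rule jac_iso[OF c that])
    show "snd z \<noteq> 0" if "z \<in> cimg c" for z by (rule snd_cimg[OF c that])
  qed (rule smooth_\<rho>c[OF c] smooth_\<alpha>c[OF c] dim P.local_spray_axioms P.local_finsler_axioms)+
qed

abbreviation "\<xi>c c \<equiv> local_isotropic.\<xi> (\<rho>c c) (\<alpha>c c)"
abbreviation "dJ c \<equiv> local_isotropic.d\<^sub>J\<xi> (\<rho>c c) (\<alpha>c c)"
abbreviation "dh c \<equiv> local_isotropic.d\<^sub>h\<xi> (G c) (\<rho>c c) (\<alpha>c c)"

lemma \<xi>_comp:
  assumes c: "c \<in> SA" "u \<in> cdom c" and X: "X \<in> TS u"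
  shows "\<xi> u X = \<xi>c c (fst (X c)) (cmap c u)"
proof -
  interpret I: local_isotropic_finsler "cimg c" "G c" "\<rho>c c" "\<alpha>c c" "lc c" by (rule local_isotropic[OF c(1)])
  show ?thesis by (simp add: \<xi>_def \<alpha>_comp[OF c X] dK0_vert[OF smooth_\<rho> c X] I.\<xi>_def)
qed

text \<open>As \<open>\<xi>\<close> is semi-basic, \<open>i_J \<xi> = 0\<close> and
  \<open>i_h \<xi> = \<xi>\<close>. So \<open>d_J \<xi> = i_J d\<xi>\<close> and
  \<open>d_h \<xi> = i_h d\<xi> - d\<xi>\<close>, where in the latter the derivatives along the
  unprojected \<open>X\<close> and \<open>Y\<close> cancel.\<close>

lemma dK1_\<xi>:
  assumes u: "u \<in> slit_bundle A" and c: "c = chart_at SA u"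
  shows "dK1 SA vert_endo \<xi> u X Y = dJ c (fst (X c)) (fst (Y c)) (cmap c u)"
    and "dK1 SA (hor_proj A S) \<xi> u X Y = dh c (fst (X c)) (fst (Y c)) (cmap c u)"
proof -
  have cc: "c \<in> SA" "u \<in> cdom c" using slit_chart_at[OF u] c by auto
  interpret I: local_isotropic_finsler "cimg c" "G c" "\<rho>c c" "\<alpha>c c" "lc c" by (rule local_isotropic[OF cc(1)])
  note z = slit.cmap_in[OF cc(2)]
  have d\<xi>: "d1 SA \<xi> u X Y = D (I.\<xi> (fst (Y c))) (cmap c u) (X c) - D (I.\<xi> (fst (X c))) (cmap c u) (Y c)" for X Y
    by (rule d1_eq[where m = "\<lambda>z w. I.\<xi> (fst w) z", OF u c]) (rule \<xi>_comp[OF cc(1)])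
  have \<xi>0: "D (I.\<xi> 0) (cmap c u) v = 0" for v
    by (rule I.D_const_W[OF z]) (rule linear_0[OF I.linear_\<xi>])
  have "d1 SA (i1 vert_endo \<xi>) u X Y = D (I.\<xi> 0) (cmap c u) (X c) - D (I.\<xi> 0) (cmap c u) (Y c)"
    by (rule d1_eq[where m = "\<lambda>z w. I.\<xi> 0 z", OF u c])
      (unfold i1_def, subst \<xi>_comp[OF cc(1) _ vert_endo_tangent], simp_all add: vert_endo_def)
  then show "dK1 SA vert_endo \<xi> u X Y = dJ c (fst (X c)) (fst (Y c)) (cmap c u)"
    by (simp add: dK1_def i2_def d\<xi> \<xi>0 vert_endo_def I.d\<^sub>J\<xi>_def)
  have "d1 SA (i1 (hor_proj A S) \<xi>) u X Y = D (I.\<xi> (fst (Y c))) (cmap c u) (X c) - D (I.\<xi> (fst (X c))) (cmap c u) (Y c)"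
    by (rule d1_eq[where m = "\<lambda>z w. I.\<xi> (fst w) z", OF u c])
      (simp add: i1_def \<xi>_comp[OF cc(1) _ hor_proj_tangent[OF cdom_SA[OF cc(1)]]] hor_proj_comp[OF cc(1)] I.hor_def)
  then show "dK1 SA (hor_proj A S) \<xi> u X Y = dh c (fst (X c)) (fst (Y c)) (cmap c u)"
    by (simp add: dK1_def i2_def d\<xi> hor_proj_comp[OF cc] I.d\<^sub>h\<xi>_def) (simp add: I.hor_def)
qed

lemma form2_zero_dJ:
  "form2_zero SA (dK1 SA vert_endo \<xi>) \<longleftrightarrow>
    (\<forall>u\<in>slit_bundle A. \<forall>X Y. dJ (chart_at SA u) X Y (cmap (chart_at SA u) u) = 0)" (is "?l \<longleftrightarrow> ?r")
proof
  assume l: ?l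
  show ?r
  proof (intro ballI allI)
    fix u X Y assume u: "u \<in> slit_bundle A"
    let ?c = "chart_at SA u" let ?v = "\<lambda>X. coord_vec SA ?c (X, 0) u"
    have c: "?c \<in> SA" "u \<in> cdom ?c" using slit_chart_at[OF u] by auto
    have "dK1 SA vert_endo \<xi> u (?v X) (?v Y) = 0"
      using l u slit.coord_vec_tangent[OF c] by (simp add: form2_zero_def carrier_SA)
    then show "dJ ?c X Y (cmap ?c u) = 0" by (simp add: dK1_\<xi>(1)[OF u refl] slit.coord_vec_self[OF c])
  qed
qed (simp add: form2_zero_def carrier_SA dK1_\<xi>(1)[OF _ refl])

lemma form2_zero_dh:
  "form2_zero SA (dK1 SA (hor_proj A S) \<xi>) \<longleftrightarrow>
    (\<forall>u\<in>slit_bundle A. \<forall>X Y. dh (chart_at SA u) X Y (cmap (chart_at SA u) u) = 0)" (is "?l \<longleftrightarrow> ?r")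
proof
  assume l: ?l
  show ?r
  proof (intro ballI allI)
    fix u X Y assume u: "u \<in> slit_bundle A"
    let ?c = "chart_at SA u" let ?v = "\<lambda>X. coord_vec SA ?c (X, 0) u"
    have c: "?c \<in> SA" "u \<in> cdom ?c" using slit_chart_at[OF u] by auto
    have "dK1 SA (hor_proj A S) \<xi> u (?v X) (?v Y) = 0"
      using l u slit.coord_vec_tangent[OF c] by (simp add: form2_zero_def carrier_SA)
    then show "dh ?c X Y (cmap ?c u) = 0" by (simp add: dK1_\<xi>(2)[OF u refl] slit.coord_vec_self[OF c])
  qed
qed (simp add: form2_zero_def carrier_SA dK1_\<xi>(2)[OF _ refl])

lemma dh_zero_dim:
  assumes "CARD('n) > 2" shows "form2_zero SA (dK1 SA (hor_proj A S) \<xi>)"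
  unfolding form2_zero_dh
proof (intro ballI allI)
  fix u X Y assume u: "u \<in> slit_bundle A"
  let ?c = "chart_at SA u"
  have c: "?c \<in> SA" "u \<in> cdom ?c" using slit_chart_at[OF u] by auto
  interpret I: local_isotropic_finsler "cimg ?c" "G ?c" "\<rho>c ?c" "\<alpha>c ?c" "lc ?c" by (rule local_isotropic[OF c(1)])
  show "dh ?c X Y (cmap ?c u) = 0"
    using assms by (intro I.dh\<xi>_eq_0 slit.cmap_in c) simp
qed

definition \<kappa> :: "('m, real^'n) tpoint \<Rightarrow> real" where "\<kappa> u = \<rho> u / L u"

abbreviation "\<kappa>c c \<equiv> \<lambda>z. \<kappa> (cinv c z)"

lemma local_\<kappa>:
  assumes c: "c \<in> SA" shows "local_isotropic_finsler.\<kappa> (\<rho>c c) (lc c) = \<kappa>c c"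
proof -
  interpret I: local_isotropic_finsler "cimg c" "G c" "\<rho>c c" "\<alpha>c c" "lc c" by (rule local_isotropic[OF c])
  show ?thesis by (simp add: I.\<kappa>_def[abs_def] \<kappa>_def)
qed

lemma smooth_\<kappa>c: assumes c: "c \<in> SA" shows "smooth_on (cimg c) (\<kappa>c c)"
proof -
  interpret I: local_isotropic_finsler "cimg c" "G c" "\<rho>c c" "\<alpha>c c" "lc c" by (rule local_isotropic[OF c])
  show ?thesis using I.smooth_\<kappa> by (simp only: local_\<kappa>[OF c])
qed

lemma smooth_\<kappa>: "smooth_fun SA \<kappa>"
  using smooth_\<kappa>c by (simp add: smooth_fun_def comp_def)

lemma jacobi_\<kappa>:
  assumes u: "u \<in> slit_bundle A" and X: "X \<in> TS u"
  shows "jacobi_endo A S u X = (\<lambda>c. \<kappa> u *\<^sub>R (L u *\<^sub>R vert_endo u X c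
    - (F u * dK0 SA vert_endo F u X) *\<^sub>R liouville A u c))"
proof -
  obtain c where c: "c \<in> SA" "u \<in> cdom c" using slit_chart_at[OF u] by blast
  interpret I: local_isotropic_finsler "cimg c" "G c" "\<rho>c c" "\<alpha>c c" "lc c" by (rule local_isotropic[OF c(1)])
  have z: "cmap c u \<in> cimg c" by (rule slit.cmap_in[OF c(2)])
  have "\<alpha> u X = \<kappa> u * (F u * dK0 SA vert_endo F u X)"
    unfolding F_dK0[OF u X] dK0_vert[OF smooth_L c X] \<alpha>_comp[OF c X] I.\<alpha>_\<kappa>[OF z] local_\<kappa>[OF c(1)]
    by (simp add: slit.cinv_cmap[OF c])
  moreover have "\<rho> u = \<kappa> u * L u" using F_pos[OF u] by (simp add: \<kappa>_def)
  ultimately show ?thesis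
    using isotropy u X by (simp add: isotropy_form_def scaleR_right_diff_distrib)
qed

lemma constant_dJ_dh:
  assumes k: "\<And>u. u \<in> slit_bundle A \<Longrightarrow> \<kappa> u = k"
  shows "form2_zero SA (dK1 SA vert_endo \<xi>)" "form2_zero SA (dK1 SA (hor_proj A S) \<xi>)"
proof -
  have *: "dJ c X Y (cmap c u) = 0" "dh c X Y (cmap c u) = 0" if c: "c \<in> SA" "u \<in> cdom c" for c u X Y
  proof -
    interpret I: local_isotropic_finsler "cimg c" "G c" "\<rho>c c" "\<alpha>c c" "lc c" by (rule local_isotropic[OF c(1)])
    have "I.\<kappa> x = k" if "x \<in> cimg c" for x
      unfolding local_\<kappa>[OF c(1)] using that c(1) by (intro k cdom_SA[of c] slit.cinv_in)
    then show "dJ c X Y (cmap c u) = 0" "dh c X Y (cmap c u) = 0"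
      using I.const_\<xi>[OF slit.cmap_in[OF c(2)]] by blast+
  qed
  then show "form2_zero SA (dK1 SA vert_endo \<xi>)" "form2_zero SA (dK1 SA (hor_proj A S) \<xi>)"
    unfolding form2_zero_dJ form2_zero_dh using slit_chart_at by blast+
qed

subsection \<open>Vanishing of \<open>d\<^sub>J\<xi>\<close> and \<open>d\<^sub>h\<xi>\<close>\<close>

context
  assumes dJ0: "form2_zero SA (dK1 SA vert_endo \<xi>)" and dh0: "form2_zero SA (dK1 SA (hor_proj A S) \<xi>)"
begin

text \<open>\<open>\<kappa>_vert\<close> applies at one point in its selected chart. Stated as
  \<open>d_J \<kappa> = 0\<close> the result no longer refers to that chart and can be read in
  \<open>c\<close>.\<close>

lemma \<kappa>c_vert:
  assumes c: "c \<in> SA" and z: "z \<in> cimg c" shows "D (\<kappa>c c) z (0, X) = 0"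
proof -
  have dv: "dK0 SA vert_endo \<kappa> u Y = 0" if u: "u \<in> slit_bundle A" and Y: "Y \<in> TS u" for u Y
  proof -
    define c where "c = chart_at SA u"
    have c: "c \<in> SA" "u \<in> cdom c" using slit_chart_at[OF u] c_def by auto
    interpret I: local_isotropic_finsler "cimg c" "G c" "\<rho>c c" "\<alpha>c c" "lc c" by (rule local_isotropic[OF c(1)])
    have "I.d\<^sub>J\<xi> X Y (cmap c u) = 0" for X Y using dJ0 u unfolding form2_zero_dJ c_def by blast
    then show ?thesis
      using I.\<kappa>_vert[OF slit.cmap_in[OF c(2)]] by (simp add: dK0_vert[OF smooth_\<kappa> c Y] local_\<kappa>[OF c(1)])
  qed
  note u = slit.cinv_in[OF z]
  show ?thesis
    using dv[OF cdom_SA[OF c u] slit.coord_vec_tangent[OF c u, of "(X, 0)"]]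
    by (simp add: dK0_vert[OF smooth_\<kappa> c u slit.coord_vec_tangent[OF c u]] slit.coord_vec_self[OF c u] slit.cmap_cinv[OF z])
qed

lemma \<kappa>c_split:
  assumes c: "c \<in> SA" and z: "z \<in> cimg c" shows "D (\<kappa>c c) z v = D (\<kappa>c c) z (fst v, 0)"
proof -
  interpret P: local_spray "cimg c" "G c" by (rule local_spray[OF c])
  show ?thesis using P.D_split[OF smooth_\<kappa>c[OF c] z, of "fst v" "snd v"] \<kappa>c_vert[OF c z] by simp
qed

text \<open>Given vertical constancy, the hypothesis says that the differential of
  \<open>\<kappa>\<close> kills \<open>S\<close>. This form of it passes from \<open>c\<close> to
  the selected chart \<open>b\<close>, where \<open>\<kappa>_hor\<close> applies, and the conclusion
  passes back through \<open>d0\<close>.\<close>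

lemma \<kappa>c_hor:
  assumes c: "c \<in> SA" and z: "z \<in> cimg c" and 0: "D (\<kappa>c c) z (snd z, 0) = 0"
  shows "D (\<kappa>c c) z v = 0"
proof -
  note u = slit.cinv_in[OF z] and us = cdom_SA[OF c slit.cinv_in[OF z]]
  let ?u = "cinv c z"
  have "d0 SA \<kappa> ?u (S ?u) = 0"
    using slit.d0_eq[OF smooth_\<kappa> c u S_tangent[OF us]] \<kappa>c_split[OF c z, of "S ?u c"] 0
    by (simp add: slit.cmap_cinv[OF z] S_comp[OF c z])
  then have *: "d0 SA \<kappa> ?u Y = 0" if Y: "Y \<in> TS ?u" for Y
  proof -
    assume S0: "d0 SA \<kappa> ?u (S ?u) = 0"
    define b where "b = chart_at SA ?u"
    have b: "b \<in> SA" "?u \<in> cdom b" using slit_chart_at[OF us] b_def by auto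
    interpret I: local_isotropic_finsler "cimg b" "G b" "\<rho>c b" "\<alpha>c b" "lc b" by (rule local_isotropic[OF b(1)])
    have zb: "cmap b ?u \<in> cimg b" by (rule slit.cmap_in[OF b(2)])
    have "D (\<kappa>c b) (cmap b ?u) (snd (cmap b ?u), 0) = 0"
      using S0 \<kappa>c_split[OF b(1) zb, of "S ?u b"]
      by (simp add: slit.d0_eq[OF smooth_\<kappa> b S_tangent[OF us]] S_spr[OF b] I.spr_def)
    moreover have "I.d\<^sub>h\<xi> X Y (cmap b ?u) = 0" for X Y using dh0 us unfolding form2_zero_dh b_def by blast
    ultimately have "D (\<kappa>c b) (cmap b ?u) (X, 0) = 0" for X
      using I.\<kappa>_hor[OF zb] \<kappa>c_vert[OF b(1)] by (simp add: local_\<kappa>[OF b(1)])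
    then show ?thesis
      unfolding slit.d0_eq[OF smooth_\<kappa> b Y] \<kappa>c_split[OF b(1) zb, of "Y b"] .
  qed
  show ?thesis
    using *[OF slit.coord_vec_tangent[OF c u, of v]]
    by (simp add: slit.d0_eq[OF smooth_\<kappa> c u slit.coord_vec_tangent[OF c u]] slit.coord_vec_self[OF c u] slit.cmap_cinv[OF z])
qed

text \<open>In dimension at least two a fibre without its origin is connected, so the vanishing
  vertical derivative integrates.\<close>

lemma \<kappa>c_fibre:
  assumes c: "c \<in> A" and x: "x \<in> cimg c" and y: "y \<noteq> 0" "y' \<noteq> 0"
  shows "\<kappa>c (slc c) (x, y) = \<kappa>c (slc c) (x, y')"
proof -
  have cs: "slc c \<in> SA" using c by (simp add: slit_atlas_def)
  have "((\<lambda>y. \<kappa>c (slc c) (x, y)) has_derivative (\<lambda>h. 0)) (at y)" if "y \<in> - {0}" for y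
  proof -
    have z: "(x, y) \<in> cimg (slc c)" using that x by (simp add: cimg_slc[OF c])
    have "((\<lambda>y. (x, y)) has_derivative (\<lambda>h. (0, h))) (at y)" by (auto intro!: derivative_eq_intros)
    from has_derivative_compose[OF this has_derivative_D[OF smooth_on_differentiable[OF smooth_\<kappa>c[OF cs] z]]]
    show ?thesis unfolding \<kappa>c_vert[OF cs z] .
  qed
  moreover have "connected (- {0 :: real^'n})"
    using dim by (intro connected_punctured_universe) simp
  ultimately show ?thesis
    using y by (intro has_derivative_zero_unique_connected[of "- {0}" "\<lambda>y. \<kappa>c (slc c) (x, y)" y y']) auto
qed

text \<open>\<open>\<kappa>\<close> lives on \<open>M\<close>, and \<open>\<kappa>c_hor\<close> makes its differential at \<open>x\<close> vanish as soon as it vanishes on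
  some \<open>y' \<noteq> 0\<close>, which exists in dimension at least two.\<close>

lemma D_\<kappa>c:
  assumes c: "c \<in> A" and z: "z \<in> cimg (slc c)" shows "D (\<kappa>c (slc c)) z v = 0"
proof -
  have cs: "slc c \<in> SA" using c by (simp add: slit_atlas_def)
  obtain x y where xy: "z = (x, y)" "x \<in> cimg c" "y \<noteq> 0" using z by (auto simp: cimg_slc[OF c])
  define \<delta> where "\<delta> y X = D (\<kappa>c (slc c)) (x, y) (X, 0)" for y X
  have same: "\<delta> y' X = \<delta> y X" if "y' \<noteq> 0" for y' X
  proof -
    have *: "D (\<lambda>x. \<kappa>c (slc c) (x, y')) x X = \<delta> y' X" if "y' \<noteq> 0" for y'
    proof -
      have z: "(x, y') \<in> cimg (slc c)" using that xy by (simp add: cimg_slc[OF c])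
      have "((\<lambda>x. (x, y')) has_derivative (\<lambda>h. (h, 0))) (at x)" by (auto intro!: derivative_eq_intros)
      from has_derivative_compose[OF this has_derivative_D[OF smooth_on_differentiable[OF smooth_\<kappa>c[OF cs] z]]]
      show ?thesis unfolding \<delta>_def by (rule fun_cong[OF D_eq])
    qed
    have "D (\<lambda>x. \<kappa>c (slc c) (x, y')) x = D (\<lambda>x. \<kappa>c (slc c) (x, y)) x"
      by (rule D_cong_open[OF base.open_cimg[OF c] xy(2)]) (rule \<kappa>c_fibre[OF c _ that xy(3)])
    then show ?thesis using *[OF that] *[OF xy(3)] by simp
  qed
  have lin: "linear (\<delta> y)"
  proof -
    have l: "linear (D (\<kappa>c (slc c)) (x, y))"
      using z xy by (intro D_linear smooth_on_differentiable[OF smooth_\<kappa>c[OF cs]]) simp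
    show ?thesis
      using linear_add[OF l, of "(_, 0)" "(_, 0)"] linear_scale[OF l, of _ "(_, 0)"]
      by (auto intro!: linearI simp: \<delta>_def)
  qed
  \<comment> \<open>Either \<open>y\<close> itself lies in the kernel of \<open>\<delta> y\<close>,
    or a vector off its line does after subtracting a multiple of \<open>y\<close>.\<close>
  have "\<exists>y'. y' \<noteq> 0 \<and> \<delta> y y' = 0"
  proof (cases "\<delta> y y = 0")
    case False
    obtain X where X: "\<And>r. X \<noteq> r *\<^sub>R y" using ex_not_in_line[OF dim] by metis
    then have "X - (\<delta> y X / \<delta> y y) *\<^sub>R y \<noteq> 0" by simp
    moreover have "\<delta> y (X - (\<delta> y X / \<delta> y y) *\<^sub>R y) = 0"
      using False by (simp add: linear_diff[OF lin] linear_scale[OF lin])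
    ultimately show ?thesis by blast
  qed (use xy in blast)
  then obtain y' where y': "y' \<noteq> 0" "\<delta> y y' = 0" by blast
  have z': "(x, y') \<in> cimg (slc c)" using y' xy by (simp add: cimg_slc[OF c])
  \<comment> \<open>Moving along the fibre to \<open>y'\<close> leaves the functional unchanged by
    \<open>same\<close>, and there it kills the fibre coordinate itself, as
    \<open>\<kappa>c_hor\<close> demands.\<close>
  have 0: "D (\<kappa>c (slc c)) (x, y') (snd (x, y'), 0) = 0"
    using y'(2) unfolding same[OF y'(1), of y', symmetric] by (simp only: \<delta>_def snd_conv)
  have "\<delta> y (fst v) = 0"
    unfolding same[OF y'(1), symmetric] unfolding \<delta>_def by (rule \<kappa>c_hor[OF cs z' 0])
  then show ?thesis unfolding \<kappa>c_split[OF cs z, of v] unfolding \<delta>_def xy(1) .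
qed

lemma \<kappa>_locally_constant:
  "\<exists>V. open V \<and> p \<in> V \<and> (\<forall>u\<in>slit_bundle A. \<forall>v\<in>slit_bundle A. fst u \<in> V \<longrightarrow> fst v \<in> V \<longrightarrow> \<kappa> u = \<kappa> v)"
proof -
  obtain c where c: "c \<in> A" "p \<in> cdom c" using carrier_A unfolding carrier_of_def by blast
  then have cs: "slc c \<in> SA" by (simp add: slit_atlas_def)
  have h: "homeomorphism (cdom c) (cimg c) (cmap c) (cinv c)" "open (cdom c)"
    using smooth_atlas c by (auto simp: smooth_atlas_def)
  obtain r where r: "r > 0" "ball (cmap c p) r \<subseteq> cimg c"
    using base.open_cimg[OF c(1)] base.cmap_in[OF c(2)] openE by blast
  let ?V = "cdom c \<inter> cmap c -` ball (cmap c p) r" and ?O = "ball (cmap c p) r \<times> (- {0 :: real^'n})"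
  have eq: "\<kappa> u = \<kappa> v" if uv: "u \<in> slit_bundle A" "v \<in> slit_bundle A" "fst u \<in> ?V" "fst v \<in> ?V" for u v
  proof -
    have O: "open ?O" "connected ?O"
      using dim by (auto intro!: open_Times connected_Times convex_connected connected_punctured_universe)
    have mem: "u \<in> cdom (slc c)" "v \<in> cdom (slc c)" "cmap (slc c) u \<in> ?O" "cmap (slc c) v \<in> ?O"
      using uv slit_nonzero[OF _ c(1)] by (auto simp: cdom_slc cmap_slc)
    have "(\<kappa>c (slc c) has_derivative (\<lambda>v. 0)) (at z)" if "z \<in> ?O" for z
    proof -
      have z: "z \<in> cimg (slc c)" using that r by (auto simp: cimg_slc[OF c(1)])
      have "D (\<kappa>c (slc c)) z = (\<lambda>v. 0)" by (rule ext) (rule D_\<kappa>c[OF c(1) z])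
      then show ?thesis
        using has_derivative_D[OF smooth_on_differentiable[OF smooth_\<kappa>c[OF cs] z]] by simp
    qed
    from has_derivative_zero_unique_connected[OF O this mem(3,4)] show ?thesis
      by (simp add: slit.cinv_cmap[OF cs] mem)
  qed
  have "open ?V"
    using h by (auto simp: homeomorphism_def intro: continuous_open_preimage)
  moreover have "p \<in> ?V" using c(2) r(1) by simp
  ultimately show ?thesis using eq by blast
qed

text \<open>Local constancy at a base point includes independence of the vector over it. Picking a
  nonzero vector over each point turns \<open>\<kappa>\<close> into a locally constant function on
  the connected base.\<close>

lemma \<kappa>_constant:
  assumes conn: "connected (UNIV :: 'm set)"
  shows "\<exists>k. \<forall>u\<in>slit_bundle A. \<kappa> u = k"
proof -
  have ex: "\<exists>u\<in>slit_bundle A. fst u = p" for p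
  proof -
    obtain c where c: "c \<in> A" "p \<in> cdom c" using carrier_A unfolding carrier_of_def by blast
    have "axis undefined 1 \<noteq> (0 :: real^'n)" by simp
    from coord_vec_slit[OF c this] show ?thesis by (force simp: cdom_slc)
  qed
  then obtain pick where pick: "\<And>p. pick p \<in> slit_bundle A" "\<And>p. fst (pick p) = p" by metis
  define f where "f p = \<kappa> (pick p)" for p
  have f: "f (fst u) = \<kappa> u" if "u \<in> slit_bundle A" for u
    using \<kappa>_locally_constant[of "fst u"] pick[of "fst u"] that unfolding f_def by metis
  have "f p = f q" for p q
  proof (rule connected_local_const[OF conn])
    show "\<forall>a\<in>UNIV. \<forall>\<^sub>F b in at a. f a = f b"
    proof
      fix a
      obtain V where V: "open V" "a \<in> V"
        "\<And>u v. u \<in> slit_bundle A \<Longrightarrow> v \<in> slit_bundle A \<Longrightarrow> fst u \<in> V \<Longrightarrow> fst v \<in> V \<Longrightarrow> \<kappa> u = \<kappa> v"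
        using \<kappa>_locally_constant[of a] by blast
      have "f a = f b" if "b \<in> V" for b
        unfolding f_def by (rule V(3)) (simp_all add: pick V(2) that)
      then show "\<forall>\<^sub>F b in at a. f a = f b"
        using V(1,2) unfolding eventually_at_topological by blast
    qed
  qed auto
  then show ?thesis using f by metis
qed

end

end

theorem theorem3p1:
  fixes A :: "('m::{t2_space,second_countable_topology}, real^'n) chart set"
    and F :: "('m, real^'n) tpoint \<Rightarrow> real"
    and S :: "(('m, real^'n) tpoint, (real^'n) \<times> (real^'n)) vfield"
  assumes "smooth_atlas A"
    and "connected (UNIV :: 'm set)"
    and "CARD('n) > 1"
    and "finsler_metric A F"
    and "geodesic_spray A F S"
  shows "(constant_flag_curvature A F S \<longleftrightarrow>
            isotropic A S \<and>
            form2_zero (slit_atlas A) (dK1 (slit_atlas A) vert_endo (curvature_form A S)) \<and>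
            form2_zero (slit_atlas A) (dK1 (slit_atlas A) (hor_proj A S) (curvature_form A S))) \<and>
         (CARD('n) = 2 \<longrightarrow> isotropic A S) \<and>
         (CARD('n) > 2 \<longrightarrow> isotropic A S \<longrightarrow>
            form2_zero (slit_atlas A) (dK1 (slit_atlas A) (hor_proj A S) (curvature_form A S)))"
proof -
  interpret F: finsler_manifold A S F
    by unfold_locales (use assms in \<open>auto simp: geodesic_spray_def\<close>)
  define \<alpha> where "\<alpha> = (SOME \<alpha>. isotropy_form A S \<alpha>)"
  have iso: "isotropic_finsler_manifold A S F \<alpha>" if "isotropic A S"
  proof
    show "isotropy_form A S \<alpha>" using that unfolding isotropic_def \<alpha>_def by (rule someI_ex)
  qed
  have \<xi>: "curvature_form A S = isotropic_finsler_manifold.\<xi> A S \<alpha>" if "isotropic A S"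
    using isotropic_finsler_manifold.\<xi>_def[OF iso[OF that]] by (simp add: fun_eq_iff curvature_form_def \<alpha>_def)
  have "isotropic A S \<and>
      form2_zero (slit_atlas A) (dK1 (slit_atlas A) vert_endo (curvature_form A S)) \<and>
      form2_zero (slit_atlas A) (dK1 (slit_atlas A) (hor_proj A S) (curvature_form A S))"
    if cc: "constant_flag_curvature A F S"
  proof -
    obtain \<kappa> k where \<kappa>: "scalar_flag_curvature A F S \<kappa>" "\<And>u. u \<in> slit_bundle A \<Longrightarrow> \<kappa> u = k"
      using cc unfolding constant_flag_curvature_def by blast
    have iso_S: "isotropic A S" using F.constant_curvature_isotropy(2)[OF \<kappa>] unfolding isotropic_def by blast
    interpret I: isotropic_finsler_manifold A S F \<alpha> by (rule iso[OF iso_S])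
    have "I.\<kappa> u = k" if "u \<in> slit_bundle A" for u
      using F.constant_curvature_isotropy(1)[OF \<kappa> that] F.F_pos[OF that] by (simp add: I.\<kappa>_def)
    then show ?thesis using iso_S I.constant_dJ_dh unfolding \<xi>[OF iso_S] by blast
  qed
  moreover have "constant_flag_curvature A F S"
    if iso_S: "isotropic A S"
      and J: "form2_zero (slit_atlas A) (dK1 (slit_atlas A) vert_endo (curvature_form A S))"
      and h: "form2_zero (slit_atlas A) (dK1 (slit_atlas A) (hor_proj A S) (curvature_form A S))"
  proof -
    interpret I: isotropic_finsler_manifold A S F \<alpha> by (rule iso[OF iso_S])
    obtain k where k: "\<And>u. u \<in> slit_bundle A \<Longrightarrow> I.\<kappa> u = k"
      using I.\<kappa>_constant[OF J[unfolded \<xi>[OF iso_S]] h[unfolded \<xi>[OF iso_S]] assms(2)] by blast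
    \<comment> \<open>The constant function serves as witness: its smoothness and 0-homogeneity are
      immediate, and it agrees with \<open>I.\<kappa>\<close> on the slit bundle.\<close>
    have "scalar_flag_curvature A F S (\<lambda>_. k)"
      unfolding scalar_flag_curvature_def
      using assms(5) I.jacobi_\<kappa> k by (simp add: smooth_fun_def comp_def smooth_on_const)
    then show ?thesis unfolding constant_flag_curvature_def by blast
  qed
  moreover have "form2_zero (slit_atlas A) (dK1 (slit_atlas A) (hor_proj A S) (curvature_form A S))"
    if "CARD('n) > 2" "isotropic A S"
    using isotropic_finsler_manifold.dh_zero_dim[OF iso[OF that(2)] that(1)] by (simp add: \<xi>[OF that(2)])
  ultimately show ?thesis using F.isotropic_dim_2 by blast
qed

end
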